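(* Let $\mathcal A$ be a small category and $G$ a crossed $\mathcal A$-group. Then the forgetful functor $U^G_{\mathcal A}:\mathbf{CrsMon}^{/G}_{\mathcal A}\to\mathbf{Set}^{/G}_{\mathcal A}$ admits a left adjoint $F^G_{\mathcal A}$, and the adjunction $F^G_{\mathcal A}\dashv U^G_{\mathcal A}$ is monadic. Moreover, the associated monad on $\mathbf{Set}^{/G}_{\mathcal A}$ is finitary; i.e. it commutes with filtered colimits. Consequently, the category $\mathbf{CrsMon}^{/G}_{\mathcal A}$ is locally presentable.
   Context: **Crossed groups.** Let $\mathcal A$ be a small category. An $\mathcal A$-set is a presheaf of sets on $\mathcal A$; they form $\mathbf{Set}_{\mathcal A}$. A crossed $\mathcal A$-group is an $\mathcal A$-set $G$ together with a group structure on each $G(a)$ and a left action $G(b)\times\mathcal A(a,b)\to\mathcal A(a,b)$, $(x,\varphi)\mapsto\varphi^x$, of the group $G(b)$ for all $a,b$, such that: (i) $(\psi\varphi)^x=\psi^x\varphi^{\psi^\ast(x)}$ for $\varphi:a\to b$, $\psi:b\to c$, $x\in G(c)$; (ii) $\varphi^\ast(xy)=(\varphi^y)^\ast(x)\varphi^\ast(y)$ for $\varphi:a\to b$, $x,y\in G(b)$. A map of crossed $\mathcal A$-groups is a map of $\mathcal A$-sets which is degreewise a group homomorphism and respects the actions on the $\mathcal A(a,b)$. The category $\mathbf{CrsGrp}_{\mathcal A}$ of crossed $\mathcal A$-groups has a terminal object, denoted $\mathfrak T_{\mathcal A}$. **Monoidal structure.** For a crossed $\mathcal A$-group $G$, $\mathbf{Set}^{/G}_{\mathcal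 A}$ is the category of $\mathcal A$-sets over (the underlying $\mathcal A$-set of) $G$. For $p:X\to G$ in it, $x\in X(b)$ and $\varphi:a\to b$, write $\varphi^x:=\varphi^{p(x)}$. For $p:X\to G$, $q:Y\to G$ define $X\rtimes_G Y$ by $(X\rtimes_G Y)(a)=X(a)\times Y(a)$, $\varphi^\ast(x,y)=((\varphi^y)^\ast(x),\varphi^\ast(y))$, with structure map $(x,y)\mapsto p(x)q(y)$ to $G$. This is a monoidal structure on $\mathbf{Set}^{/G}_{\mathcal A}$, with degreewise canonical associativity, whose unit is the terminal $\mathcal A$-set $\ast$ with the map $\ast\to G$ picking out the unit elements. **Crossed monoids.** $\mathbf{CrsMon}_{\mathcal A}$ is the category of monoid objects in $(\mathbf{Set}^{/\mathfrak T_{\mathcal A}}_{\mathcal A},\rtimes_{\mathfrak T_{\mathcal A}})$; its objects are called crossed $\mathcal A$-monoids. Every crossed $\mathcal A$-group is a crossed $\mathcal A$-monoid via the unique map to $\mathfrak T_{\mathcal A}$ and its degreewise multiplication. $\mathbf{CrsMon}^{/G}_{\mathcal A}$ is the slice category over $G$; the forgetful functor to $\mathbf{Set}^{/G}_{\mathcal A}$ forgets the monoid structure. *)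

theory Defs
  imports "HOL-Algebra.Group_Action"
begin

unbundle cardinal_syntax

section \<open>Size\<close>

text \<open>
  ``Sets'' are modelled by the subsets of a type \<open>'u\<close> of cardinality less than
  \<open>\<kappa> = |UNIV :: 'u set|\<close>, and ``small'' means of cardinality less than \<open>\<kappa>\<close>.
  The only requirement imposed throughout is that \<open>\<kappa>\<close> is regular and uncountable. If \<open>\<kappa>\<close> is in
  addition a strong limit, it is strongly inaccessible and the category of these sets
  is (equivalent to) the category of sets of a Grothendieck universe.
\<close>

definition small :: "'u itself \<Rightarrow> 'x set \<Rightarrow> bool" where
  "small U S \<longleftrightarrow> |S| <o |UNIV :: 'u set|"

definition universe :: "'u itself \<Rightarrow> bool" where
  "universe U \<longleftrightarrow> regularCard |UNIV :: 'u set| \<and> natLeq <o |UNIV :: 'u set|"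

definition strong_limit :: "'u itself \<Rightarrow> bool" where
  "strong_limit U \<longleftrightarrow> (\<forall>S :: 'u set. small U S \<longrightarrow> small U (Pow S))"


section \<open>Categories, functors, adjunctions\<close>

text \<open>
  Hom-sets of different pairs of objects need not be disjoint; so composition is indexed by
  the three objects involved, and \<open>Comp C a b c g f\<close> is the composite of \<open>f : a \<rightarrow> b\<close>
  and \<open>g : b \<rightarrow> c\<close>.
\<close>

record ('x, 'f) cat =
  Obj :: "'x set"
  Hom :: "'x \<Rightarrow> 'x \<Rightarrow> 'f set"
  Id :: "'x \<Rightarrow> 'f"
  Comp :: "'x \<Rightarrow> 'x \<Rightarrow> 'x \<Rightarrow> 'f \<Rightarrow> 'f \<Rightarrow> 'f"

locale category =
  fixes C :: "('x, 'f) cat"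
  assumes Id_in_Hom: "a \<in> Obj C \<Longrightarrow> Id C a \<in> Hom C a a"
    and Comp_in_Hom: "\<lbrakk>a \<in> Obj C; b \<in> Obj C; c \<in> Obj C; f \<in> Hom C a b; g \<in> Hom C b c\<rbrakk>
      \<Longrightarrow> Comp C a b c g f \<in> Hom C a c"
    and Comp_Id_right: "\<lbrakk>a \<in> Obj C; b \<in> Obj C; f \<in> Hom C a b\<rbrakk> \<Longrightarrow> Comp C a a b f (Id C a) = f"
    and Comp_Id_left: "\<lbrakk>a \<in> Obj C; b \<in> Obj C; f \<in> Hom C a b\<rbrakk> \<Longrightarrow> Comp C a b b (Id C b) f = f"
    and Comp_assoc: "\<lbrakk>a \<in> Obj C; b \<in> Obj C; c \<in> Obj C; d \<in> Obj C;
        f \<in> Hom C a b; g \<in> Hom C b c; h \<in> Hom C c d\<rbrakk>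
      \<Longrightarrow> Comp C a b d (Comp C b c d h g) f = Comp C a c d h (Comp C a b c g f)"

definition locally_small :: "'u itself \<Rightarrow> ('x, 'f) cat \<Rightarrow> bool" where
  "locally_small U C \<longleftrightarrow> (\<forall>a \<in> Obj C. \<forall>b \<in> Obj C. small U (Hom C a b))"

definition small_category :: "'u itself \<Rightarrow> ('x, 'f) cat \<Rightarrow> bool" where
  "small_category U C \<longleftrightarrow> category C \<and> small U (Obj C) \<and> locally_small U C"

definition terminal :: "('x, 'f) cat \<Rightarrow> 'x \<Rightarrow> bool" where
  "terminal C t \<longleftrightarrow> t \<in> Obj C \<and> (\<forall>x \<in> Obj C. \<exists>!f. f \<in> Hom C x t)"

definition is_iso :: "('x, 'f) cat \<Rightarrow> 'x \<Rightarrow> 'x \<Rightarrow> 'f \<Rightarrow> bool" where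
  "is_iso C a b f \<longleftrightarrow> f \<in> Hom C a b \<and>
     (\<exists>g \<in> Hom C b a. Comp C a b a g f = Id C a \<and> Comp C b a b f g = Id C b)"

definition slice :: "('x, 'f) cat \<Rightarrow> 'x \<Rightarrow> ('x \<times> 'f, 'f) cat" where
  "slice C c = \<lparr>
     Obj = {(x, p). x \<in> Obj C \<and> p \<in> Hom C x c},
     Hom = (\<lambda>(x, p) (y, q). {f \<in> Hom C x y. Comp C x y c q f = p}),
     Id = (\<lambda>(x, p). Id C x),
     Comp = (\<lambda>(x, p) (y, q) (z, r). Comp C x y z)\<rparr>"

record ('x, 'f, 'y, 'g) func =
  FObj :: "'x \<Rightarrow> 'y"
  FArr :: "'x \<Rightarrow> 'x \<Rightarrow> 'f \<Rightarrow> 'g"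

definition is_functor :: "('x, 'f) cat \<Rightarrow> ('y, 'g) cat \<Rightarrow> ('x, 'f, 'y, 'g) func \<Rightarrow> bool" where
  "is_functor C D F \<longleftrightarrow> category C \<and> category D \<and>
     (\<forall>a \<in> Obj C. FObj F a \<in> Obj D) \<and>
     (\<forall>a \<in> Obj C. \<forall>b \<in> Obj C. \<forall>f \<in> Hom C a b. FArr F a b f \<in> Hom D (FObj F a) (FObj F b)) \<and>
     (\<forall>a \<in> Obj C. FArr F a a (Id C a) = Id D (FObj F a)) \<and>
     (\<forall>a \<in> Obj C. \<forall>b \<in> Obj C. \<forall>c \<in> Obj C. \<forall>f \<in> Hom C a b. \<forall>g \<in> Hom C b c.
        FArr F a c (Comp C a b c g f)
          = Comp D (FObj F a) (FObj F b) (FObj F c) (FArr F b c g) (FArr F a b f))"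

definition id_func :: "('x, 'f, 'x, 'f) func" where
  "id_func = \<lparr>FObj = (\<lambda>x. x), FArr = (\<lambda>x y f. f)\<rparr>"

definition comp_func ::
  "('y, 'g, 'z, 'h) func \<Rightarrow> ('x, 'f, 'y, 'g) func \<Rightarrow> ('x, 'f, 'z, 'h) func" where
  "comp_func G F = \<lparr>
     FObj = (\<lambda>x. FObj G (FObj F x)),
     FArr = (\<lambda>x y f. FArr G (FObj F x) (FObj F y) (FArr F x y f))\<rparr>"

definition nat_trans :: "('x, 'f) cat \<Rightarrow> ('y, 'g) cat \<Rightarrow>
    ('x, 'f, 'y, 'g) func \<Rightarrow> ('x, 'f, 'y, 'g) func \<Rightarrow> ('x \<Rightarrow> 'g) \<Rightarrow> bool" where
  "nat_trans C D F G \<eta> \<longleftrightarrow>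
     (\<forall>x \<in> Obj C. \<eta> x \<in> Hom D (FObj F x) (FObj G x)) \<and>
     (\<forall>x \<in> Obj C. \<forall>y \<in> Obj C. \<forall>f \<in> Hom C x y.
        Comp D (FObj F x) (FObj F y) (FObj G y) (\<eta> y) (FArr F x y f)
          = Comp D (FObj F x) (FObj G x) (FObj G y) (FArr G x y f) (\<eta> x))"

definition nat_iso :: "('x, 'f) cat \<Rightarrow> ('y, 'g) cat \<Rightarrow>
    ('x, 'f, 'y, 'g) func \<Rightarrow> ('x, 'f, 'y, 'g) func \<Rightarrow> ('x \<Rightarrow> 'g) \<Rightarrow> bool" where
  "nat_iso C D F G \<eta> \<longleftrightarrow> nat_trans C D F G \<eta> \<and>
     (\<forall>x \<in> Obj C. is_iso D (FObj F x) (FObj G x) (\<eta> x))"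

definition equivalence :: "('x, 'f) cat \<Rightarrow> ('y, 'g) cat \<Rightarrow> ('x, 'f, 'y, 'g) func \<Rightarrow> bool" where
  "equivalence C D F \<longleftrightarrow> is_functor C D F \<and>
     (\<exists>G \<alpha> \<beta>. is_functor D C G \<and>
        nat_iso C C id_func (comp_func G F) \<alpha> \<and>
        nat_iso D D (comp_func F G) id_func \<beta>)"

text \<open>\<open>F : C \<rightarrow> D\<close> is left adjoint to \<open>U : D \<rightarrow> C\<close> with unit \<open>\<eta>\<close> and counit \<open>\<epsilon>\<close>.\<close>

definition adjunction :: "('x, 'f) cat \<Rightarrow> ('y, 'g) cat \<Rightarrow> ('x, 'f, 'y, 'g) func \<Rightarrow>
    ('y, 'g, 'x, 'f) func \<Rightarrow> ('x \<Rightarrow> 'f) \<Rightarrow> ('y \<Rightarrow> 'g) \<Rightarrow> bool" where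
  "adjunction C D F U \<eta> \<epsilon> \<longleftrightarrow> is_functor C D F \<and> is_functor D C U \<and>
     nat_trans C C id_func (comp_func U F) \<eta> \<and>
     nat_trans D D (comp_func F U) id_func \<epsilon> \<and>
     (\<forall>x \<in> Obj C.
        Comp D (FObj F x) (FObj F (FObj U (FObj F x))) (FObj F x)
          (\<epsilon> (FObj F x)) (FArr F x (FObj U (FObj F x)) (\<eta> x)) = Id D (FObj F x)) \<and>
     (\<forall>y \<in> Obj D.
        Comp C (FObj U y) (FObj U (FObj F (FObj U y))) (FObj U y)
          (FArr U (FObj F (FObj U y)) y (\<epsilon> y)) (\<eta> (FObj U y)) = Id C (FObj U y))"

text \<open>The Eilenberg--Moore category of the monad \<open>(T, \<eta>, \<mu>)\<close> on \<open>C\<close>.\<close>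

definition em_cat :: "('x, 'f) cat \<Rightarrow> ('x, 'f, 'x, 'f) func \<Rightarrow> ('x \<Rightarrow> 'f) \<Rightarrow> ('x \<Rightarrow> 'f) \<Rightarrow>
    ('x \<times> 'f, 'f) cat" where
  "em_cat C T \<eta> \<mu> = \<lparr>
     Obj = {(x, h). x \<in> Obj C \<and> h \<in> Hom C (FObj T x) x \<and>
       Comp C x (FObj T x) x h (\<eta> x) = Id C x \<and>
       Comp C (FObj T (FObj T x)) (FObj T x) x h (FArr T (FObj T x) x h)
         = Comp C (FObj T (FObj T x)) (FObj T x) x h (\<mu> x)},
     Hom = (\<lambda>(x, h) (y, k). {f \<in> Hom C x y.
       Comp C (FObj T x) x y f h = Comp C (FObj T x) (FObj T y) y k (FArr T x y f)}),
     Id = (\<lambda>(x, h). Id C x),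
     Comp = (\<lambda>(x, h) (y, k) (z, l). Comp C x y z)\<rparr>"

definition comparison :: "('x, 'f, 'y, 'g) func \<Rightarrow> ('y, 'g, 'x, 'f) func \<Rightarrow> ('y \<Rightarrow> 'g) \<Rightarrow>
    ('y, 'g, 'x \<times> 'f, 'f) func" where
  "comparison F U \<epsilon> = \<lparr>
     FObj = (\<lambda>y. (FObj U y, FArr U (FObj F (FObj U y)) y (\<epsilon> y))),
     FArr = FArr U\<rparr>"

definition monadic :: "('x, 'f) cat \<Rightarrow> ('y, 'g) cat \<Rightarrow> ('x, 'f, 'y, 'g) func \<Rightarrow>
    ('y, 'g, 'x, 'f) func \<Rightarrow> ('x \<Rightarrow> 'f) \<Rightarrow> ('y \<Rightarrow> 'g) \<Rightarrow> bool" where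
  "monadic C D F U \<eta> \<epsilon> \<longleftrightarrow>
     equivalence D
       (em_cat C (comp_func U F) \<eta>
         (\<lambda>x. FArr U (FObj F (FObj U (FObj F x))) (FObj F x) (\<epsilon> (FObj F x))))
       (comparison F U \<epsilon>)"


section \<open>Colimits and local presentability\<close>

definition cocone :: "('i, 'j) cat \<Rightarrow> ('x, 'f) cat \<Rightarrow> ('i, 'j, 'x, 'f) func \<Rightarrow> 'x \<Rightarrow>
    ('i \<Rightarrow> 'f) \<Rightarrow> bool" where
  "cocone J C D c \<iota> \<longleftrightarrow> c \<in> Obj C \<and> (\<forall>i \<in> Obj J. \<iota> i \<in> Hom C (FObj D i) c) \<and>
     (\<forall>i \<in> Obj J. \<forall>j \<in> Obj J. \<forall>f \<in> Hom J i j.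
        Comp C (FObj D i) (FObj D j) c (\<iota> j) (FArr D i j f) = \<iota> i)"

definition is_colimit :: "('i, 'j) cat \<Rightarrow> ('x, 'f) cat \<Rightarrow> ('i, 'j, 'x, 'f) func \<Rightarrow> 'x \<Rightarrow>
    ('i \<Rightarrow> 'f) \<Rightarrow> bool" where
  "is_colimit J C D c \<iota> \<longleftrightarrow> cocone J C D c \<iota> \<and>
     (\<forall>d \<kappa>. cocone J C D d \<kappa> \<longrightarrow>
        (\<exists>!f. f \<in> Hom C c d \<and> (\<forall>i \<in> Obj J. Comp C (FObj D i) c d f (\<iota> i) = \<kappa> i)))"

text \<open>
  For a regular cardinal \<open>r\<close>; ordinary filteredness is the case \<open>r = natLeq\<close>.
  Nonemptiness is the case \<open>S = {}\<close> of the first condition.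
\<close>

definition filtered :: "'k rel \<Rightarrow> ('i, 'j) cat \<Rightarrow> bool" where
  "filtered r J \<longleftrightarrow>
     (\<forall>S. S \<subseteq> Obj J \<and> |S| <o r \<longrightarrow> (\<exists>c \<in> Obj J. \<forall>a \<in> S. Hom J a c \<noteq> {})) \<and>
     (\<forall>a \<in> Obj J. \<forall>b \<in> Obj J. \<forall>F. F \<subseteq> Hom J a b \<and> |F| <o r \<longrightarrow>
        (\<exists>c \<in> Obj J. \<exists>h \<in> Hom J b c. \<forall>f \<in> F. \<forall>g \<in> F. Comp J a b c h f = Comp J a b c h g))"

text \<open>
  Every small category is isomorphic to one whose objects and arrows are elements of \<open>'u\<close>, so
  below it suffices to let the index categories range over the type \<open>('u, 'u) cat\<close>.
\<close>

definition cocomplete :: "'u itself \<Rightarrow> ('x, 'f) cat \<Rightarrow> bool" where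
  "cocomplete U C \<longleftrightarrow> (\<forall>(J :: ('u, 'u) cat) D. small_category U J \<and> is_functor J C D \<longrightarrow>
     (\<exists>c \<iota>. is_colimit J C D c \<iota>))"

definition preserves_filtered_colimits :: "'u itself \<Rightarrow> 'k rel \<Rightarrow> ('x, 'f) cat \<Rightarrow> ('y, 'g) cat \<Rightarrow>
    ('x, 'f, 'y, 'g) func \<Rightarrow> bool" where
  "preserves_filtered_colimits U r C C' T \<longleftrightarrow>
     (\<forall>(J :: ('u, 'u) cat) D c \<iota>.
        small_category U J \<and> filtered r J \<and> is_functor J C D \<and> is_colimit J C D c \<iota> \<longrightarrow>
        is_colimit J C' (comp_func T D) (FObj T c) (\<lambda>i. FArr T (FObj D i) c (\<iota> i)))"

definition finitary :: "'u itself \<Rightarrow> ('x, 'f) cat \<Rightarrow> ('x, 'f, 'x, 'f) func \<Rightarrow> bool" where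
  "finitary U C T \<longleftrightarrow> preserves_filtered_colimits U natLeq C C T"

definition set_cat :: "'u itself \<Rightarrow> ('f set, 'f \<Rightarrow> 'f) cat" where
  "set_cat U = \<lparr>
     Obj = {S. small U S},
     Hom = (\<lambda>S T. S \<rightarrow>\<^sub>E T),
     Id = (\<lambda>S. \<lambda>x \<in> S. x),
     Comp = (\<lambda>S T V g f. compose S g f)\<rparr>"

definition hom_func :: "('x, 'f) cat \<Rightarrow> 'x \<Rightarrow> ('x, 'f, 'f set, 'f \<Rightarrow> 'f) func" where
  "hom_func C k = \<lparr>
     FObj = Hom C k,
     FArr = (\<lambda>x y f. \<lambda>g \<in> Hom C k x. Comp C k x y f g)\<rparr>"

definition presentable :: "'u itself \<Rightarrow> 'k rel \<Rightarrow> ('x, 'f) cat \<Rightarrow> 'x \<Rightarrow> bool" where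
  "presentable U r C k \<longleftrightarrow> k \<in> Obj C \<and>
     is_functor C (set_cat U) (hom_func C k) \<and>
     preserves_filtered_colimits U r C (set_cat U) (hom_func C k)"

text \<open>
  Local smallness of \<open>C\<close>, which is often part of the conventions on categories, is not included
  here. Without the strong limit hypothesis on the universe it fails already for
  categories of presheaves.
\<close>

definition locally_presentable :: "'u itself \<Rightarrow> ('x, 'f) cat \<Rightarrow> bool" where
  "locally_presentable U C \<longleftrightarrow> category C \<and> cocomplete U C \<and>
     (\<exists>r :: 'u rel. Card_order r \<and> infinite (Field r) \<and> regularCard r \<and>
        r <o |UNIV :: 'u set| \<and>
        (\<exists>S. S \<subseteq> Obj C \<and> small U S \<and> (\<forall>k \<in> S. presentable U r C k) \<and>
           (\<forall>x \<in> Obj C. \<exists>(J :: ('u, 'u) cat) D \<iota>.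
              small_category U J \<and> filtered r J \<and> is_functor J C D \<and>
              (\<forall>i \<in> Obj J. FObj D i \<in> S) \<and> is_colimit J C D x \<iota>)))"


section \<open>Monoid objects\<close>

record ('x, 'f) monoidal =
  Base :: "('x, 'f) cat"
  TObj :: "'x \<Rightarrow> 'x \<Rightarrow> 'x"
  TArr :: "'x \<Rightarrow> 'x \<Rightarrow> 'x \<Rightarrow> 'x \<Rightarrow> 'f \<Rightarrow> 'f \<Rightarrow> 'f"
  TUnit :: "'x"
  Assoc :: "'x \<Rightarrow> 'x \<Rightarrow> 'x \<Rightarrow> 'f"
  LUnit :: "'x \<Rightarrow> 'f"
  RUnit :: "'x \<Rightarrow> 'f"

text \<open>
  In \<open>TArr M x x' y y' f g : x \<otimes> y \<rightarrow> x' \<otimes> y'\<close> we have \<open>f : x \<rightarrow> x'\<close> and \<open>g : y \<rightarrow> y'\<close>; the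
  structure isomorphisms are \<open>(x \<otimes> y) \<otimes> z \<rightarrow> x \<otimes> (y \<otimes> z)\<close>, \<open>I \<otimes> x \<rightarrow> x\<close> and \<open>x \<otimes> I \<rightarrow> x\<close>.
\<close>

definition is_monoid :: "('x, 'f) monoidal \<Rightarrow> 'x \<Rightarrow> 'f \<Rightarrow> 'f \<Rightarrow> bool" where
  "is_monoid M x m e \<longleftrightarrow>
     (let C = Base M; xx = TObj M x x; I = TUnit M; i = Id C x in
      x \<in> Obj C \<and> m \<in> Hom C xx x \<and> e \<in> Hom C I x \<and>
      Comp C (TObj M xx x) xx x m (TArr M xx x x x m i)
        = Comp C (TObj M xx x) (TObj M x xx) x
            (Comp C (TObj M x xx) xx x m (TArr M x x xx x i m)) (Assoc M x x x) \<and>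
      Comp C (TObj M I x) xx x m (TArr M I x x x e i) = LUnit M x \<and>
      Comp C (TObj M x I) xx x m (TArr M x x I x i e) = RUnit M x)"

definition mon_cat :: "('x, 'f) monoidal \<Rightarrow> ('x \<times> 'f \<times> 'f, 'f) cat" where
  "mon_cat M = \<lparr>
     Obj = {(x, m, e). is_monoid M x m e},
     Hom = (\<lambda>(x, m, e) (y, n, d). {f \<in> Hom (Base M) x y.
       Comp (Base M) (TObj M x x) x y f m
         = Comp (Base M) (TObj M x x) (TObj M y y) y n (TArr M x y x y f f) \<and>
       Comp (Base M) (TUnit M) x y f e = d}),
     Id = (\<lambda>(x, m, e). Id (Base M) x),
     Comp = (\<lambda>(x, m, e) (y, n, d) (z, l, c). Comp (Base M) x y z)\<rparr>"


section \<open>Presheaves and crossed groups\<close>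

text \<open>\<open>Res X a b \<phi>\<close> is \<open>\<phi>\<^sup>* : X(b) \<rightarrow> X(a)\<close> for \<open>\<phi> : a \<rightarrow> b\<close>.\<close>

record ('o, 'm, 'u) presheaf =
  Sec :: "'o \<Rightarrow> 'u set"
  Res :: "'o \<Rightarrow> 'o \<Rightarrow> 'm \<Rightarrow> 'u \<Rightarrow> 'u"

definition is_presheaf :: "('o, 'm) cat \<Rightarrow> ('o, 'm, 'u) presheaf \<Rightarrow> bool" where
  "is_presheaf A X \<longleftrightarrow>
     (\<forall>a \<in> Obj A. small TYPE('u) (Sec X a)) \<and>
     (\<forall>a \<in> Obj A. \<forall>b \<in> Obj A. \<forall>\<phi> \<in> Hom A a b. Res X a b \<phi> \<in> Sec X b \<rightarrow> Sec X a) \<and>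
     (\<forall>a \<in> Obj A. \<forall>x \<in> Sec X a. Res X a a (Id A a) x = x) \<and>
     (\<forall>a \<in> Obj A. \<forall>b \<in> Obj A. \<forall>c \<in> Obj A. \<forall>\<phi> \<in> Hom A a b. \<forall>\<psi> \<in> Hom A b c. \<forall>x \<in> Sec X c.
        Res X a c (Comp A a b c \<psi> \<phi>) x = Res X a b \<phi> (Res X b c \<psi> x))"

text \<open>
  The components of a map of presheaves are extensional functions, so that maps which agree on
  all sections are equal.
\<close>

definition psh_cat :: "('o, 'm) cat \<Rightarrow> (('o, 'm, 'u) presheaf, 'o \<Rightarrow> 'u \<Rightarrow> 'u) cat" where
  "psh_cat A = \<lparr>
     Obj = {X. is_presheaf A X},
     Hom = (\<lambda>X Y. {f \<in> (\<Pi>\<^sub>E a \<in> Obj A. Sec X a \<rightarrow>\<^sub>E Sec Y a).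
       \<forall>a \<in> Obj A. \<forall>b \<in> Obj A. \<forall>\<phi> \<in> Hom A a b. \<forall>x \<in> Sec X b.
         f a (Res X a b \<phi> x) = Res Y a b \<phi> (f b x)}),
     Id = (\<lambda>X. \<lambda>a \<in> Obj A. \<lambda>x \<in> Sec X a. x),
     Comp = (\<lambda>X Y Z g f. \<lambda>a \<in> Obj A. compose (Sec X a) (g a) (f a))\<rparr>"

text \<open>\<open>Xact G a b x \<phi>\<close> is \<open>\<phi>\<^sup>x\<close> for \<open>x \<in> G(b)\<close> and \<open>\<phi> : a \<rightarrow> b\<close>.\<close>

record ('o, 'm, 'u) crs_group =
  Grp :: "'o \<Rightarrow> 'u monoid"
  GRes :: "'o \<Rightarrow> 'o \<Rightarrow> 'm \<Rightarrow> 'u \<Rightarrow> 'u"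
  Xact :: "'o \<Rightarrow> 'o \<Rightarrow> 'u \<Rightarrow> 'm \<Rightarrow> 'm"

definition crs_psh :: "('o, 'm, 'u) crs_group \<Rightarrow> ('o, 'm, 'u) presheaf" where
  "crs_psh G = \<lparr>Sec = (\<lambda>a. carrier (Grp G a)), Res = GRes G\<rparr>"

locale crossed_group = category A
  for A :: "('o, 'm) cat" +
  fixes G :: "('o, 'm, 'u) crs_group"
  assumes crs_presheaf: "is_presheaf A (crs_psh G)"
    and crs_is_group: "a \<in> Obj A \<Longrightarrow> group (Grp G a)"
    and crs_action: "\<lbrakk>a \<in> Obj A; b \<in> Obj A\<rbrakk>
      \<Longrightarrow> group_action (Grp G b) (Hom A a b) (Xact G a b)"
    and Xact_Comp: "\<lbrakk>a \<in> Obj A; b \<in> Obj A; c \<in> Obj A; \<phi> \<in> Hom A a b; \<psi> \<in> Hom A b c;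
        x \<in> carrier (Grp G c)\<rbrakk>
      \<Longrightarrow> Xact G a c x (Comp A a b c \<psi> \<phi>)
        = Comp A a b c (Xact G b c x \<psi>) (Xact G a b (GRes G b c \<psi> x) \<phi>)"
    and GRes_mult: "\<lbrakk>a \<in> Obj A; b \<in> Obj A; \<phi> \<in> Hom A a b;
        x \<in> carrier (Grp G b); y \<in> carrier (Grp G b)\<rbrakk>
      \<Longrightarrow> GRes G a b \<phi> (x \<otimes>\<^bsub>Grp G b\<^esub> y)
        = GRes G a b (Xact G a b y \<phi>) x \<otimes>\<^bsub>Grp G a\<^esub> GRes G a b \<phi> y"

definition crs_grp_cat :: "('o, 'm) cat \<Rightarrow> (('o, 'm, 'u) crs_group, 'o \<Rightarrow> 'u \<Rightarrow> 'u) cat" where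
  "crs_grp_cat A = \<lparr>
     Obj = {G. crossed_group A G},
     Hom = (\<lambda>G H. {f \<in> Hom (psh_cat A) (crs_psh G) (crs_psh H).
       (\<forall>a \<in> Obj A. f a \<in> hom (Grp G a) (Grp H a)) \<and>
       (\<forall>a \<in> Obj A. \<forall>b \<in> Obj A. \<forall>\<phi> \<in> Hom A a b. \<forall>x \<in> carrier (Grp G b).
          Xact H a b (f b x) \<phi> = Xact G a b x \<phi>)}),
     Id = (\<lambda>G. Id (psh_cat A) (crs_psh G)),
     Comp = (\<lambda>G H K. Comp (psh_cat A) (crs_psh G) (crs_psh H) (crs_psh K))\<rparr>"


section \<open>Crossed monoids\<close>

text \<open>
  In order that cartesian products of subsets of \<open>'u\<close> are again subsets of \<open>'u\<close>, pairs are encoded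
  by a fixed injection \<open>'u \<times> 'u \<rightarrow> 'u\<close>, which exists since \<open>'u\<close> is infinite.
\<close>

definition enc :: "'u \<times> 'u \<Rightarrow> 'u" where
  "enc = (SOME f. inj f)"

definition dec :: "'u \<Rightarrow> 'u \<times> 'u" where
  "dec = inv_into UNIV enc"

abbreviation set_over :: "('o, 'm) cat \<Rightarrow> ('o, 'm, 'u) crs_group \<Rightarrow>
    (('o, 'm, 'u) presheaf \<times> ('o \<Rightarrow> 'u \<Rightarrow> 'u), 'o \<Rightarrow> 'u \<Rightarrow> 'u) cat" where
  "set_over A G \<equiv> slice (psh_cat A) (crs_psh G)"

definition rtimes_psh :: "('o, 'm, 'u) crs_group \<Rightarrow>
    ('o, 'm, 'u) presheaf \<times> ('o \<Rightarrow> 'u \<Rightarrow> 'u) \<Rightarrow> ('o, 'm, 'u) presheaf \<times> ('o \<Rightarrow> 'u \<Rightarrow> 'u) \<Rightarrow>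
    ('o, 'm, 'u) presheaf" where
  "rtimes_psh G = (\<lambda>(X, p) (Y, q). \<lparr>
     Sec = (\<lambda>a. enc ` (Sec X a \<times> Sec Y a)),
     Res = (\<lambda>a b \<phi> z. case dec z of (x, y) \<Rightarrow>
       enc (Res X a b (Xact G a b (q b y) \<phi>) x, Res Y a b \<phi> y))\<rparr>)"

definition rtimes :: "('o, 'm) cat \<Rightarrow> ('o, 'm, 'u) crs_group \<Rightarrow>
    ('o, 'm, 'u) presheaf \<times> ('o \<Rightarrow> 'u \<Rightarrow> 'u) \<Rightarrow> ('o, 'm, 'u) presheaf \<times> ('o \<Rightarrow> 'u \<Rightarrow> 'u) \<Rightarrow>
    ('o, 'm, 'u) presheaf \<times> ('o \<Rightarrow> 'u \<Rightarrow> 'u)" where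
  "rtimes A G = (\<lambda>(X, p) (Y, q). (rtimes_psh G (X, p) (Y, q),
     \<lambda>a \<in> Obj A. \<lambda>z \<in> enc ` (Sec X a \<times> Sec Y a).
       case dec z of (x, y) \<Rightarrow> p a x \<otimes>\<^bsub>Grp G a\<^esub> q a y))"

definition rtimes_unit :: "('o, 'm) cat \<Rightarrow> ('o, 'm, 'u) crs_group \<Rightarrow>
    ('o, 'm, 'u) presheaf \<times> ('o \<Rightarrow> 'u \<Rightarrow> 'u)" where
  "rtimes_unit A G = (\<lparr>Sec = (\<lambda>a. {undefined}), Res = (\<lambda>a b \<phi> z. z)\<rparr>,
     \<lambda>a \<in> Obj A. \<lambda>z \<in> {undefined}. \<one>\<^bsub>Grp G a\<^esub>)"

definition rtimes_monoidal :: "('o, 'm) cat \<Rightarrow> ('o, 'm, 'u) crs_group \<Rightarrow>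
    (('o, 'm, 'u) presheaf \<times> ('o \<Rightarrow> 'u \<Rightarrow> 'u), 'o \<Rightarrow> 'u \<Rightarrow> 'u) monoidal" where
  "rtimes_monoidal A G = \<lparr>
     Base = set_over A G,
     TObj = rtimes A G,
     TArr = (\<lambda>(X, p) (X', p') (Y, q) (Y', q') f g. \<lambda>a \<in> Obj A. \<lambda>z \<in> enc ` (Sec X a \<times> Sec Y a).
       case dec z of (x, y) \<Rightarrow> enc (f a x, g a y)),
     TUnit = rtimes_unit A G,
     Assoc = (\<lambda>(X, p) (Y, q) (Z, r). \<lambda>a \<in> Obj A.
       \<lambda>z \<in> enc ` (enc ` (Sec X a \<times> Sec Y a) \<times> Sec Z a).
         case dec z of (v, w) \<Rightarrow> case dec v of (x, y) \<Rightarrow> enc (x, enc (y, w))),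
     LUnit = (\<lambda>(X, p). \<lambda>a \<in> Obj A. \<lambda>z \<in> enc ` ({undefined} \<times> Sec X a). snd (dec z)),
     RUnit = (\<lambda>(X, p). \<lambda>a \<in> Obj A. \<lambda>z \<in> enc ` (Sec X a \<times> {undefined}). fst (dec z))\<rparr>"

type_synonym ('o, 'm, 'u) crs_monoid =
  "(('o, 'm, 'u) presheaf \<times> ('o \<Rightarrow> 'u \<Rightarrow> 'u)) \<times> ('o \<Rightarrow> 'u \<Rightarrow> 'u) \<times> ('o \<Rightarrow> 'u \<Rightarrow> 'u)"

text \<open>Throughout, \<open>T\<close> stands for a terminal crossed group.\<close>

definition crs_mon_cat :: "('o, 'm) cat \<Rightarrow> ('o, 'm, 'u) crs_group \<Rightarrow>
    (('o, 'm, 'u) crs_monoid, 'o \<Rightarrow> 'u \<Rightarrow> 'u) cat" where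
  "crs_mon_cat A T = mon_cat (rtimes_monoidal A T)"

definition crs_group_monoid :: "('o, 'm) cat \<Rightarrow> ('o, 'm, 'u) crs_group \<Rightarrow>
    ('o, 'm, 'u) crs_group \<Rightarrow> ('o, 'm, 'u) crs_monoid" where
  "crs_group_monoid A T G =
     ((crs_psh G, THE t. t \<in> Hom (crs_grp_cat A) G T),
      \<lambda>a \<in> Obj A. \<lambda>z \<in> enc ` (carrier (Grp G a) \<times> carrier (Grp G a)).
        case dec z of (x, y) \<Rightarrow> x \<otimes>\<^bsub>Grp G a\<^esub> y,
      \<lambda>a \<in> Obj A. \<lambda>z \<in> {undefined}. \<one>\<^bsub>Grp G a\<^esub>)"

abbreviation crs_mon_over :: "('o, 'm) cat \<Rightarrow> ('o, 'm, 'u) crs_group \<Rightarrow>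
    ('o, 'm, 'u) crs_group \<Rightarrow>
    (('o, 'm, 'u) crs_monoid \<times> ('o \<Rightarrow> 'u \<Rightarrow> 'u), 'o \<Rightarrow> 'u \<Rightarrow> 'u) cat" where
  "crs_mon_over A T G \<equiv> slice (crs_mon_cat A T) (crs_group_monoid A T G)"

definition forget :: "(('o, 'm, 'u) crs_monoid \<times> ('o \<Rightarrow> 'u \<Rightarrow> 'u), 'o \<Rightarrow> 'u \<Rightarrow> 'u,
    ('o, 'm, 'u) presheaf \<times> ('o \<Rightarrow> 'u \<Rightarrow> 'u), 'o \<Rightarrow> 'u \<Rightarrow> 'u) func" where
  "forget = \<lparr>FObj = (\<lambda>(((X, t), m, e), p). (X, p)), FArr = (\<lambda>M N f. f)\<rparr>"

end

theory Submission
  imports Defs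
begin

text \<open>
  A crossed monoid over \<open>G\<close> is an algebra of a many-sorted finitary algebraic theory: the sorts are the
  pairs of an object \<open>a\<close> and an element of \<open>G(a)\<close>, and the operations are the restrictions, the
  multiplications and the units; the terminal crossed group enters only through \<open>\<phi>\<^sup>x\<close>, which
  depends just on the image of \<open>x\<close> in \<open>G\<close>. Every term is equal to a word in restrictions of
  variables, and every presentation by generators and relations defines a crossed monoid over \<open>G\<close>,
  namely the words modulo the intersection of the kernels of all evaluations that satisfy the relations.
  This yields free objects, colimits and finitely presented objects at once.

  Monadicity is direct: an Eilenberg--Moore algebra \<open>h\<close> on \<open>X\<close> carries the multiplication
  \<open>x y = h (\<eta> x \<cdot> \<eta> y)\<close>, which makes \<open>h\<close> a homomorphism. In a filtered colimit of crossed
  monoids, every element comes from some stage and two elements of a stage are identified only if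
  they agree at a later stage, because finitely many factors of a word can be multiplied at a common
  stage. Hence the forgetful functor preserves filtered colimits and the monad is finitary. For the
  same reason finitely presented objects are finitely presentable, and every object is the filtered
  colimit of the objects presented by finitely many of its elements and finitely many of the
  relations that hold between them. So the category is locally finitely presentable.
\<close>

section \<open>Small sets\<close>

text \<open>Restriction of a product is twisted by the degree of the right factor. This is harmless
  because degrees of words are computed from the degrees of the generators alone: restriction
  already acts on words before any crossed monoid is chosen, and it descends to every quotient whose
  congruence respects degrees, products and restrictions. Describing the congruence through all
  evaluations, instead of generating it by rules, makes these closure properties and the universal
  property immediate, with no induction on derivations.

  The universe is only regular and uncountable. Words over small sets then form small sets, but
  hom-sets of presheaves may be large. Hence smallness of hom-sets is proved for finitely presented
  sources, where a map is a finite list of values, and a strong limit enters for local smallness.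

  Sections are elements of \<open>'u\<close> and index categories live on \<open>'u\<close>. So
  classes of words and finite presentations, which are elements of other types, have to be coded in
  \<open>'u\<close> by injections before they can be used.\<close>

lemma small_subset: "small U T \<Longrightarrow> S \<subseteq> T \<Longrightarrow> small U S"
  unfolding small_def using card_of_mono1 ordLeq_ordLess_trans by blast

lemma small_image: "small U S \<Longrightarrow> small U (f ` S)"
  unfolding small_def using card_of_image ordLeq_ordLess_trans by blast

lemma small_inj_onD:
  assumes "inj_on f S" "small U (f ` S)"
  shows "small U S"
  using small_image[OF assms(2), of "inv_into S f"] assms(1) by simp

text \<open>This is how classes of words and finite presentations get replaced by elements of
  \<open>'u\<close>.\<close>

lemma small_inj_into_universe:
  fixes U :: "'u itself"
  assumes "small U S"
  shows "\<exists>f :: _ \<Rightarrow> 'u. inj_on f S"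
  using assms unfolding small_def
  by (meson card_of_ordLeq ordLess_imp_ordLeq)

context
  fixes U :: "'u itself"
  assumes U: "universe U"
begin

lemma universe_infinite: "infinite (UNIV :: 'u set)"
  using U unfolding universe_def
  by (meson infinite_iff_natLeq_ordLeq ordLess_imp_ordLeq)

lemma small_finite: "finite S \<Longrightarrow> small U S"
  unfolding small_def using universe_infinite
  by (metis Field_card_of card_of_Well_order finite_ordLess_infinite card_of_well_order_on)

text \<open>Regularity of the cardinal of \<open>'u\<close>: fewer than \<kappa> many sets of size
  less than \<kappa> cannot fill up \<kappa>.\<close>

lemma small_UN:
  assumes "small U I" "\<And>i. i \<in> I \<Longrightarrow> small U (B i)"
  shows "small U (\<Union>i\<in>I. B i)"
  using assms U universe_infinite unfolding small_def universe_def
  by (intro card_of_UNION_ordLess_infinite_Field_regularCard)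
     (auto simp: cinfinite_def Field_card_of card_of_Card_order[unfolded Field_card_of])

lemma small_nat: "small U (S :: nat set)"
proof -
  have "|UNIV :: nat set| =o natLeq" by (rule card_of_nat)
  then have "small U (UNIV :: nat set)"
    using U unfolding small_def universe_def using ordIso_ordLess_trans by blast
  then show ?thesis by (rule small_subset) simp
qed

lemma small_Sigma:
  assumes "small U S" "\<And>a. a \<in> S \<Longrightarrow> small U (B a)"
  shows "small U (Sigma S B)"
proof -
  have "Sigma S B = (\<Union>a\<in>S. Pair a ` B a)" by auto
  then show ?thesis using assms by (auto intro!: small_UN small_image)
qed

text \<open>Lists of a fixed length form a finite power; the union over all lengths stays small
  because \<kappa> is regular and uncountable.\<close>

lemma small_lists:
  assumes "small U S"
  shows "small U (lists S)"
proof -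
  have *: "small U {l \<in> lists S. length l = n}" for n
  proof (induction n)
    case 0
    show ?case by (rule small_finite) (rule finite_subset[of _ "{[]}"], auto)
  next
    case (Suc n)
    have "{l \<in> lists S. length l = Suc n} \<subseteq> (\<lambda>(x, l). x # l) ` (S \<times> {l \<in> lists S. length l = n})"
      by (auto simp: length_Suc_conv image_iff)
    then show ?case by (rule small_subset[rotated]) (intro small_image small_Sigma assms Suc)
  qed
  have "lists S = (\<Union>n\<in>UNIV. {l \<in> lists S. length l = n})" by auto
  then show ?thesis using small_UN[OF small_nat, of UNIV "\<lambda>n. {l \<in> lists S. length l = n}"] * by simp
qed

lemma small_finite_subsets:
  assumes "small U S"
  shows "small U {F. F \<subseteq> S \<and> finite F}"
proof -
  have "{F. F \<subseteq> S \<and> finite F} \<subseteq> set ` lists S"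
    by (auto simp: image_iff) (metis finite_list in_listsI subsetD)
  then show ?thesis by (rule small_subset[rotated]) (intro small_image small_lists assms)
qed

text \<open>The strong limit condition speaks of subsets of \<open>'u\<close> only; an injection
  into \<open>'u\<close> carries it to sets of any type.\<close>

lemma small_Pow:
  assumes "strong_limit U" "small U S"
  shows "small U (Pow S)"
proof -
  obtain f :: "_ \<Rightarrow> 'u" where f: "inj_on f S" using small_inj_into_universe[OF assms(2)] by blast
  have "small U (Pow (f ` S))"
    using assms unfolding strong_limit_def by (simp add: small_image)
  then have "small U (image f ` Pow S)"
    by (rule small_subset) auto
  then show ?thesis by (rule small_inj_onD[rotated]) (rule inj_on_image_Pow[OF f])
qed

lemma inj_enc: "inj (enc :: 'u \<times> 'u \<Rightarrow> 'u)"
proof -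
  have "|(UNIV :: 'u set) \<times> (UNIV :: 'u set)| =o |UNIV :: 'u set|"
    using universe_infinite by (rule card_of_Times_same_infinite)
  then have "\<exists>f :: 'u \<times> 'u \<Rightarrow> 'u. inj f"
    by (metis UNIV_Times_UNIV bij_betw_def card_of_ordIso)
  then show ?thesis unfolding enc_def by (rule someI_ex)
qed

end

section \<open>Presheaves and slices\<close>

text \<open>Arrows of \<open>psh_cat\<close> are extensional in both arguments. Cutting off a family
  this way lets constructions be written down by their values alone.\<close>

definition psh_map :: "('o, 'm) cat \<Rightarrow> ('o, 'm, 'u) presheaf \<Rightarrow> ('o \<Rightarrow> 'u \<Rightarrow> 'u) \<Rightarrow> 'o \<Rightarrow> 'u \<Rightarrow> 'u" where
  "psh_map A X f = (\<lambda>a \<in> Obj A. \<lambda>x \<in> Sec X a. f a x)"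

lemma psh_map_apply [simp]: "a \<in> Obj A \<Longrightarrow> x \<in> Sec X a \<Longrightarrow> psh_map A X f a x = f a x"
  by (simp add: psh_map_def)

lemma psh_map_in_HomI:
  assumes "\<And>a x. a \<in> Obj A \<Longrightarrow> x \<in> Sec X a \<Longrightarrow> f a x \<in> Sec Y a"
    and "\<And>a b \<phi> x. \<lbrakk>a \<in> Obj A; b \<in> Obj A; \<phi> \<in> Hom A a b; x \<in> Sec X b\<rbrakk>
      \<Longrightarrow> Res X a b \<phi> x \<in> Sec X a \<and> f a (Res X a b \<phi> x) = Res Y a b \<phi> (f b x)"
  shows "psh_map A X f \<in> Hom (psh_cat A) X Y"
  using assms by (auto simp: psh_cat_def psh_map_def)

lemma psh_Hom_closed: "\<lbrakk>f \<in> Hom (psh_cat A) X Y; a \<in> Obj A; x \<in> Sec X a\<rbrakk> \<Longrightarrow> f a x \<in> Sec Y a"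
  by (auto simp: psh_cat_def PiE_iff)

lemma psh_Hom_natural: "\<lbrakk>f \<in> Hom (psh_cat A) X Y; a \<in> Obj A; b \<in> Obj A; \<phi> \<in> Hom A a b; x \<in> Sec X b\<rbrakk>
   \<Longrightarrow> f a (Res X a b \<phi> x) = Res Y a b \<phi> (f b x)"
  by (auto simp: psh_cat_def)

lemma psh_Hom_eqI:
  assumes f: "f \<in> Hom (psh_cat A) X Y" and g: "g \<in> Hom (psh_cat A) X Y'"
    and eq: "\<And>a x. a \<in> Obj A \<Longrightarrow> x \<in> Sec X a \<Longrightarrow> f a x = g a x"
  shows "f = g"
proof (rule ext)
  fix a
  show "f a = g a"
  proof (cases "a \<in> Obj A")
    case True
    then have "f a \<in> extensional (Sec X a)" "g a \<in> extensional (Sec X a)"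
      using f g by (auto simp: psh_cat_def PiE_iff)
    then show ?thesis using eq[OF True] by (rule extensionalityI)
  next
    case False
    then show ?thesis using f g by (auto simp: psh_cat_def PiE_iff extensional_def)
  qed
qed

lemma psh_Comp_apply [simp]:
  "a \<in> Obj A \<Longrightarrow> x \<in> Sec X a \<Longrightarrow> Comp (psh_cat A) X Y Z g f a x = g a (f a x)"
  by (simp add: psh_cat_def compose_def)

lemma psh_Id_apply [simp]: "a \<in> Obj A \<Longrightarrow> x \<in> Sec X a \<Longrightarrow> Id (psh_cat A) X a x = x"
  by (simp add: psh_cat_def)

lemma Obj_psh_cat [simp]: "Obj (psh_cat A) = {X. is_presheaf A X}"
  by (simp add: psh_cat_def)

lemma presheaf_Res_closed:
  "\<lbrakk>is_presheaf A X; a \<in> Obj A; b \<in> Obj A; \<phi> \<in> Hom A a b; x \<in> Sec X b\<rbrakk> \<Longrightarrow> Res X a b \<phi> x \<in> Sec X a"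
  unfolding is_presheaf_def Pi_iff by blast

lemma presheaf_Res_Id: "\<lbrakk>is_presheaf A X; a \<in> Obj A; x \<in> Sec X a\<rbrakk> \<Longrightarrow> Res X a a (Id A a) x = x"
  by (auto simp: is_presheaf_def)

lemma presheaf_Res_Comp:
  "\<lbrakk>is_presheaf A X; a \<in> Obj A; b \<in> Obj A; c \<in> Obj A; \<phi> \<in> Hom A a b; \<psi> \<in> Hom A b c; x \<in> Sec X c\<rbrakk>
   \<Longrightarrow> Res X a c (Comp A a b c \<psi> \<phi>) x = Res X a b \<phi> (Res X b c \<psi> x)"
  by (auto simp: is_presheaf_def)

lemma psh_Comp_eq: "Comp (psh_cat A) X Y Z g f = psh_map A X (\<lambda>a x. g a (f a x))"
  by (auto simp: psh_cat_def psh_map_def compose_def fun_eq_iff)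

lemma psh_Id_eq: "Id (psh_cat A) X = psh_map A X (\<lambda>a x. x)"
  by (auto simp: psh_cat_def psh_map_def fun_eq_iff)

lemma psh_Comp_in_Hom:
  assumes "is_presheaf A X" and f: "f \<in> Hom (psh_cat A) X Y" and g: "g \<in> Hom (psh_cat A) Y Z"
  shows "Comp (psh_cat A) X Y Z g f \<in> Hom (psh_cat A) X Z"
  unfolding psh_Comp_eq
proof (rule psh_map_in_HomI, goal_cases)
  case (1 a x)
  then show ?case using f g by (simp add: psh_Hom_closed)
next
  case (2 a b \<phi> x)
  then have "f b x \<in> Sec Y b" using f by (simp add: psh_Hom_closed)
  then show ?case using 2 assms by (simp add: psh_Hom_natural presheaf_Res_closed)
qed

lemma psh_Id_in_Hom: "is_presheaf A X \<Longrightarrow> Id (psh_cat A) X \<in> Hom (psh_cat A) X X"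
  unfolding psh_Id_eq by (rule psh_map_in_HomI) (auto simp: presheaf_Res_closed)

lemma category_psh: "category (psh_cat A)"
proof
  fix X assume "X \<in> Obj (psh_cat A)"
  then show "Id (psh_cat A) X \<in> Hom (psh_cat A) X X" by (simp add: psh_Id_in_Hom)
next
  fix X Y Z f g
  assume "X \<in> Obj (psh_cat A)" "f \<in> Hom (psh_cat A) X Y" "g \<in> Hom (psh_cat A) Y Z"
  then show "Comp (psh_cat A) X Y Z g f \<in> Hom (psh_cat A) X Z" by (simp add: psh_Comp_in_Hom)
next
  fix X Y f
  assume *: "X \<in> Obj (psh_cat A)" "Y \<in> Obj (psh_cat A)" "f \<in> Hom (psh_cat A) X Y"
  then show "Comp (psh_cat A) X X Y f (Id (psh_cat A) X) = f"
    by (intro psh_Hom_eqI[OF psh_Comp_in_Hom *(3)]) (auto simp: psh_Id_in_Hom)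
  show "Comp (psh_cat A) X Y Y (Id (psh_cat A) Y) f = f"
    using * by (intro psh_Hom_eqI[OF psh_Comp_in_Hom *(3)]) (auto simp: psh_Id_in_Hom psh_Hom_closed)
next
  fix W X Y Z f g h
  assume *: "W \<in> Obj (psh_cat A)" "X \<in> Obj (psh_cat A)" "f \<in> Hom (psh_cat A) W X"
    "g \<in> Hom (psh_cat A) X Y" "h \<in> Hom (psh_cat A) Y Z"
  then show "Comp (psh_cat A) W X Z (Comp (psh_cat A) X Y Z h g) f
      = Comp (psh_cat A) W Y Z h (Comp (psh_cat A) W X Y g f)"
    by (intro psh_Hom_eqI[of _ A W Z _ Z] psh_Comp_in_Hom) (auto simp: psh_Hom_closed[OF *(3)])
qed

section \<open>Projections from functors and adjunctions\<close>

context
  fixes C :: "('x, 'f) cat" and D :: "('y, 'g) cat" and F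
  assumes F: "is_functor C D F"
begin

lemma functor_dom: "category C"
  and functor_cod: "category D"
  and functor_Obj: "a \<in> Obj C \<Longrightarrow> FObj F a \<in> Obj D"
  and functor_Hom: "\<lbrakk>a \<in> Obj C; b \<in> Obj C; f \<in> Hom C a b\<rbrakk> \<Longrightarrow> FArr F a b f \<in> Hom D (FObj F a) (FObj F b)"
  and functor_Id: "a \<in> Obj C \<Longrightarrow> FArr F a a (Id C a) = Id D (FObj F a)"
  and functor_Comp: "\<lbrakk>a \<in> Obj C; b \<in> Obj C; c \<in> Obj C; f \<in> Hom C a b; g \<in> Hom C b c\<rbrakk> \<Longrightarrow>
    FArr F a c (Comp C a b c g f) = Comp D (FObj F a) (FObj F b) (FObj F c) (FArr F b c g) (FArr F a b f)"
  using F unfolding is_functor_def by blast+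

end

context
  fixes C :: "('x, 'f) cat" and D :: "('y, 'g) cat" and F U \<eta> \<epsilon>
  assumes adj: "adjunction C D F U \<eta> \<epsilon>"
begin

lemma adjunction_functors: "is_functor C D F" "is_functor D C U"
  and adjunction_unit: "x \<in> Obj C \<Longrightarrow> \<eta> x \<in> Hom C x (FObj U (FObj F x))"
  and adjunction_counit: "y \<in> Obj D \<Longrightarrow> \<epsilon> y \<in> Hom D (FObj F (FObj U y)) y"
  and adjunction_unit_natural: "\<lbrakk>x \<in> Obj C; x' \<in> Obj C; f \<in> Hom C x x'\<rbrakk> \<Longrightarrow>
    Comp C x x' (FObj U (FObj F x')) (\<eta> x') f = Comp C x (FObj U (FObj F x)) (FObj U (FObj F x'))
      (FArr U (FObj F x) (FObj F x') (FArr F x x' f)) (\<eta> x)"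
  and adjunction_counit_natural: "\<lbrakk>y \<in> Obj D; y' \<in> Obj D; g \<in> Hom D y y'\<rbrakk> \<Longrightarrow>
    Comp D (FObj F (FObj U y)) (FObj F (FObj U y')) y' (\<epsilon> y') (FArr F (FObj U y) (FObj U y') (FArr U y y' g))
      = Comp D (FObj F (FObj U y)) y y' g (\<epsilon> y)"
  and adjunction_triangle_left: "x \<in> Obj C \<Longrightarrow> Comp D (FObj F x) (FObj F (FObj U (FObj F x))) (FObj F x)
    (\<epsilon> (FObj F x)) (FArr F x (FObj U (FObj F x)) (\<eta> x)) = Id D (FObj F x)"
  and adjunction_triangle_right: "y \<in> Obj D \<Longrightarrow> Comp C (FObj U y) (FObj U (FObj F (FObj U y))) (FObj U y)
    (FArr U (FObj F (FObj U y)) y (\<epsilon> y)) (\<eta> (FObj U y)) = Id C (FObj U y)"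
  using adj by (simp_all add: adjunction_def nat_trans_def id_func_def comp_func_def)

end

lemma Obj_slice [simp]: "(x, p) \<in> Obj (slice C c) \<longleftrightarrow> x \<in> Obj C \<and> p \<in> Hom C x c"
  by (simp add: slice_def)

lemma Hom_slice [simp]: "f \<in> Hom (slice C c) (x, p) (y, q) \<longleftrightarrow> f \<in> Hom C x y \<and> Comp C x y c q f = p"
  by (simp add: slice_def)

lemma Id_slice [simp]: "Id (slice C c) (x, p) = Id C x"
  by (simp add: slice_def)

lemma Comp_slice [simp]: "Comp (slice C c) (x, p) (y, q) (z, r) = Comp C x y z"
  by (simp add: slice_def)

lemma category_slice:
  assumes "category C" "c \<in> Obj C"
  shows "category (slice C c)"
proof -
  interpret category C by fact
  show ?thesis
  proof
    fix X assume "X \<in> Obj (slice C c)"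
    then show "Id (slice C c) X \<in> Hom (slice C c) X X"
      by (cases X) (use assms in \<open>auto simp: Id_in_Hom Comp_Id_right\<close>)
  next
    fix X Y Z f g
    assume "X \<in> Obj (slice C c)" "Y \<in> Obj (slice C c)" "Z \<in> Obj (slice C c)"
      "f \<in> Hom (slice C c) X Y" "g \<in> Hom (slice C c) Y Z"
    then show "Comp (slice C c) X Y Z g f \<in> Hom (slice C c) X Z"
      by (cases X; cases Y; cases Z) (use assms in \<open>simp add: Comp_in_Hom Comp_assoc[symmetric]\<close>)
  next
    fix X Y f
    assume *: "X \<in> Obj (slice C c)" "Y \<in> Obj (slice C c)" "f \<in> Hom (slice C c) X Y"
    then show "Comp (slice C c) X X Y f (Id (slice C c) X) = f"
      by (cases X; cases Y) (auto simp: Comp_Id_right)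
    from * show "Comp (slice C c) X Y Y (Id (slice C c) Y) f = f"
      by (cases X; cases Y) (auto simp: Comp_Id_left)
  next
    fix W X Y Z f g h
    assume "W \<in> Obj (slice C c)" "X \<in> Obj (slice C c)" "Y \<in> Obj (slice C c)" "Z \<in> Obj (slice C c)"
      "f \<in> Hom (slice C c) W X" "g \<in> Hom (slice C c) X Y" "h \<in> Hom (slice C c) Y Z"
    then show "Comp (slice C c) W X Z (Comp (slice C c) X Y Z h g) f
      = Comp (slice C c) W Y Z h (Comp (slice C c) W X Y g f)"
      by (cases W; cases X; cases Y; cases Z) (simp add: Comp_assoc)
  qed
qed

section \<open>Crossed monoids over a crossed group\<close>

locale crossed_group_over = crossed_group A G
  for A :: "('o, 'm) cat" and G :: "('o, 'm, 'u) crs_group" +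
  fixes T :: "('o, 'm, 'u) crs_group"
  assumes universe: "universe TYPE('u)"
    and small_A: "small_category TYPE('u) A"
    and terminal_T: "terminal (crs_grp_cat A) T"
begin

abbreviation "C \<equiv> set_over A G"
abbreviation "M \<equiv> crs_mon_over A T G"
abbreviation "gpsh \<equiv> crs_psh G"
abbreviation "gm a \<equiv> monoid.mult (Grp G a)"
abbreviation "g1 a \<equiv> one (Grp G a)"
abbreviation "act \<equiv> Xact G"
abbreviation "gr \<equiv> GRes G"

lemma dec_enc [simp]: "dec (enc z :: 'u) = z"
  unfolding dec_def using inj_enc[OF universe] by simp

lemma enc_eq [simp]: "(enc y :: 'u) = enc z \<longleftrightarrow> y = z"
  using inj_enc[OF universe] by (auto dest: injD)

lemma Sec_gpsh [simp]: "Sec gpsh a = carrier (Grp G a)"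
  and Res_gpsh [simp]: "Res gpsh = gr"
  by (simp_all add: crs_psh_def)

section \<open>Calculation in the crossed group \<open>G\<close>\<close>

lemma gm_closed [simp]: "\<lbrakk>a \<in> Obj A; x \<in> carrier (Grp G a); y \<in> carrier (Grp G a)\<rbrakk> \<Longrightarrow> gm a x y \<in> carrier (Grp G a)"
  and gm_assoc: "\<lbrakk>a \<in> Obj A; x \<in> carrier (Grp G a); y \<in> carrier (Grp G a); z \<in> carrier (Grp G a)\<rbrakk>
    \<Longrightarrow> gm a (gm a x y) z = gm a x (gm a y z)"
  and g1_closed [simp]: "a \<in> Obj A \<Longrightarrow> g1 a \<in> carrier (Grp G a)"
  and gm_g1_left [simp]: "\<lbrakk>a \<in> Obj A; x \<in> carrier (Grp G a)\<rbrakk> \<Longrightarrow> gm a (g1 a) x = x"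
  and gm_g1_right [simp]: "\<lbrakk>a \<in> Obj A; x \<in> carrier (Grp G a)\<rbrakk> \<Longrightarrow> gm a x (g1 a) = x"
  using crs_is_group
  by (simp_all add: group.is_monoid monoid.m_closed monoid.m_assoc)

lemma gr_closed [simp]: "\<lbrakk>a \<in> Obj A; b \<in> Obj A; \<phi> \<in> Hom A a b; x \<in> carrier (Grp G b)\<rbrakk>
    \<Longrightarrow> gr a b \<phi> x \<in> carrier (Grp G a)"
  using presheaf_Res_closed[OF crs_presheaf] by simp

lemma gr_Id [simp]: "\<lbrakk>a \<in> Obj A; x \<in> carrier (Grp G a)\<rbrakk> \<Longrightarrow> gr a a (Id A a) x = x"
  using presheaf_Res_Id[OF crs_presheaf] by simp

lemma gr_Comp: "\<lbrakk>a \<in> Obj A; b \<in> Obj A; c \<in> Obj A; \<phi> \<in> Hom A a b; \<psi> \<in> Hom A b c; x \<in> carrier (Grp G c)\<rbrakk>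
   \<Longrightarrow> gr a c (Comp A a b c \<psi> \<phi>) x = gr a b \<phi> (gr b c \<psi> x)"
  using presheaf_Res_Comp[OF crs_presheaf] by simp

text \<open>Axiom (ii) at x = y = 1, together with the fact that 1 acts trivially, makes the
  restricted unit idempotent, and a group has only one idempotent.\<close>

lemma gr_g1 [simp]:
  assumes "a \<in> Obj A" "b \<in> Obj A" "\<phi> \<in> Hom A a b"
  shows "gr a b \<phi> (g1 b) = g1 a"
proof -
  interpret group "Grp G a" using assms crs_is_group by simp
  interpret b: group "Grp G b" using assms crs_is_group by simp
  interpret group_action "Grp G b" "Hom A a b" "act a b" using assms crs_action by simp
  have "act a b (g1 b) \<phi> = \<phi>" using assms(3) id_eq_one by (metis restrict_apply')
  then have "gm a (gr a b \<phi> (g1 b)) (gr a b \<phi> (g1 b)) = gr a b \<phi> (g1 b)"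
    using GRes_mult[OF assms, of "g1 b" "g1 b"] assms by simp
  then show ?thesis using assms by (metis gr_closed b.one_closed r_cancel_one)
qed

lemma act_closed [simp]: "\<lbrakk>a \<in> Obj A; b \<in> Obj A; \<phi> \<in> Hom A a b; x \<in> carrier (Grp G b)\<rbrakk>
    \<Longrightarrow> act a b x \<phi> \<in> Hom A a b"
  by (rule group_action.element_image[OF crs_action _ _ refl])

lemma act_g1 [simp]: "\<lbrakk>a \<in> Obj A; b \<in> Obj A; \<phi> \<in> Hom A a b\<rbrakk> \<Longrightarrow> act a b (g1 b) \<phi> = \<phi>"
  using group_action.id_eq_one[OF crs_action] by (metis restrict_apply')

lemma act_gm: "\<lbrakk>a \<in> Obj A; b \<in> Obj A; \<phi> \<in> Hom A a b; x \<in> carrier (Grp G b); y \<in> carrier (Grp G b)\<rbrakk>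
    \<Longrightarrow> act a b (gm b x y) \<phi> = act a b x (act a b y \<phi>)"
  by (rule group_action.composition_rule[OF crs_action])

text \<open>\<open>x\<close> acts by a bijection, so some \<phi> is moved to the identity. Axiom (i)
  for the composite of the identity with this \<phi> then equates the identity with the twisted
  identity, since restriction along an identity fixes \<open>x\<close>.\<close>

lemma act_Id [simp]:
  assumes "a \<in> Obj A" "x \<in> carrier (Grp G a)"
  shows "act a a x (Id A a) = Id A a"
proof -
  interpret group_action "Grp G a" "Hom A a a" "act a a" using assms crs_action by simp
  obtain \<phi> where \<phi>: "\<phi> \<in> Hom A a a" "act a a x \<phi> = Id A a"
    using bij_prop1[OF assms(2), of "Id A a"] assms Id_in_Hom by auto
  have "act a a x (Comp A a a a (Id A a) \<phi>) = Comp A a a a (act a a x (Id A a)) (act a a x \<phi>)"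
    using Xact_Comp[of a a a \<phi> "Id A a" x] assms \<phi> Id_in_Hom by simp
  then show ?thesis using assms \<phi> Id_in_Hom
    by (simp add: Comp_Id_left Comp_Id_right)
qed

text \<open>Spelled as in \<open>crs_group_monoid\<close>, so that unfolding that definition
  produces \<tau>.\<close>

definition \<tau> :: "'o \<Rightarrow> 'u \<Rightarrow> 'u" where
  "\<tau> = (THE t. t \<in> Hom (crs_grp_cat A) G T)"

lemma \<tau>_Hom: "\<tau> \<in> Hom (crs_grp_cat A) G T"
proof -
  have "G \<in> Obj (crs_grp_cat A)"
    using crossed_group_axioms by (simp add: crs_grp_cat_def)
  then show ?thesis
    using terminal_T theI'[of "\<lambda>t. t \<in> Hom (crs_grp_cat A) G T"]
    unfolding terminal_def \<tau>_def by blast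
qed

lemma crossed_group_T: "crossed_group A T"
  using terminal_T by (simp add: terminal_def crs_grp_cat_def)

sublocale T: crossed_group A T by (rule crossed_group_T)

lemma \<tau>_psh: "\<tau> \<in> Hom (psh_cat A) gpsh (crs_psh T)"
  using \<tau>_Hom by (simp add: crs_grp_cat_def)

lemma \<tau>_closed [simp]: "a \<in> Obj A \<Longrightarrow> x \<in> carrier (Grp G a) \<Longrightarrow> \<tau> a x \<in> carrier (Grp T a)"
  using psh_Hom_closed[OF \<tau>_psh] by (simp add: crs_psh_def)

lemma \<tau>_mult [simp]: "\<lbrakk>a \<in> Obj A; x \<in> carrier (Grp G a); y \<in> carrier (Grp G a)\<rbrakk>
    \<Longrightarrow> \<tau> a (gm a x y) = \<tau> a x \<otimes>\<^bsub>Grp T a\<^esub> \<tau> a y"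
  using \<tau>_Hom by (simp add: crs_grp_cat_def hom_def)

lemma \<tau>_one [simp]:
  assumes "a \<in> Obj A"
  shows "\<tau> a (g1 a) = \<one>\<^bsub>Grp T a\<^esub>"
proof -
  have "\<tau> a \<in> hom (Grp G a) (Grp T a)" using \<tau>_Hom assms by (simp add: crs_grp_cat_def)
  then show ?thesis using hom_one crs_is_group T.crs_is_group assms by blast
qed

lemma \<tau>_act [simp]: "\<lbrakk>a \<in> Obj A; b \<in> Obj A; \<phi> \<in> Hom A a b; x \<in> carrier (Grp G b)\<rbrakk>
    \<Longrightarrow> Xact T a b (\<tau> b x) \<phi> = act a b x \<phi>"
  using \<tau>_Hom by (simp add: crs_grp_cat_def)

section \<open>Elementwise description of crossed monoids over \<open>G\<close>\<close>

abbreviation psh :: "('o, 'm, 'u) crs_monoid \<times> ('o \<Rightarrow> 'u \<Rightarrow> 'u) \<Rightarrow> ('o, 'm, 'u) presheaf" where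
  "psh E \<equiv> fst (fst (fst E))"

definition ml :: "('o, 'm, 'u) crs_monoid \<times> ('o \<Rightarrow> 'u \<Rightarrow> 'u) \<Rightarrow> 'o \<Rightarrow> 'u \<Rightarrow> 'u \<Rightarrow> 'u" where
  "ml E a x y = fst (snd (fst E)) a (enc (x, y))"

definition un :: "('o, 'm, 'u) crs_monoid \<times> ('o \<Rightarrow> 'u \<Rightarrow> 'u) \<Rightarrow> 'o \<Rightarrow> 'u" where
  "un E a = snd (snd (fst E)) a undefined"

text \<open>A monoid object over \<open>T\<close> with a map to \<open>G\<close>, unfolded on
  elements. The last clause is naturality of the multiplication on the twisted product; its twist is
  by the degree in \<open>G\<close> because \<tau> preserves the actions.\<close>

definition crs_mon_struct ::
    "('o, 'm, 'u) presheaf \<Rightarrow> ('o \<Rightarrow> 'u \<Rightarrow> 'u) \<Rightarrow> ('o \<Rightarrow> 'u \<Rightarrow> 'u \<Rightarrow> 'u) \<Rightarrow> ('o \<Rightarrow> 'u) \<Rightarrow> bool" where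
  "crs_mon_struct X p mul u \<longleftrightarrow>
     is_presheaf A X \<and> p \<in> Hom (psh_cat A) X gpsh \<and>
     (\<forall>a \<in> Obj A. u a \<in> Sec X a \<and> p a (u a) = g1 a) \<and>
     (\<forall>a \<in> Obj A. \<forall>x \<in> Sec X a. mul a (u a) x = x \<and> mul a x (u a) = x) \<and>
     (\<forall>a \<in> Obj A. \<forall>x \<in> Sec X a. \<forall>y \<in> Sec X a.
        mul a x y \<in> Sec X a \<and> p a (mul a x y) = gm a (p a x) (p a y)) \<and>
     (\<forall>a \<in> Obj A. \<forall>x \<in> Sec X a. \<forall>y \<in> Sec X a. \<forall>z \<in> Sec X a.
        mul a (mul a x y) z = mul a x (mul a y z)) \<and>
     (\<forall>a \<in> Obj A. \<forall>b \<in> Obj A. \<forall>\<phi> \<in> Hom A a b. Res X a b \<phi> (u b) = u a) \<and>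
     (\<forall>a \<in> Obj A. \<forall>b \<in> Obj A. \<forall>\<phi> \<in> Hom A a b. \<forall>x \<in> Sec X b. \<forall>y \<in> Sec X b.
        Res X a b \<phi> (mul b x y) = mul a (Res X a b (act a b (p b y) \<phi>) x) (Res X a b \<phi> y))"

text \<open>The structure map to \<open>T\<close> is no extra datum: since \<open>p\<close> is a map
  over \<open>T\<close>, it has to be \<tau> after \<open>p\<close>.\<close>

definition mk_over :: "('o, 'm, 'u) presheaf \<Rightarrow> ('o \<Rightarrow> 'u \<Rightarrow> 'u) \<Rightarrow> ('o \<Rightarrow> 'u \<Rightarrow> 'u \<Rightarrow> 'u) \<Rightarrow> ('o \<Rightarrow> 'u)
    \<Rightarrow> ('o, 'm, 'u) crs_monoid \<times> ('o \<Rightarrow> 'u \<Rightarrow> 'u)" where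
  "mk_over X p mul u = (((X, Comp (psh_cat A) X gpsh (crs_psh T) \<tau> p),
     \<lambda>a \<in> Obj A. \<lambda>z \<in> enc ` (Sec X a \<times> Sec X a). case dec z of (x, y) \<Rightarrow> mul a x y,
     \<lambda>a \<in> Obj A. \<lambda>z \<in> {undefined}. u a), p)"

lemma psh_mk_over [simp]: "psh (mk_over X p mul u) = X"
  and snd_mk_over [simp]: "snd (mk_over X p mul u) = p"
  and un_mk_over [simp]: "a \<in> Obj A \<Longrightarrow> un (mk_over X p mul u) a = u a"
  and ml_mk_over [simp]: "\<lbrakk>a \<in> Obj A; x \<in> Sec X a; y \<in> Sec X a\<rbrakk> \<Longrightarrow> ml (mk_over X p mul u) a x y = mul a x y"
  by (simp_all add: mk_over_def un_def ml_def)

text \<open>Each diagram in the definition of a monoid object is an equation between families of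
  functions; evaluating it at an encoded tuple yields the law on elements.\<close>

lemma crs_mon_structD:
  assumes "E \<in> Obj M"
  shows "crs_mon_struct (psh E) (snd E) (ml E) (un E)"
proof -
  obtain X t m e p where E: "E = (((X, t), m, e), p)" by (metis surj_pair)
  let ?P = "psh_cat A" and ?Y = "rtimes_psh T (X, t) (X, t)"
  have "is_monoid (rtimes_monoidal A T) (X, t) m e"
    and "p \<in> Hom (mon_cat (rtimes_monoidal A T)) ((X, t), m, e) (crs_group_monoid A T G)"
    using assms by (simp_all add: E crs_mon_cat_def mon_cat_def slice_def)
  then have X: "is_presheaf A X" and t: "t \<in> Hom ?P X (crs_psh T)"
    and m: "m \<in> Hom ?P ?Y X"
    and e: "e \<in> Hom ?P (fst (rtimes_unit A T)) X"
    and assoc: "Comp (set_over A T)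
       (rtimes A T (rtimes A T (X, t) (X, t)) (X, t)) (rtimes A T (X, t) (X, t)) (X, t) m
       (TArr (rtimes_monoidal A T) (rtimes A T (X, t) (X, t)) (X, t) (X, t) (X, t) m (Id ?P X)) =
      Comp (set_over A T) (rtimes A T (rtimes A T (X, t) (X, t)) (X, t))
       (rtimes A T (X, t) (rtimes A T (X, t) (X, t))) (X, t)
       (Comp (set_over A T) (rtimes A T (X, t) (rtimes A T (X, t) (X, t)))
         (rtimes A T (X, t) (X, t)) (X, t) m
         (TArr (rtimes_monoidal A T) (X, t) (X, t) (rtimes A T (X, t) (X, t)) (X, t) (Id ?P X) m))
       (Assoc (rtimes_monoidal A T) (X, t) (X, t) (X, t))"
    and lunit: "Comp (set_over A T) (rtimes A T (rtimes_unit A T) (X, t)) (rtimes A T (X, t) (X, t)) (X, t) m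
       (TArr (rtimes_monoidal A T) (rtimes_unit A T) (X, t) (X, t) (X, t) e (Id ?P X))
      = LUnit (rtimes_monoidal A T) (X, t)"
    and runit: "Comp (set_over A T) (rtimes A T (X, t) (rtimes_unit A T)) (rtimes A T (X, t) (X, t)) (X, t) m
       (TArr (rtimes_monoidal A T) (X, t) (X, t) (rtimes_unit A T) (X, t) (Id ?P X) e)
      = RUnit (rtimes_monoidal A T) (X, t)"
    and p: "p \<in> Hom ?P X gpsh" and tp: "Comp ?P X gpsh (crs_psh T) \<tau> p = t"
    and pm: "Comp (set_over A T) (rtimes A T (X, t) (X, t)) (X, t) (gpsh, \<tau>) p m =
       Comp (set_over A T) (rtimes A T (X, t) (X, t)) (rtimes A T (gpsh, \<tau>) (gpsh, \<tau>)) (gpsh, \<tau>)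
         (\<lambda>a \<in> Obj A. \<lambda>z \<in> enc ` (carrier (Grp G a) \<times> carrier (Grp G a)).
            case dec z of (x, y) \<Rightarrow> x \<otimes>\<^bsub>Grp G a\<^esub> y)
         (TArr (rtimes_monoidal A T) (X, t) (gpsh, \<tau>) (X, t) (gpsh, \<tau>) p p)"
    and pe: "Comp (set_over A T) (rtimes_unit A T) (X, t) (gpsh, \<tau>) p e =
       (\<lambda>a \<in> Obj A. \<lambda>z \<in> {undefined}. \<one>\<^bsub>Grp G a\<^esub>)"
    by (simp_all add: is_monoid_def mon_cat_def crs_group_monoid_def Let_def rtimes_def rtimes_unit_def
        rtimes_monoidal_def \<tau>_def[symmetric])
  have pc: "p a x \<in> carrier (Grp G a)" if "a \<in> Obj A" "x \<in> Sec X a" for a x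
    using psh_Hom_closed[OF p] that by simp
  have mc: "m a (enc (x, y)) \<in> Sec X a" if "a \<in> Obj A" "x \<in> Sec X a" "y \<in> Sec X a" for a x y
    using psh_Hom_closed[OF m] that by (simp add: rtimes_psh_def)
  have ec: "e a undefined \<in> Sec X a" if "a \<in> Obj A" for a
    using psh_Hom_closed[OF e] that by (simp add: rtimes_unit_def)
  \<comment> \<open>Here the twist through \<open>T\<close> turns into the twist through
    \<open>G\<close>, so that \<open>T\<close> disappears from the elementwise laws.\<close>
  have t': "t a x = \<tau> a (p a x)" if "a \<in> Obj A" "x \<in> Sec X a" for a x
    using that by (simp flip: tp)
  note simps = rtimes_def rtimes_psh_def rtimes_unit_def rtimes_monoidal_def image_iff
  show ?thesis
    unfolding crs_mon_struct_def E ml_def un_def fst_conv snd_conv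
  proof (intro conjI ballI X p, goal_cases)
    case (1 a)
    then show ?case by (rule ec)
  next
    case (2 a)
    then show ?case using fun_cong[OF fun_cong[OF pe], of a undefined] by (simp add: simps)
  next
    case (3 a x)
    then show ?case using fun_cong[OF fun_cong[OF lunit], of a "enc (undefined, x)"]
      by (simp add: simps)
  next
    case (4 a x)
    then show ?case using fun_cong[OF fun_cong[OF runit], of a "enc (x, undefined)"]
      by (simp add: simps)
  next
    case (5 a x y)
    then show ?case by (rule mc)
  next
    case (6 a x y)
    then show ?case using fun_cong[OF fun_cong[OF pm], of a "enc (x, y)"] pc
      by (simp add: simps)
  next
    case (7 a x y z)
    then show ?case using fun_cong[OF fun_cong[OF assoc], of a "enc (enc (x, y), z)"] 
      by (simp add: simps)
  next
    case (8 a b \<phi>)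
    then show ?case using psh_Hom_natural[OF e, of a b \<phi> undefined] by (simp add: simps)
  next
    case (9 a b \<phi> x y)
    then show ?case using psh_Hom_natural[OF m, of a b \<phi> "enc (x, y)"] pc by (simp add: simps t')
  qed
qed

text \<open>Only extensionality enters, so composites out of twisted products can be compared
  without first showing that they are arrows or that the products are presheaves.\<close>

lemma tup_ext:
  assumes "f \<in> extensional (Obj A)" "f' \<in> extensional (Obj A)"
    "\<And>a. a \<in> Obj A \<Longrightarrow> f a \<in> extensional (S a)" "\<And>a. a \<in> Obj A \<Longrightarrow> f' a \<in> extensional (S a)"
    "\<And>a z. a \<in> Obj A \<Longrightarrow> z \<in> S a \<Longrightarrow> f a z = f' a z"
  shows "f = f'"
  using assms(1,2)
proof (rule extensionalityI)
  fix a assume "a \<in> Obj A"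
  then show "f a = f' a" using assms(3-5) by (intro extensionalityI[of "f a" "S a" "f' a"])
qed

context
  fixes X p mul u
  assumes struct: "crs_mon_struct X p mul u"
begin

private lemma p: "p \<in> Hom (psh_cat A) X gpsh" and X: "is_presheaf A X"
  using struct by (auto simp: crs_mon_struct_def)

private lemma p_closed: "a \<in> Obj A \<Longrightarrow> x \<in> Sec X a \<Longrightarrow> p a x \<in> carrier (Grp G a)"
  using psh_Hom_closed[OF p] by simp

private abbreviation "t \<equiv> Comp (psh_cat A) X gpsh (crs_psh T) \<tau> p"
private abbreviation "mu \<equiv> \<lambda>a \<in> Obj A. \<lambda>z \<in> enc ` (Sec X a \<times> Sec X a). case dec z of (x, y) \<Rightarrow> mul a x y"
private abbreviation "e \<equiv> \<lambda>a \<in> Obj A. \<lambda>z \<in> {undefined}. u a"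

private lemma t: "t \<in> Hom (psh_cat A) X (crs_psh T)"
  using X p \<tau>_psh by (intro psh_Comp_in_Hom)

private lemmas st = struct[unfolded crs_mon_struct_def]
private lemmas sts = rtimes_def rtimes_psh_def rtimes_unit_def rtimes_monoidal_def

private lemma u_closed: "a \<in> Obj A \<Longrightarrow> u a \<in> Sec X a"
  and pu: "a \<in> Obj A \<Longrightarrow> p a (u a) = g1 a"
  and mul_closed: "\<lbrakk>a \<in> Obj A; x \<in> Sec X a; y \<in> Sec X a\<rbrakk> \<Longrightarrow> mul a x y \<in> Sec X a"
  and pmul: "\<lbrakk>a \<in> Obj A; x \<in> Sec X a; y \<in> Sec X a\<rbrakk> \<Longrightarrow> p a (mul a x y) = gm a (p a x) (p a y)"
  and mul_assoc: "\<lbrakk>a \<in> Obj A; x \<in> Sec X a; y \<in> Sec X a; z \<in> Sec X a\<rbrakk> \<Longrightarrow> mul a (mul a x y) z = mul a x (mul a y z)"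
  and mul_u: "\<lbrakk>a \<in> Obj A; x \<in> Sec X a\<rbrakk> \<Longrightarrow> mul a (u a) x = x" "\<lbrakk>a \<in> Obj A; x \<in> Sec X a\<rbrakk> \<Longrightarrow> mul a x (u a) = x"
  and Res_u: "\<lbrakk>a \<in> Obj A; b \<in> Obj A; \<phi> \<in> Hom A a b\<rbrakk> \<Longrightarrow> Res X a b \<phi> (u b) = u a"
  and Res_mul: "\<lbrakk>a \<in> Obj A; b \<in> Obj A; \<phi> \<in> Hom A a b; x \<in> Sec X b; y \<in> Sec X b\<rbrakk>
    \<Longrightarrow> Res X a b \<phi> (mul b x y) = mul a (Res X a b (act a b (p b y) \<phi>) x) (Res X a b \<phi> y)"
  using st by blast+

private lemma mu_eq: "mu = psh_map A (rtimes_psh T (X, t) (X, t)) (\<lambda>a z. case dec z of (x, y) \<Rightarrow> mul a x y)"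
  by (simp add: psh_map_def rtimes_psh_def)

private lemma mu: "mu \<in> Hom (psh_cat A) (rtimes_psh T (X, t) (X, t)) X"
  unfolding mu_eq
proof (rule psh_map_in_HomI)
  fix a x assume "a \<in> Obj A" "x \<in> Sec (rtimes_psh T (X, t) (X, t)) a"
  then show "(case dec x of (x, y) \<Rightarrow> mul a x y) \<in> Sec X a"
    by (auto simp: rtimes_psh_def mul_closed)
next
  fix a b \<phi> z assume ab: "a \<in> Obj A" "b \<in> Obj A" "\<phi> \<in> Hom A a b" and "z \<in> Sec (rtimes_psh T (X, t) (X, t)) b"
  then obtain x y where z: "z = enc (x, y)" and xy: "x \<in> Sec X b" "y \<in> Sec X b" by (auto simp: rtimes_psh_def)
  have r: "Res (rtimes_psh T (X, t) (X, t)) a b \<phi> z = enc (Res X a b (act a b (p b y) \<phi>) x, Res X a b \<phi> y)"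
    using ab xy by (simp add: z rtimes_psh_def p_closed)
  show "Res (rtimes_psh T (X, t) (X, t)) a b \<phi> z \<in> Sec (rtimes_psh T (X, t) (X, t)) a \<and>
    (case dec (Res (rtimes_psh T (X, t) (X, t)) a b \<phi> z) of (x, y) \<Rightarrow> mul a x y) = Res X a b \<phi> (case dec z of (x, y) \<Rightarrow> mul b x y)"
    using ab xy presheaf_Res_closed[OF X] by (simp add: r) (simp add: z rtimes_psh_def Res_mul p_closed)
qed

private lemma e: "e \<in> Hom (psh_cat A) (fst (rtimes_unit A T)) X"
proof -
  have "e = psh_map A (fst (rtimes_unit A T)) (\<lambda>a z. u a)"
    by (simp add: psh_map_def rtimes_unit_def)
  also have "\<dots> \<in> Hom (psh_cat A) (fst (rtimes_unit A T)) X"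
    by (rule psh_map_in_HomI) (simp_all add: rtimes_unit_def u_closed Res_u)
  finally show ?thesis .
qed

private lemma mu_over: "Comp (psh_cat A) (rtimes_psh T (X, t) (X, t)) X (crs_psh T) t mu = snd (rtimes A T (X, t) (X, t))"
  by (rule tup_ext[of _ _ "\<lambda>a. enc ` (Sec X a \<times> Sec X a)"])
     (auto simp: psh_cat_def rtimes_def rtimes_psh_def compose_def mul_closed pmul p_closed)

private lemma e_over: "Comp (psh_cat A) (fst (rtimes_unit A T)) X (crs_psh T) t e = snd (rtimes_unit A T)"
  by (rule tup_ext[of _ _ "\<lambda>a. {undefined}"])
     (auto simp: psh_cat_def rtimes_unit_def compose_def u_closed pu)

private lemma is_mon: "is_monoid (rtimes_monoidal A T) (X, t) mu e"
proof -
  have 1: "Comp (set_over A T)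
       (rtimes A T (rtimes A T (X, t) (X, t)) (X, t)) (rtimes A T (X, t) (X, t)) (X, t) mu
       (TArr (rtimes_monoidal A T) (rtimes A T (X, t) (X, t)) (X, t) (X, t) (X, t) mu (Id (psh_cat A) X)) =
      Comp (set_over A T) (rtimes A T (rtimes A T (X, t) (X, t)) (X, t))
       (rtimes A T (X, t) (rtimes A T (X, t) (X, t))) (X, t)
       (Comp (set_over A T) (rtimes A T (X, t) (rtimes A T (X, t) (X, t)))
         (rtimes A T (X, t) (X, t)) (X, t) mu
         (TArr (rtimes_monoidal A T) (X, t) (X, t) (rtimes A T (X, t) (X, t)) (X, t) (Id (psh_cat A) X) mu))
       (Assoc (rtimes_monoidal A T) (X, t) (X, t) (X, t))"
    by (rule tup_ext[of _ _ "\<lambda>a. enc ` (enc ` (Sec X a \<times> Sec X a) \<times> Sec X a)"])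
      (auto simp: sts psh_cat_def compose_def mul_closed mul_assoc)
  have 2: "Comp (set_over A T) (rtimes A T (rtimes_unit A T) (X, t)) (rtimes A T (X, t) (X, t)) (X, t) mu
       (TArr (rtimes_monoidal A T) (rtimes_unit A T) (X, t) (X, t) (X, t) e (Id (psh_cat A) X))
      = LUnit (rtimes_monoidal A T) (X, t)"
    by (rule tup_ext[of _ _ "\<lambda>a. enc ` ({undefined} \<times> Sec X a)"])
      (auto simp: sts psh_cat_def compose_def u_closed mul_u)
  have 3: "Comp (set_over A T) (rtimes A T (X, t) (rtimes_unit A T)) (rtimes A T (X, t) (X, t)) (X, t) mu
       (TArr (rtimes_monoidal A T) (X, t) (X, t) (rtimes_unit A T) (X, t) (Id (psh_cat A) X) e)
      = RUnit (rtimes_monoidal A T) (X, t)"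
    by (rule tup_ext[of _ _ "\<lambda>a. enc ` (Sec X a \<times> {undefined})"])
      (auto simp: sts psh_cat_def compose_def u_closed mul_u)
  have s: "Base (rtimes_monoidal A T) = set_over A T" "TObj (rtimes_monoidal A T) = rtimes A T"
    "TUnit (rtimes_monoidal A T) = rtimes_unit A T"
    "rtimes A T (X, t) (X, t) = (rtimes_psh T (X, t) (X, t), snd (rtimes A T (X, t) (X, t)))"
    "rtimes_unit A T = (fst (rtimes_unit A T), snd (rtimes_unit A T))"
    by (simp_all add: rtimes_monoidal_def rtimes_def)
  have m: "mu \<in> Hom (set_over A T) (rtimes A T (X, t) (X, t)) (X, t)"
    by (subst s(4), subst Hom_slice, intro conjI mu mu_over)
  have e': "e \<in> Hom (set_over A T) (rtimes_unit A T) (X, t)"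
    by (subst s(5), subst Hom_slice, intro conjI e e_over)
  show ?thesis
    unfolding is_monoid_def Let_def s(1-3) Id_slice
    using X t by (intro conjI m e' 1 2 3) simp_all
qed

private lemma p_mon: "p \<in> Hom (mon_cat (rtimes_monoidal A T)) ((X, t), mu, e) (crs_group_monoid A T G)"
proof -
  have pm: "Comp (set_over A T) (rtimes A T (X, t) (X, t)) (X, t) (gpsh, \<tau>) p mu =
       Comp (set_over A T) (rtimes A T (X, t) (X, t)) (rtimes A T (gpsh, \<tau>) (gpsh, \<tau>)) (gpsh, \<tau>)
         (\<lambda>a \<in> Obj A. \<lambda>z \<in> enc ` (carrier (Grp G a) \<times> carrier (Grp G a)).
            case dec z of (x, y) \<Rightarrow> x \<otimes>\<^bsub>Grp G a\<^esub> y)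
         (TArr (rtimes_monoidal A T) (X, t) (gpsh, \<tau>) (X, t) (gpsh, \<tau>) p p)"
    by (rule tup_ext[of _ _ "\<lambda>a. enc ` (Sec X a \<times> Sec X a)"])
      (auto simp: sts psh_cat_def compose_def p_closed pmul)
  have pe: "Comp (set_over A T) (rtimes_unit A T) (X, t) (gpsh, \<tau>) p e =
       (\<lambda>a \<in> Obj A. \<lambda>z \<in> {undefined}. \<one>\<^bsub>Grp G a\<^esub>)"
    by (rule tup_ext[of _ _ "\<lambda>a. {undefined}"])
      (auto simp: sts psh_cat_def compose_def pu)
  show ?thesis
    using p pm pe unfolding mon_cat_def crs_group_monoid_def \<tau>_def[symmetric]
    by (simp add: rtimes_monoidal_def)
qed

text \<open>The converse of \<open>crs_mon_structD\<close>: later constructions give a structure on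
  elements and obtain an object of \<open>M\<close> from here.\<close>

lemma mk_over_in_Obj: "mk_over X p mul u \<in> Obj M"
  using is_mon p_mon
  by (simp add: mk_over_def crs_mon_cat_def) (simp add: mon_cat_def)

end

lemma Obj_M_components:
  assumes "(((X, t), m, e), p) \<in> Obj M"
  shows "is_presheaf A X" "p \<in> Hom (psh_cat A) X gpsh"
    "Comp (psh_cat A) X gpsh (crs_psh T) \<tau> p = t"
    "m \<in> Hom (psh_cat A) (rtimes_psh T (X, t) (X, t)) X"
    "e \<in> Hom (psh_cat A) (fst (rtimes_unit A T)) X"
proof -
  have "is_monoid (rtimes_monoidal A T) (X, t) m e"
    and "p \<in> Hom (mon_cat (rtimes_monoidal A T)) ((X, t), m, e) (crs_group_monoid A T G)"
    using assms by (simp_all add: crs_mon_cat_def mon_cat_def slice_def)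
  then show "is_presheaf A X" "p \<in> Hom (psh_cat A) X gpsh"
    "Comp (psh_cat A) X gpsh (crs_psh T) \<tau> p = t"
    "m \<in> Hom (psh_cat A) (rtimes_psh T (X, t) (X, t)) X"
    "e \<in> Hom (psh_cat A) (fst (rtimes_unit A T)) X"
    by (simp_all add: is_monoid_def mon_cat_def crs_group_monoid_def Let_def rtimes_def rtimes_unit_def
        rtimes_monoidal_def \<tau>_def[symmetric])
qed

text \<open>The map to \<open>T\<close> is determined by the projection, and multiplication and unit
  are extensional on encoded pairs and on the point. Equality on the nose is what lets the
  comparison functor have a strict inverse.\<close>

lemma over_eqI:
  assumes E: "E \<in> Obj M" "E' \<in> Obj M" and "psh E = psh E'" "snd E = snd E'"
    and ml: "\<And>a x y. \<lbrakk>a \<in> Obj A; x \<in> Sec (psh E) a; y \<in> Sec (psh E) a\<rbrakk> \<Longrightarrow> ml E a x y = ml E' a x y"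
    and un: "\<And>a. a \<in> Obj A \<Longrightarrow> un E a = un E' a"
  shows "E = E'"
proof -
  obtain X t m e p where E1: "E = (((X, t), m, e), p)" by (metis surj_pair)
  obtain t' m' e' where E2: "E' = (((X, t'), m', e'), p)"
    using assms(3,4) by (metis E1 fst_conv snd_conv surj_pair)
  note c = Obj_M_components[OF E(1)[unfolded E1]] Obj_M_components[OF E(2)[unfolded E2]]
  have "t = t'" using c(3,8) by simp
  moreover from this have "m = m'"
    using ml c(4,9) by (intro psh_Hom_eqI) (auto simp: E1 E2 ml_def rtimes_psh_def)
  moreover have "e = e'"
    using un c(5,10) by (intro psh_Hom_eqI) (auto simp: E1 E2 un_def rtimes_unit_def)
  ultimately show ?thesis by (simp add: E1 E2)
qed

lemma Hom_M_iff:
  assumes E: "E \<in> Obj M" and E': "E' \<in> Obj M"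
  shows "f \<in> Hom M E E' \<longleftrightarrow> f \<in> Hom (psh_cat A) (psh E) (psh E') \<and>
     (\<forall>a \<in> Obj A. \<forall>x \<in> Sec (psh E) a. snd E' a (f a x) = snd E a x) \<and>
     (\<forall>a \<in> Obj A. \<forall>x \<in> Sec (psh E) a. \<forall>y \<in> Sec (psh E) a. f a (ml E a x y) = ml E' a (f a x) (f a y)) \<and>
     (\<forall>a \<in> Obj A. f a (un E a) = un E' a)"
proof -
  obtain X t m e p where E1: "E = (((X, t), m, e), p)" by (metis surj_pair)
  obtain X' t' m' e' p' where E2: "E' = (((X', t'), m', e'), p')" by (metis surj_pair)
  let ?P = "psh_cat A"
  note c = Obj_M_components[OF E[unfolded E1]] Obj_M_components[OF E'[unfolded E2]]
  note X = c(1,6) and p = c(2,7) and t = c(3,8) and m = c(4,9) and e = c(5,10)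
  have "f \<in> Hom M E E' \<longleftrightarrow> f \<in> Hom ?P X X' \<and> Comp ?P X X' (crs_psh T) t' f = t \<and>
     Comp ?P X X' gpsh p' f = p \<and>
     Comp ?P (rtimes_psh T (X, t) (X, t)) X X' f m =
       Comp ?P (rtimes_psh T (X, t) (X, t)) (rtimes_psh T (X', t') (X', t')) X' m'
        (TArr (rtimes_monoidal A T) (X, t) (X', t') (X, t) (X', t') f f) \<and>
     Comp ?P (fst (rtimes_unit A T)) X X' f e = e'"
    by (auto simp: E1 E2 crs_mon_cat_def mon_cat_def rtimes_monoidal_def rtimes_def rtimes_unit_def
        crs_group_monoid_def)
  \<comment> \<open>Commuting with the maps to \<open>T\<close> follows from commuting with the
    projections to \<open>G\<close>, as both maps to \<open>T\<close> factor through \<tau>.\<close>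
  also have "\<dots> \<longleftrightarrow> f \<in> Hom ?P X X' \<and> Comp ?P X X' gpsh p' f = p \<and>
     Comp ?P (rtimes_psh T (X, t) (X, t)) X X' f m =
       Comp ?P (rtimes_psh T (X, t) (X, t)) (rtimes_psh T (X', t') (X', t')) X' m'
        (TArr (rtimes_monoidal A T) (X, t) (X', t') (X, t) (X', t') f f) \<and>
     Comp ?P (fst (rtimes_unit A T)) X X' f e = e'"
  proof -
    interpret P: category ?P by (rule category_psh)
    show ?thesis using X p \<tau>_psh crs_presheaf T.crs_presheaf
      by (auto simp flip: t simp: P.Comp_assoc)
  qed
  also have "\<dots> \<longleftrightarrow> f \<in> Hom ?P X X' \<and>
     (\<forall>a \<in> Obj A. \<forall>x \<in> Sec X a. p' a (f a x) = p a x) \<and>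
     (\<forall>a \<in> Obj A. \<forall>x \<in> Sec X a. \<forall>y \<in> Sec X a. f a (m a (enc (x, y))) = m' a (enc (f a x, f a y))) \<and>
     (\<forall>a \<in> Obj A. f a (e a undefined) = e' a undefined)"
  proof (rule conj_cong[OF refl], intro conj_cong)
    assume f: "f \<in> Hom ?P X X'"
    have fc: "a \<in> Obj A \<Longrightarrow> x \<in> Sec X a \<Longrightarrow> f a x \<in> Sec X' a" for a x using psh_Hom_closed[OF f] .
    show "Comp ?P X X' gpsh p' f = p \<longleftrightarrow> (\<forall>a \<in> Obj A. \<forall>x \<in> Sec X a. p' a (f a x) = p a x)"
      using psh_Hom_eqI[OF psh_Comp_in_Hom[OF X(1) f p(2)] p(1)] by auto
    show "Comp ?P (fst (rtimes_unit A T)) X X' f e = e' \<longleftrightarrow> (\<forall>a \<in> Obj A. f a (e a undefined) = e' a undefined)"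
    proof
      assume "Comp ?P (fst (rtimes_unit A T)) X X' f e = e'"
      then show "\<forall>a \<in> Obj A. f a (e a undefined) = e' a undefined"
        by (auto simp: rtimes_unit_def)
    next
      assume "\<forall>a \<in> Obj A. f a (e a undefined) = e' a undefined"
      then show "Comp ?P (fst (rtimes_unit A T)) X X' f e = e'"
        using e(2) psh_Hom_closed[OF e(1)]
        by (intro tup_ext[of _ _ "\<lambda>a. {undefined}"])
          (auto simp: psh_cat_def rtimes_unit_def compose_def PiE_iff)
    qed
    show "Comp ?P (rtimes_psh T (X, t) (X, t)) X X' f m =
       Comp ?P (rtimes_psh T (X, t) (X, t)) (rtimes_psh T (X', t') (X', t')) X' m'
        (TArr (rtimes_monoidal A T) (X, t) (X', t') (X, t) (X', t') f f) \<longleftrightarrow>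
     (\<forall>a \<in> Obj A. \<forall>x \<in> Sec X a. \<forall>y \<in> Sec X a. f a (m a (enc (x, y))) = m' a (enc (f a x, f a y)))" (is "?l = ?r \<longleftrightarrow> ?Q")
    proof
      assume eq: "?l = ?r"
      show ?Q
      proof (intro ballI)
        fix a x y assume "a \<in> Obj A" "x \<in> Sec X a" "y \<in> Sec X a"
        then show "f a (m a (enc (x, y))) = m' a (enc (f a x, f a y))"
          using fun_cong[OF fun_cong[OF eq], of a "enc (x, y)"]
          by (simp add: psh_cat_def rtimes_psh_def rtimes_monoidal_def compose_def image_iff)
      qed
    next
      assume ?Q
      then show "?l = ?r"
        by (intro tup_ext[of _ _ "\<lambda>a. enc ` (Sec X a \<times> Sec X a)"])
          (auto simp: psh_cat_def rtimes_psh_def rtimes_monoidal_def compose_def)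
    qed
  qed
  finally show ?thesis by (simp add: E1 E2 ml_def un_def)
qed

lemma Comp_M [simp]: "Comp M E E' E'' = Comp (psh_cat A) (psh E) (psh E') (psh E'')"
  by (cases E; cases E'; cases E'') (auto simp: crs_mon_cat_def mon_cat_def rtimes_monoidal_def)

lemma Id_M [simp]: "Id M E = Id (psh_cat A) (psh E)"
  by (cases E) (auto simp: crs_mon_cat_def mon_cat_def rtimes_monoidal_def)

end

section \<open>Words and quotients\<close>

context crossed_group_over begin

lemma category_C: "category C"
  by (rule category_slice[OF category_psh]) (simp add: crs_presheaf)

lemma Hom_C_iff:
  assumes "(X, p) \<in> Obj C" "(Y, q) \<in> Obj C"
  shows "f \<in> Hom C (X, p) (Y, q) \<longleftrightarrow> f \<in> Hom (psh_cat A) X Y \<and> (\<forall>a \<in> Obj A. \<forall>x \<in> Sec X a. q a (f a x) = p a x)"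
  unfolding Hom_slice
proof (rule conj_cong[OF refl])
  assume f: "f \<in> Hom (psh_cat A) X Y"
  show "Comp (psh_cat A) X Y gpsh q f = p \<longleftrightarrow> (\<forall>a \<in> Obj A. \<forall>x \<in> Sec X a. q a (f a x) = p a x)"
    using psh_Hom_eqI[of "Comp (psh_cat A) X Y gpsh q f" A X gpsh p gpsh] assms
      psh_Comp_in_Hom[of A X f Y q gpsh] f by auto
qed

context
  fixes E assumes E: "E \<in> Obj M"
begin

private lemmas over_st = crs_mon_structD[OF E, unfolded crs_mon_struct_def]

lemma M_presheaf: "is_presheaf A (psh E)"
  and M_pr_Hom: "snd E \<in> Hom (psh_cat A) (psh E) gpsh"
  and un_closed [simp]: "a \<in> Obj A \<Longrightarrow> un E a \<in> Sec (psh E) a"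
  and pr_un [simp]: "a \<in> Obj A \<Longrightarrow> snd E a (un E a) = g1 a"
  and ml_un_left [simp]: "\<lbrakk>a \<in> Obj A; x \<in> Sec (psh E) a\<rbrakk> \<Longrightarrow> ml E a (un E a) x = x"
  and ml_un_right [simp]: "\<lbrakk>a \<in> Obj A; x \<in> Sec (psh E) a\<rbrakk> \<Longrightarrow> ml E a x (un E a) = x"
  and ml_closed [simp]: "\<lbrakk>a \<in> Obj A; x \<in> Sec (psh E) a; y \<in> Sec (psh E) a\<rbrakk> \<Longrightarrow> ml E a x y \<in> Sec (psh E) a"
  and pr_ml [simp]: "\<lbrakk>a \<in> Obj A; x \<in> Sec (psh E) a; y \<in> Sec (psh E) a\<rbrakk>
    \<Longrightarrow> snd E a (ml E a x y) = gm a (snd E a x) (snd E a y)"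
  and ml_assoc: "\<lbrakk>a \<in> Obj A; x \<in> Sec (psh E) a; y \<in> Sec (psh E) a; z \<in> Sec (psh E) a\<rbrakk>
    \<Longrightarrow> ml E a (ml E a x y) z = ml E a x (ml E a y z)"
  and Res_un [simp]: "\<lbrakk>a \<in> Obj A; b \<in> Obj A; \<phi> \<in> Hom A a b\<rbrakk> \<Longrightarrow> Res (psh E) a b \<phi> (un E b) = un E a"
  and Res_ml: "\<lbrakk>a \<in> Obj A; b \<in> Obj A; \<phi> \<in> Hom A a b; x \<in> Sec (psh E) b; y \<in> Sec (psh E) b\<rbrakk>
    \<Longrightarrow> Res (psh E) a b \<phi> (ml E b x y)
      = ml E a (Res (psh E) a b (act a b (snd E b y) \<phi>) x) (Res (psh E) a b \<phi> y)"
  using over_st by blast+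

lemma pr_closed [simp]: "\<lbrakk>a \<in> Obj A; x \<in> Sec (psh E) a\<rbrakk> \<Longrightarrow> snd E a x \<in> carrier (Grp G a)"
  using psh_Hom_closed[OF M_pr_Hom] by simp

lemma pr_Res [simp]: "\<lbrakk>a \<in> Obj A; b \<in> Obj A; \<phi> \<in> Hom A a b; x \<in> Sec (psh E) b\<rbrakk>
    \<Longrightarrow> snd E a (Res (psh E) a b \<phi> x) = gr a b \<phi> (snd E b x)"
  using psh_Hom_natural[OF M_pr_Hom] by simp

lemma Res_closed [simp]: "\<lbrakk>a \<in> Obj A; b \<in> Obj A; \<phi> \<in> Hom A a b; x \<in> Sec (psh E) b\<rbrakk>
    \<Longrightarrow> Res (psh E) a b \<phi> x \<in> Sec (psh E) a"
  using presheaf_Res_closed[OF M_presheaf] .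

lemma Res_Id [simp]: "\<lbrakk>a \<in> Obj A; x \<in> Sec (psh E) a\<rbrakk> \<Longrightarrow> Res (psh E) a a (Id A a) x = x"
  using presheaf_Res_Id[OF M_presheaf] .

lemma Res_Comp: "\<lbrakk>a \<in> Obj A; b \<in> Obj A; c \<in> Obj A; \<phi> \<in> Hom A a b; \<psi> \<in> Hom A b c; x \<in> Sec (psh E) c\<rbrakk>
   \<Longrightarrow> Res (psh E) a c (Comp A a b c \<psi> \<phi>) x = Res (psh E) a b \<phi> (Res (psh E) b c \<psi> x)"
  using presheaf_Res_Comp[OF M_presheaf] .

lemma small_Sec: "a \<in> Obj A \<Longrightarrow> small TYPE('u) (Sec (psh E) a)"
  using M_presheaf by (simp add: is_presheaf_def)

lemma forget_in_Obj [simp]: "(psh E, snd E) \<in> Obj C"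
  using M_presheaf M_pr_Hom by simp

end

context
  fixes f E E' assumes E: "E \<in> Obj M" and E': "E' \<in> Obj M" and f: "f \<in> Hom M E E'"
begin

private lemmas hst = f[unfolded Hom_M_iff[OF E E']]

lemma M_Hom_psh: "f \<in> Hom (psh_cat A) (psh E) (psh E')"
  and M_Hom_pr: "\<lbrakk>a \<in> Obj A; x \<in> Sec (psh E) a\<rbrakk> \<Longrightarrow> snd E' a (f a x) = snd E a x"
  and M_Hom_ml: "\<lbrakk>a \<in> Obj A; x \<in> Sec (psh E) a; y \<in> Sec (psh E) a\<rbrakk> \<Longrightarrow> f a (ml E a x y) = ml E' a (f a x) (f a y)"
  and M_Hom_un: "a \<in> Obj A \<Longrightarrow> f a (un E a) = un E' a"
  using hst by blast+

lemma M_Hom_closed: "\<lbrakk>a \<in> Obj A; x \<in> Sec (psh E) a\<rbrakk> \<Longrightarrow> f a x \<in> Sec (psh E') a"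
  by (rule psh_Hom_closed[OF M_Hom_psh])

lemma M_Hom_Res: "\<lbrakk>a \<in> Obj A; b \<in> Obj A; \<phi> \<in> Hom A a b; x \<in> Sec (psh E) b\<rbrakk>
   \<Longrightarrow> f a (Res (psh E) a b \<phi> x) = Res (psh E') a b \<phi> (f b x)"
  by (rule psh_Hom_natural[OF M_Hom_psh])

lemma M_Hom_forget: "f \<in> Hom C (psh E, snd E) (psh E', snd E')"
  using Hom_C_iff[OF forget_in_Obj[OF E] forget_in_Obj[OF E']] M_Hom_psh M_Hom_pr by blast

end

lemma psh_map_in_Hom_M:
  assumes "E \<in> Obj M" "E' \<in> Obj M"
    and "\<And>a x. \<lbrakk>a \<in> Obj A; x \<in> Sec (psh E) a\<rbrakk> \<Longrightarrow> f a x \<in> Sec (psh E') a"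
    and "\<And>a b \<phi> x. \<lbrakk>a \<in> Obj A; b \<in> Obj A; \<phi> \<in> Hom A a b; x \<in> Sec (psh E) b\<rbrakk>
      \<Longrightarrow> f a (Res (psh E) a b \<phi> x) = Res (psh E') a b \<phi> (f b x)"
    and "\<And>a x. \<lbrakk>a \<in> Obj A; x \<in> Sec (psh E) a\<rbrakk> \<Longrightarrow> snd E' a (f a x) = snd E a x"
    and "\<And>a x y. \<lbrakk>a \<in> Obj A; x \<in> Sec (psh E) a; y \<in> Sec (psh E) a\<rbrakk> \<Longrightarrow> f a (ml E a x y) = ml E' a (f a x) (f a y)"
    and "\<And>a. a \<in> Obj A \<Longrightarrow> f a (un E a) = un E' a"
  shows "psh_map A (psh E) f \<in> Hom M E E'"
proof -
  have "psh_map A (psh E) f \<in> Hom (psh_cat A) (psh E) (psh E')"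
    using assms by (intro psh_map_in_HomI) simp_all
  then show ?thesis using assms by (simp add: Hom_M_iff)
qed

lemma M_Hom_eqI:
  assumes "E \<in> Obj M" "E' \<in> Obj M" "f \<in> Hom M E E'" "g \<in> Hom M E E'"
    and "\<And>a x. \<lbrakk>a \<in> Obj A; x \<in> Sec (psh E) a\<rbrakk> \<Longrightarrow> f a x = g a x"
  shows "f = g"
  using psh_Hom_eqI[OF M_Hom_psh[OF assms(1-3)] M_Hom_psh[OF assms(1,2,4)] assms(5)] .

lemma category_M: "category M"
proof
  fix E assume "E \<in> Obj M"
  then show "Id M E \<in> Hom M E E"
    by (simp add: Hom_M_iff psh_Id_in_Hom M_presheaf)
next
  fix D E F f g assume *: "D \<in> Obj M" "E \<in> Obj M" "F \<in> Obj M" "f \<in> Hom M D E" "g \<in> Hom M E F"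
  have "Comp (psh_cat A) (psh D) (psh E) (psh F) g f \<in> Hom (psh_cat A) (psh D) (psh F)"
    using * by (intro psh_Comp_in_Hom) (auto intro: M_Hom_psh M_presheaf)
  then show "Comp M D E F g f \<in> Hom M D F"
    using M_Hom_pr[OF *(1,2,4)] M_Hom_pr[OF *(2,3,5)] M_Hom_ml[OF *(1,2,4)] M_Hom_ml[OF *(2,3,5)]
      M_Hom_un[OF *(1,2,4)] M_Hom_un[OF *(2,3,5)] M_Hom_closed[OF *(1,2,4)] *(1-3)
    by (simp add: Hom_M_iff)
next
  fix D E f assume *: "D \<in> Obj M" "E \<in> Obj M" "f \<in> Hom M D E"
  interpret P: category "psh_cat A" by (rule category_psh)
  show "Comp M D D E f (Id M D) = f" "Comp M D E E (Id M E) f = f"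
    using * M_Hom_psh[OF *] by (simp_all add: M_presheaf P.Comp_Id_left P.Comp_Id_right)
next
  fix B D E F f g h assume *: "B \<in> Obj M" "D \<in> Obj M" "E \<in> Obj M" "F \<in> Obj M"
    "f \<in> Hom M B D" "g \<in> Hom M D E" "h \<in> Hom M E F"
  interpret P: category "psh_cat A" by (rule category_psh)
  show "Comp M B D F (Comp M D E F h g) f = Comp M B E F h (Comp M B D E g f)"
    using M_Hom_psh[OF *(1,2,5)] M_Hom_psh[OF *(2,3,6)] M_Hom_psh[OF *(3,4,7)] *(1-4)
    by (simp add: M_presheaf P.Comp_assoc)
qed

lemma FObj_forget [simp]: "FObj forget E = (psh E, snd E)"
  by (cases E) (auto simp: forget_def)

lemma FArr_forget [simp]: "FArr forget E E' f = f"
  by (simp add: forget_def)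

lemma functor_forget: "is_functor M C forget"
  unfolding is_functor_def
  using category_M category_C by (auto simp: M_Hom_forget simp del: Hom_slice Obj_slice)

end

text \<open>A small presheaf over \<open>G\<close> whose elements may have any type
  \<open>'x\<close>. The instances are the sections of a presheaf, the pairs of an index and a
  section, and the pairs of a variable and an arrow.\<close>

locale generators = crossed_group_over A G T
  for A :: "('o, 'm) cat" and G T :: "('o, 'm, 'u) crs_group" +
  fixes Xs :: "'o \<Rightarrow> 'x set" and rs :: "'o \<Rightarrow> 'o \<Rightarrow> 'm \<Rightarrow> 'x \<Rightarrow> 'x" and dg :: "'o \<Rightarrow> 'x \<Rightarrow> 'u"
  assumes small_Xs: "a \<in> Obj A \<Longrightarrow> small TYPE('u) (Xs a)"
    and rs_closed [simp]: "\<lbrakk>a \<in> Obj A; b \<in> Obj A; \<phi> \<in> Hom A a b; x \<in> Xs b\<rbrakk> \<Longrightarrow> rs a b \<phi> x \<in> Xs a"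
    and rs_Id [simp]: "\<lbrakk>a \<in> Obj A; x \<in> Xs a\<rbrakk> \<Longrightarrow> rs a a (Id A a) x = x"
    and rs_Comp: "\<lbrakk>a \<in> Obj A; b \<in> Obj A; c \<in> Obj A; \<phi> \<in> Hom A a b; \<psi> \<in> Hom A b c; x \<in> Xs c\<rbrakk>
      \<Longrightarrow> rs a c (Comp A a b c \<psi> \<phi>) x = rs a b \<phi> (rs b c \<psi> x)"
    and dg_closed [simp]: "\<lbrakk>a \<in> Obj A; x \<in> Xs a\<rbrakk> \<Longrightarrow> dg a x \<in> carrier (Grp G a)"
    and dg_rs [simp]: "\<lbrakk>a \<in> Obj A; b \<in> Obj A; \<phi> \<in> Hom A a b; x \<in> Xs b\<rbrakk>
      \<Longrightarrow> dg a (rs a b \<phi> x) = gr a b \<phi> (dg b x)"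
begin

primrec dgw :: "'o \<Rightarrow> 'x list \<Rightarrow> 'u" where
  "dgw a [] = g1 a"
| "dgw a (x # w) = gm a (dg a x) (dgw a w)"

text \<open>Axiom (ii) iterated: every letter is restricted along \<phi> twisted by the degree of
  everything to its right.\<close>

primrec rw :: "'o \<Rightarrow> 'o \<Rightarrow> 'm \<Rightarrow> 'x list \<Rightarrow> 'x list" where
  "rw a b \<phi> [] = []"
| "rw a b \<phi> (x # w) = rs a b (act a b (dgw b w) \<phi>) x # rw a b \<phi> w"

lemma dgw_closed [simp]: "a \<in> Obj A \<Longrightarrow> w \<in> lists (Xs a) \<Longrightarrow> dgw a w \<in> carrier (Grp G a)"
  by (induction w) simp_all

lemma dgw_append: "\<lbrakk>a \<in> Obj A; w \<in> lists (Xs a); w' \<in> lists (Xs a)\<rbrakk>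
    \<Longrightarrow> dgw a (w @ w') = gm a (dgw a w) (dgw a w')"
  by (induction w) (simp_all add: gm_assoc)

lemma rw_closed [simp]: "\<lbrakk>a \<in> Obj A; b \<in> Obj A; \<phi> \<in> Hom A a b; w \<in> lists (Xs b)\<rbrakk> \<Longrightarrow> rw a b \<phi> w \<in> lists (Xs a)"
  by (induction w) simp_all

lemma dgw_rw: "\<lbrakk>a \<in> Obj A; b \<in> Obj A; \<phi> \<in> Hom A a b; w \<in> lists (Xs b)\<rbrakk>
    \<Longrightarrow> dgw a (rw a b \<phi> w) = gr a b \<phi> (dgw b w)"
  by (induction w) (simp_all add: GRes_mult)

lemma rw_append: "\<lbrakk>a \<in> Obj A; b \<in> Obj A; \<phi> \<in> Hom A a b; w \<in> lists (Xs b); w' \<in> lists (Xs b)\<rbrakk>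
    \<Longrightarrow> rw a b \<phi> (w @ w') = rw a b (act a b (dgw b w') \<phi>) w @ rw a b \<phi> w'"
  by (induction w) (simp_all add: dgw_append act_gm)

lemma rw_Id: "\<lbrakk>a \<in> Obj A; w \<in> lists (Xs a)\<rbrakk> \<Longrightarrow> rw a a (Id A a) w = w"
  by (induction w) simp_all

text \<open>Axiom (i) splits the twisted composite. The twist that reaches \<phi> is the degree of
  the tail restricted along \<psi>, and by \<open>dgw_rw\<close> this is the degree of the
  restricted tail, as the outer \<open>rw\<close> demands.\<close>

lemma rw_Comp: "\<lbrakk>a \<in> Obj A; b \<in> Obj A; c \<in> Obj A; \<phi> \<in> Hom A a b; \<psi> \<in> Hom A b c; w \<in> lists (Xs c)\<rbrakk>
    \<Longrightarrow> rw a c (Comp A a b c \<psi> \<phi>) w = rw a b \<phi> (rw b c \<psi> w)"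
  by (induction w) (simp_all add: Xact_Comp dgw_rw rs_Comp)

end

locale generators_cong = generators A G T Xs rs dg
  for A :: "('o, 'm) cat" and G T :: "('o, 'm, 'u) crs_group"
    and Xs :: "'o \<Rightarrow> 'x set" and rs :: "'o \<Rightarrow> 'o \<Rightarrow> 'm \<Rightarrow> 'x \<Rightarrow> 'x" and dg :: "'o \<Rightarrow> 'x \<Rightarrow> 'u" +
  fixes eqv :: "'o \<Rightarrow> 'x list \<Rightarrow> 'x list \<Rightarrow> bool"
  assumes eqv_refl: "\<lbrakk>a \<in> Obj A; w \<in> lists (Xs a)\<rbrakk> \<Longrightarrow> eqv a w w"
    and eqv_sym: "\<lbrakk>a \<in> Obj A; w \<in> lists (Xs a); w' \<in> lists (Xs a); eqv a w w'\<rbrakk> \<Longrightarrow> eqv a w' w"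
    and eqv_trans: "\<lbrakk>a \<in> Obj A; w \<in> lists (Xs a); w' \<in> lists (Xs a); w'' \<in> lists (Xs a); eqv a w w'; eqv a w' w''\<rbrakk>
      \<Longrightarrow> eqv a w w''"
    and eqv_dgw: "\<lbrakk>a \<in> Obj A; w \<in> lists (Xs a); w' \<in> lists (Xs a); eqv a w w'\<rbrakk> \<Longrightarrow> dgw a w = dgw a w'"
    and eqv_append: "\<lbrakk>a \<in> Obj A; w \<in> lists (Xs a); w' \<in> lists (Xs a); eqv a w w';
         v \<in> lists (Xs a); v' \<in> lists (Xs a); eqv a v v'\<rbrakk> \<Longrightarrow> eqv a (w @ v) (w' @ v')"
    and eqv_rw: "\<lbrakk>a \<in> Obj A; b \<in> Obj A; \<phi> \<in> Hom A a b; w \<in> lists (Xs b); w' \<in> lists (Xs b); eqv b w w'\<rbrakk>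
      \<Longrightarrow> eqv a (rw a b \<phi> w) (rw a b \<phi> w')"
begin

text \<open>Both presented objects and concrete filtered colimits are instances of this quotient.
  The listed properties hide the coding of classes, and nothing else about \<open>E\<close> and
  \<open>q\<close> is used afterwards.\<close>

lemma quotient_exists:
  obtains E q where "E \<in> Obj M"
    and "\<And>a w. \<lbrakk>a \<in> Obj A; w \<in> lists (Xs a)\<rbrakk> \<Longrightarrow> q a w \<in> Sec (psh E) a"
    and "\<And>a z. \<lbrakk>a \<in> Obj A; z \<in> Sec (psh E) a\<rbrakk> \<Longrightarrow> \<exists>w \<in> lists (Xs a). z = q a w"
    and "\<And>a w w'. \<lbrakk>a \<in> Obj A; w \<in> lists (Xs a); w' \<in> lists (Xs a)\<rbrakk> \<Longrightarrow> q a w = q a w' \<longleftrightarrow> eqv a w w'"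
    and "\<And>a w. \<lbrakk>a \<in> Obj A; w \<in> lists (Xs a)\<rbrakk> \<Longrightarrow> snd E a (q a w) = dgw a w"
    and "\<And>a. a \<in> Obj A \<Longrightarrow> q a [] = un E a"
    and "\<And>a w w'. \<lbrakk>a \<in> Obj A; w \<in> lists (Xs a); w' \<in> lists (Xs a)\<rbrakk> \<Longrightarrow> q a (w @ w') = ml E a (q a w) (q a w')"
    and "\<And>a b \<phi> w. \<lbrakk>a \<in> Obj A; b \<in> Obj A; \<phi> \<in> Hom A a b; w \<in> lists (Xs b)\<rbrakk>
      \<Longrightarrow> Res (psh E) a b \<phi> (q b w) = q a (rw a b \<phi> w)"
proof -
  have sm: "small TYPE('u) (lists (Xs a))" if "a \<in> Obj A" for a
    by (rule small_lists[OF universe small_Xs[OF that]])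
  define code :: "'o \<Rightarrow> 'x list \<Rightarrow> 'u" where "code a = (SOME f. inj_on f (lists (Xs a)))" for a
  have code: "inj_on (code a) (lists (Xs a))" if "a \<in> Obj A" for a
    unfolding code_def using small_inj_into_universe[OF sm[OF that]] by (rule someI_ex)
  \<comment> \<open>The choice depends only on the class of \<open>w\<close>, because equivalent
    words define the same predicate under \<open>SOME\<close>. Coding the chosen word therefore
    codes the class.\<close>
  define rep where "rep a w = (SOME w'. w' \<in> lists (Xs a) \<and> eqv a w w')" for a w
  have rep: "rep a w \<in> lists (Xs a) \<and> eqv a w (rep a w)" if "a \<in> Obj A" "w \<in> lists (Xs a)" for a w
    unfolding rep_def by (rule someI[of _ w]) (use that eqv_refl in blast)
  define q where "q a w = code a (rep a w)" for a w
  have q_iff: "q a w = q a w' \<longleftrightarrow> eqv a w w'" if *: "a \<in> Obj A" "w \<in> lists (Xs a)" "w' \<in> lists (Xs a)" for a w w'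
  proof
    assume "q a w = q a w'"
    then have "rep a w = rep a w'" using code[OF *(1)] rep * by (auto simp: q_def dest: inj_onD)
    then show "eqv a w w'" using rep * by (metis eqv_sym eqv_trans)
  next
    assume e: "eqv a w w'"
    have "eqv a w v \<longleftrightarrow> eqv a w' v" if "v \<in> lists (Xs a)" for v
      using eqv_trans[OF *(1,3,2) that eqv_sym[OF * e]] eqv_trans[OF * that e] by blast
    then have "rep a w = rep a w'" unfolding rep_def by (metis (no_types, lifting))
    then show "q a w = q a w'" by (simp add: q_def)
  qed
  define S where "S a = q a ` lists (Xs a)" for a
  define dq where "dq a z = (SOME w. w \<in> lists (Xs a) \<and> q a w = z)" for a z
  have dq: "dq a z \<in> lists (Xs a) \<and> q a (dq a z) = z" if "z \<in> S a" for a z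
    unfolding dq_def by (rule someI_ex) (use that in \<open>auto simp: S_def\<close>)
  then have dqq: "eqv a (dq a (q a w)) w" "dq a (q a w) \<in> lists (Xs a)" if "a \<in> Obj A" "w \<in> lists (Xs a)" for a w
    using that q_iff[of a "dq a (q a w)" w] by (auto simp: S_def)
  define X where "X = \<lparr>Sec = S, Res = (\<lambda>a b \<phi> z. q a (rw a b \<phi> (dq b z)))\<rparr>"
  define p where "p = psh_map A X (\<lambda>a z. dgw a (dq a z))"
  define mul where "mul a z z' = q a (dq a z @ dq a z')" for a z z'
  have SX: "Sec X = S" by (simp add: X_def)
  have qS: "q a w \<in> S a" if "w \<in> lists (Xs a)" for a w using that by (simp add: S_def)
  have ex: "\<exists>w \<in> lists (Xs a). z = q a w" if "z \<in> S a" for a z using that by (auto simp: S_def)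
  have ResX: "Res X a b \<phi> (q b w) = q a (rw a b \<phi> w)"
    if "a \<in> Obj A" "b \<in> Obj A" "\<phi> \<in> Hom A a b" "w \<in> lists (Xs b)" for a b \<phi> w
    using that by (simp add: X_def q_iff eqv_rw dqq)
  have pX: "p a (q a w) = dgw a w" if "a \<in> Obj A" "w \<in> lists (Xs a)" for a w
    using that eqv_dgw[OF _ _ _ dqq(1)] by (simp add: p_def SX qS dqq)
  have mulX: "mul a (q a w) (q a w') = q a (w @ w')"
    if "a \<in> Obj A" "w \<in> lists (Xs a)" "w' \<in> lists (Xs a)" for a w w'
    using that by (simp add: mul_def q_iff eqv_append dqq)
  have presh: "is_presheaf A X"
    unfolding is_presheaf_def SX
  proof (intro conjI ballI funcsetI, goal_cases)
    case (1 a)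
    then show ?case unfolding S_def by (intro small_image sm)
  next
    case (2 a b \<phi> z)
    then obtain w where "w \<in> lists (Xs b)" "z = q b w" using ex by blast
    then show ?case using 2 by (simp add: ResX qS)
  next
    case (3 a z)
    then obtain w where "w \<in> lists (Xs a)" "z = q a w" using ex by blast
    then show ?case using 3 by (simp add: ResX rw_Id Id_in_Hom)
  next
    case (4 a b c \<phi> \<psi> z)
    then obtain w where "w \<in> lists (Xs c)" "z = q c w" using ex by blast
    then show ?case using 4 by (simp add: ResX rw_Comp Comp_in_Hom)
  qed
  have pHom: "p \<in> Hom (psh_cat A) X gpsh"
    unfolding p_def
  proof (rule psh_map_in_HomI, goal_cases)
    case (1 a z)
    then show ?case using dq by (simp add: SX)
  next
    case (2 a b \<phi> z)
    then obtain w where w: "w \<in> lists (Xs b)" "z = q b w" using ex by (auto simp: SX)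
    have "p a (Res X a b \<phi> z) = gr a b \<phi> (p b z)"
      using 2 w by (simp add: ResX pX dgw_rw)
    moreover have "Res X a b \<phi> z \<in> Sec X a"
      using 2 w by (simp add: ResX SX qS)
    ultimately show ?case using 2 by (simp add: p_def)
  qed
  have "crs_mon_struct X p mul (\<lambda>a. q a [])"
    unfolding crs_mon_struct_def SX
  proof (intro conjI ballI presh pHom, goal_cases)
    case (3 a z)
    then obtain w where "w \<in> lists (Xs a)" "z = q a w" using ex by blast
    then show ?case using 3 by (simp add: mulX)
  next
    case (4 a z)
    then obtain w where "w \<in> lists (Xs a)" "z = q a w" using ex by blast
    then show ?case using 4 by (simp add: mulX)
  next
    case (5 a x y)
    then obtain v w where "v \<in> lists (Xs a)" "x = q a v" "w \<in> lists (Xs a)" "y = q a w" using ex by meson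
    then show ?case using 5 by (simp add: mulX qS)
  next
    case (6 a x y)
    then obtain v w where "v \<in> lists (Xs a)" "x = q a v" "w \<in> lists (Xs a)" "y = q a w" using ex by meson
    then show ?case using 6 by (simp add: mulX pX dgw_append)
  next
    case (7 a x y z)
    then obtain u v w where "u \<in> lists (Xs a)" "x = q a u" "v \<in> lists (Xs a)" "y = q a v"
      "w \<in> lists (Xs a)" "z = q a w" using ex by meson
    then show ?case using 7 by (simp add: mulX)
  next
    case (9 a b \<phi> x y)
    then obtain v w where "v \<in> lists (Xs b)" "x = q b v" "w \<in> lists (Xs b)" "y = q b w" using ex by meson
    then show ?case using 9 by (simp add: mulX ResX pX rw_append)
  qed (auto simp: mulX pX ResX qS)
  then have E: "mk_over X p mul (\<lambda>a. q a []) \<in> Obj M" by (rule mk_over_in_Obj)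
  have mlX: "ml (mk_over X p mul (\<lambda>a. q a [])) a (q a w) (q a w') = q a (w @ w')"
    if "a \<in> Obj A" "w \<in> lists (Xs a)" "w' \<in> lists (Xs a)" for a w w'
    using ml_mk_over[of a "q a w" X "q a w'" p mul] that qS mulX by (simp add: SX)
  show ?thesis
  proof (rule that[OF E, of q], unfold psh_mk_over snd_mk_over SX, goal_cases)
    case (6 a w w')
    then show ?case by (rule mlX[symmetric])
  qed (use qS ex q_iff pX ResX in simp_all)
qed

end

section \<open>Presentations and adjunctions\<close>

context generators begin

text \<open>A map of presheaves over \<open>G\<close> from the generators to \<open>E\<close>, with
  its values off the generators left free.\<close>

definition valuation :: "('o, 'm, 'u) crs_monoid \<times> ('o \<Rightarrow> 'u \<Rightarrow> 'u) \<Rightarrow> ('o \<Rightarrow> 'x \<Rightarrow> 'u) \<Rightarrow> bool" where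
  "valuation E e \<longleftrightarrow>
     (\<forall>a \<in> Obj A. \<forall>x \<in> Xs a. e a x \<in> Sec (psh E) a \<and> snd E a (e a x) = dg a x) \<and>
     (\<forall>a \<in> Obj A. \<forall>b \<in> Obj A. \<forall>\<phi> \<in> Hom A a b. \<forall>x \<in> Xs b. e a (rs a b \<phi> x) = Res (psh E) a b \<phi> (e b x))"

primrec ev :: "('o, 'm, 'u) crs_monoid \<times> ('o \<Rightarrow> 'u \<Rightarrow> 'u) \<Rightarrow> ('o \<Rightarrow> 'x \<Rightarrow> 'u) \<Rightarrow> 'o \<Rightarrow> 'x list \<Rightarrow> 'u" where
  "ev E e a [] = un E a"
| "ev E e a (x # w) = ml E a (e a x) (ev E e a w)"

definition sat where
  "sat R E e \<longleftrightarrow> (\<forall>(a, w, w') \<in> R. ev E e a w = ev E e a w')"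

definition presented where
  "presented R K u \<longleftrightarrow> K \<in> Obj M \<and> valuation K u \<and> sat R K u \<and>
     (\<forall>E e. E \<in> Obj M \<and> valuation E e \<and> sat R E e \<longrightarrow>
        (\<exists>!f. f \<in> Hom M K E \<and> (\<forall>a \<in> Obj A. \<forall>x \<in> Xs a. f a (u a x) = e a x)))"

context
  fixes E e assumes E: "E \<in> Obj M" and e: "valuation E e"
begin

lemma valuation_closed: "\<lbrakk>a \<in> Obj A; x \<in> Xs a\<rbrakk> \<Longrightarrow> e a x \<in> Sec (psh E) a"
  and pr_valuation: "\<lbrakk>a \<in> Obj A; x \<in> Xs a\<rbrakk> \<Longrightarrow> snd E a (e a x) = dg a x"
  and valuation_rs: "\<lbrakk>a \<in> Obj A; b \<in> Obj A; \<phi> \<in> Hom A a b; x \<in> Xs b\<rbrakk>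
    \<Longrightarrow> e a (rs a b \<phi> x) = Res (psh E) a b \<phi> (e b x)"
  using e by (auto simp: valuation_def)

lemma ev_closed: "\<lbrakk>a \<in> Obj A; w \<in> lists (Xs a)\<rbrakk> \<Longrightarrow> ev E e a w \<in> Sec (psh E) a"
  by (induction w) (simp_all add: E valuation_closed)

lemma pr_ev: "\<lbrakk>a \<in> Obj A; w \<in> lists (Xs a)\<rbrakk> \<Longrightarrow> snd E a (ev E e a w) = dgw a w"
  by (induction w) (simp_all add: E valuation_closed ev_closed pr_valuation)

lemma ev_append: "\<lbrakk>a \<in> Obj A; w \<in> lists (Xs a); w' \<in> lists (Xs a)\<rbrakk>
    \<Longrightarrow> ev E e a (w @ w') = ml E a (ev E e a w) (ev E e a w')"
  by (induction w) (simp_all add: E valuation_closed ev_closed ml_assoc)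

lemma ev_rw: "\<lbrakk>a \<in> Obj A; b \<in> Obj A; \<phi> \<in> Hom A a b; w \<in> lists (Xs b)\<rbrakk>
    \<Longrightarrow> ev E e a (rw a b \<phi> w) = Res (psh E) a b \<phi> (ev E e b w)"
  by (induction w) (simp_all add: E valuation_closed ev_closed valuation_rs Res_ml pr_ev)

lemma hom_ev:
  assumes "E' \<in> Obj M" "f \<in> Hom M E E'" "a \<in> Obj A" "w \<in> lists (Xs a)"
  shows "f a (ev E e a w) = ev E' (\<lambda>a x. f a (e a x)) a w"
  using assms(4) by (induction w)
    (simp_all add: E valuation_closed ev_closed M_Hom_ml[OF E assms(1,2)] M_Hom_un[OF E assms(1,2)] assms(3))

end

lemma ev_cong: "\<lbrakk>w \<in> lists (Xs a); \<And>x. x \<in> Xs a \<Longrightarrow> e a x = e' a x\<rbrakk> \<Longrightarrow> ev E e a w = ev E e' a w"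
  by (induction w) simp_all

text \<open>The relations have to be homogeneous: by \<open>pr_ev\<close>, a relation between words
  of different degrees holds in no crossed monoid over \<open>G\<close>.\<close>

theorem presented_exists:
  assumes R: "\<And>a w w'. (a, w, w') \<in> R \<Longrightarrow>
    a \<in> Obj A \<and> w \<in> lists (Xs a) \<and> w' \<in> lists (Xs a) \<and> dgw a w = dgw a w'"
  shows "\<exists>K u. presented R K u"
proof -
  \<comment> \<open>Equality of degrees is put in by hand, so that the projection of the quotient to
    \<open>G\<close>, which reads degrees of words, is well defined.\<close>
  define eqv where "eqv a w w' \<longleftrightarrow> dgw a w = dgw a w' \<and>
    (\<forall>E e. E \<in> Obj M \<and> valuation E e \<and> sat R E e \<longrightarrow> ev E e a w = ev E e a w')" for a w w'
  interpret generators_cong A G T Xs rs dg eqv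
    by unfold_locales (auto simp: eqv_def dgw_append ev_append dgw_rw ev_rw)
  obtain K q where K: "K \<in> Obj M"
    and q_closed: "\<And>a w. \<lbrakk>a \<in> Obj A; w \<in> lists (Xs a)\<rbrakk> \<Longrightarrow> q a w \<in> Sec (psh K) a"
    and q_surj: "\<And>a z. \<lbrakk>a \<in> Obj A; z \<in> Sec (psh K) a\<rbrakk> \<Longrightarrow> \<exists>w \<in> lists (Xs a). z = q a w"
    and q_iff: "\<And>a w w'. \<lbrakk>a \<in> Obj A; w \<in> lists (Xs a); w' \<in> lists (Xs a)\<rbrakk> \<Longrightarrow> q a w = q a w' \<longleftrightarrow> eqv a w w'"
    and pr_q: "\<And>a w. \<lbrakk>a \<in> Obj A; w \<in> lists (Xs a)\<rbrakk> \<Longrightarrow> snd K a (q a w) = dgw a w"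
    and q_Nil: "\<And>a. a \<in> Obj A \<Longrightarrow> q a [] = un K a"
    and q_append: "\<And>a w w'. \<lbrakk>a \<in> Obj A; w \<in> lists (Xs a); w' \<in> lists (Xs a)\<rbrakk> \<Longrightarrow> q a (w @ w') = ml K a (q a w) (q a w')"
    and Res_q: "\<And>a b \<phi> w. \<lbrakk>a \<in> Obj A; b \<in> Obj A; \<phi> \<in> Hom A a b; w \<in> lists (Xs b)\<rbrakk>
      \<Longrightarrow> Res (psh K) a b \<phi> (q b w) = q a (rw a b \<phi> w)"
    by (rule quotient_exists) blast
  define u where "u a x = q a [x]" for a x
  have u: "valuation K u"
    by (simp add: valuation_def u_def q_closed pr_q Res_q)
  have ev_u: "ev K u a w = q a w" if "a \<in> Obj A" "w \<in> lists (Xs a)" for a w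
    using that(2)
  proof (induction w)
    case (Cons x w)
    then show ?case using q_append[of a "[x]" w] that(1) by (simp add: u_def)
  qed (simp add: q_Nil that(1))
  \<comment> \<open>The relations hold under every evaluation that \<open>eqv\<close> ranges over,
    so their two sides are congruent.\<close>
  have "sat R K u"
    using R by (auto simp: sat_def ev_u q_iff eqv_def split: prod.splits)
  moreover have "\<exists>!f. f \<in> Hom M K E \<and> (\<forall>a \<in> Obj A. \<forall>x \<in> Xs a. f a (u a x) = e a x)"
    if E: "E \<in> Obj M" and e: "valuation E e" and s: "sat R E e" for E e
  proof -
    define dq where "dq a z = (SOME w. w \<in> lists (Xs a) \<and> q a w = z)" for a z
    define f where "f = psh_map A (psh K) (\<lambda>a z. ev E e a (dq a z))"
    \<comment> \<open>The given valuation is one of those that \<open>eqv\<close> ranges over, hence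
      evaluation does not depend on the chosen word.\<close>
    have fq: "ev E e a (dq a (q a w)) = ev E e a w" if "a \<in> Obj A" "w \<in> lists (Xs a)" for a w
    proof -
      have "dq a (q a w) \<in> lists (Xs a) \<and> q a (dq a (q a w)) = q a w"
        unfolding dq_def by (rule someI[of _ w]) (use that in simp)
      then have "eqv a (dq a (q a w)) w" using q_iff that by blast
      then show ?thesis using E e s unfolding eqv_def by blast
    qed
    have f: "f \<in> Hom M K E"
      unfolding f_def
    proof (rule psh_map_in_Hom_M[OF K E], goal_cases)
      case (1 a z)
      then obtain w where "w \<in> lists (Xs a)" "z = q a w" using q_surj by blast
      then show ?case using 1 by (simp add: fq ev_closed[OF E e])
    next
      case (2 a b \<phi> z)
      then obtain w where "w \<in> lists (Xs b)" "z = q b w" using q_surj by blast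
      then show ?case using 2 by (simp add: fq Res_q ev_rw[OF E e])
    next
      case (3 a z)
      then obtain w where "w \<in> lists (Xs a)" "z = q a w" using q_surj by blast
      then show ?case using 3 by (simp add: fq pr_ev[OF E e] pr_q)
    next
      case (4 a y z)
      then obtain v w where "v \<in> lists (Xs a)" "y = q a v" "w \<in> lists (Xs a)" "z = q a w"
        using q_surj by meson
      then show ?case using 4 by (simp add: fq ev_append[OF E e] q_append[symmetric])
    next
      case (5 a)
      then show ?case by (simp add: fq q_Nil[symmetric])
    qed
    show ?thesis
    proof (rule ex1I[of _ f])
      show "f \<in> Hom M K E \<and> (\<forall>a \<in> Obj A. \<forall>x \<in> Xs a. f a (u a x) = e a x)"
        using f by (simp add: f_def u_def q_closed fq E valuation_closed[OF E e])
    next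
      fix g assume g: "g \<in> Hom M K E \<and> (\<forall>a \<in> Obj A. \<forall>x \<in> Xs a. g a (u a x) = e a x)"
      show "g = f"
      proof (rule M_Hom_eqI[OF K E _ f])
        fix a z assume a: "a \<in> Obj A" and "z \<in> Sec (psh K) a"
        then obtain w where w: "w \<in> lists (Xs a)" "z = q a w" using q_surj by blast
        have "g a z = ev E (\<lambda>a x. g a (u a x)) a w"
          using hom_ev[OF K u E _ a w(1)] g a w by (simp add: ev_u)
        also have "\<dots> = ev E e a w" using g a w by (intro ev_cong) auto
        finally show "g a z = f a z" using a w q_closed by (simp add: f_def fq)
      qed (use g in blast)
    qed
  qed
  ultimately show ?thesis unfolding presented_def using K u by blast
qed

end

text \<open>\<open>tr\<close> is transposition along the universal arrow and is injective on arrows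
  out of \<open>F0 x\<close>. Hence functoriality, naturality of the counit and the left triangle
  identity are all checked on transposes.\<close>

lemma adjunction_of_universal_arrows:
  fixes C :: "('x, 'f) cat" and D :: "('y, 'g) cat"
  assumes U: "is_functor D C U"
    and F0: "\<And>x. x \<in> Obj C \<Longrightarrow> F0 x \<in> Obj D"
    and \<eta>: "\<And>x. x \<in> Obj C \<Longrightarrow> \<eta> x \<in> Hom C x (FObj U (F0 x))"
    and univ: "\<And>x y f. \<lbrakk>x \<in> Obj C; y \<in> Obj D; f \<in> Hom C x (FObj U y)\<rbrakk> \<Longrightarrow>
      \<exists>!g. g \<in> Hom D (F0 x) y \<and> Comp C x (FObj U (F0 x)) (FObj U y) (FArr U (F0 x) y g) (\<eta> x) = f"
  shows "\<exists>F \<epsilon>. adjunction C D F U \<eta> \<epsilon>"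
proof -
  interpret C: category C using U by (rule functor_cod)
  interpret D: category D using U by (rule functor_dom)
  let ?U = "FObj U"
  note UO = functor_Obj[OF U] and UA = functor_Hom[OF U] and UI = functor_Id[OF U] and UC = functor_Comp[OF U]
  define tr where "tr x y g = Comp C x (?U (F0 x)) (?U y) (FArr U (F0 x) y g) (\<eta> x)" for x y g
  define lift where "lift x y f = (THE g. g \<in> Hom D (F0 x) y \<and> tr x y g = f)" for x y f
  have lift: "lift x y f \<in> Hom D (F0 x) y" "tr x y (lift x y f) = f"
    if "x \<in> Obj C" "y \<in> Obj D" "f \<in> Hom C x (?U y)" for x y f
    using theI'[OF univ[OF that]] by (simp_all add: lift_def tr_def)
  have eq: "g = g'" if "x \<in> Obj C" "y \<in> Obj D" "g \<in> Hom D (F0 x) y" "g' \<in> Hom D (F0 x) y" "tr x y g = tr x y g'"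
    for x y g g'
    using univ[OF that(1,2), of "tr x y g"] that F0 UO UA \<eta> C.Comp_in_Hom by (auto simp: tr_def)
  have tr_Comp: "tr x y' (Comp D (F0 x) y y' h g) = Comp C x (?U y) (?U y') (FArr U y y' h) (tr x y g)"
    if "x \<in> Obj C" "y \<in> Obj D" "y' \<in> Obj D" "g \<in> Hom D (F0 x) y" "h \<in> Hom D y y'" for x y y' g h
    using that F0 UO UA \<eta> by (simp add: tr_def UC C.Comp_assoc)
  have tr_Id: "tr x (F0 x) (Id D (F0 x)) = \<eta> x" if "x \<in> Obj C" for x
    using that F0 UO \<eta> by (simp add: tr_def UI C.Comp_Id_left)
  define FA where "FA x x' f = lift x (F0 x') (Comp C x x' (?U (F0 x')) (\<eta> x') f)" for x x' f
  have FA: "FA x x' f \<in> Hom D (F0 x) (F0 x')" "tr x (F0 x') (FA x x' f) = Comp C x x' (?U (F0 x')) (\<eta> x') f"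
    if "x \<in> Obj C" "x' \<in> Obj C" "f \<in> Hom C x x'" for x x' f
    unfolding FA_def using that F0 UO \<eta> by (auto intro!: lift C.Comp_in_Hom)
  define F where "F = \<lparr>FObj = F0, FArr = FA\<rparr>"
  define \<epsilon> where "\<epsilon> y = lift (?U y) y (Id C (?U y))" for y
  have \<epsilon>: "\<epsilon> y \<in> Hom D (F0 (?U y)) y" "tr (?U y) y (\<epsilon> y) = Id C (?U y)" if "y \<in> Obj D" for y
    unfolding \<epsilon>_def using that UO by (auto intro!: lift C.Id_in_Hom)
  have F: "is_functor C D F"
    unfolding is_functor_def F_def
  proof (intro conjI ballI, simp_all add: F0 FA C.category_axioms D.category_axioms)
    fix x assume "x \<in> Obj C"
    then show "FA x x (Id C x) = Id D (F0 x)"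
      by (intro eq[of x "F0 x"]) (simp_all add: F0 FA D.Id_in_Hom C.Id_in_Hom tr_Id C.Comp_Id_right UO \<eta>)
  next
    fix x y z f g assume *: "x \<in> Obj C" "y \<in> Obj C" "z \<in> Obj C" "f \<in> Hom C x y" "g \<in> Hom C y z"
    have "Comp C x (?U (F0 y)) (?U (F0 z)) (FArr U (F0 y) (F0 z) (FA y z g)) (Comp C x y (?U (F0 y)) (\<eta> y) f)
       = Comp C x y (?U (F0 z)) (tr y (F0 z) (FA y z g)) f"
      using * F0 UO UA \<eta> FA(1) by (simp add: tr_def C.Comp_assoc)
    also have "\<dots> = Comp C x z (?U (F0 z)) (\<eta> z) (Comp C x y z g f)"
      using * F0 UO \<eta> by (simp add: FA C.Comp_assoc)
    finally show "FA x z (Comp C x y z g f) = Comp D (F0 x) (F0 y) (F0 z) (FA y z g) (FA x y f)"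
      using * by (intro eq[of x "F0 z"]) (simp_all add: F0 FA D.Comp_in_Hom C.Comp_in_Hom tr_Comp)
  qed
  have "adjunction C D F U \<eta> \<epsilon>"
    unfolding adjunction_def nat_trans_def
  proof (intro conjI ballI F U, simp_all add: F_def id_func_def comp_func_def \<eta> \<epsilon>)
    fix x y f assume "x \<in> Obj C" "y \<in> Obj C" "f \<in> Hom C x y"
    then show "Comp C x y (?U (F0 y)) (\<eta> y) f
      = Comp C x (?U (F0 x)) (?U (F0 y)) (FArr U (F0 x) (F0 y) (FA x y f)) (\<eta> x)"
      using FA(2) by (simp add: tr_def)
  next
    fix x y f assume *: "x \<in> Obj D" "y \<in> Obj D" "f \<in> Hom D x y"
    have "Comp C (?U x) (?U (F0 (?U y))) (?U y) (FArr U (F0 (?U y)) y (\<epsilon> y)) (Comp C (?U x) (?U y) (?U (F0 (?U y))) (\<eta> (?U y)) (FArr U x y f))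
       = Comp C (?U x) (?U y) (?U y) (tr (?U y) y (\<epsilon> y)) (FArr U x y f)"
      using * F0 UO UA \<eta> \<epsilon>(1) by (simp add: tr_def C.Comp_assoc)
    then show "Comp D (F0 (?U x)) (F0 (?U y)) y (\<epsilon> y) (FA (?U x) (?U y) (FArr U x y f)) =
       Comp D (F0 (?U x)) x y f (\<epsilon> x)"
      using * by (intro eq[of "?U x" y])
        (simp_all add: F0 FA UO UA \<epsilon> D.Comp_in_Hom tr_Comp C.Comp_Id_left C.Comp_Id_right)
  next
    fix x assume *: "x \<in> Obj C"
    have "Comp C x (?U (F0 (?U (F0 x)))) (?U (F0 x)) (FArr U (F0 (?U (F0 x))) (F0 x) (\<epsilon> (F0 x)))
        (Comp C x (?U (F0 x)) (?U (F0 (?U (F0 x)))) (\<eta> (?U (F0 x))) (\<eta> x))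
       = Comp C x (?U (F0 x)) (?U (F0 x)) (tr (?U (F0 x)) (F0 x) (\<epsilon> (F0 x))) (\<eta> x)"
      using * F0 UO UA \<eta> \<epsilon>(1) by (simp add: tr_def C.Comp_assoc)
    then show "Comp D (F0 x) (F0 (?U (F0 x))) (F0 x) (\<epsilon> (F0 x)) (FA x (?U (F0 x)) (\<eta> x)) = Id D (F0 x)"
      using * by (intro eq[of x "F0 x"])
        (simp_all add: F0 FA UO UA \<eta> \<epsilon> D.Comp_in_Hom D.Id_in_Hom tr_Comp tr_Id C.Comp_Id_left C.Comp_Id_right)
  next
    fix y assume "y \<in> Obj D"
    then show "Comp C (?U y) (?U (F0 (?U y))) (?U y) (FArr U (F0 (?U y)) y (\<epsilon> y)) (\<eta> (?U y)) = Id C (?U y)"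
      using \<epsilon>(2) by (simp add: tr_def)
  qed
  then show ?thesis by blast
qed

section \<open>Monadicity\<close>

lemma category_em_cat:
  fixes C :: "('x, 'f) cat"
  assumes T: "is_functor C C T"
  shows "category (em_cat C T \<eta> \<mu>)"
proof -
  interpret category C using T by (rule functor_dom)
  note TO = functor_Obj[OF T] and TA = functor_Hom[OF T] and TI = functor_Id[OF T] and TC = functor_Comp[OF T]
  show ?thesis
  proof (unfold_locales, goal_cases)
    case (1 a)
    then show ?case
      by (cases a) (simp add: em_cat_def Id_in_Hom TI Comp_Id_left Comp_Id_right TO)
  next
    case (2 a b c f g)
    obtain x h y k z l where e: "a = (x, h)" "b = (y, k)" "c = (z, l)" by (metis surj_pair)
    have *: "x \<in> Obj C" "y \<in> Obj C" "z \<in> Obj C" "h \<in> Hom C (FObj T x) x" "k \<in> Hom C (FObj T y) y"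
      "l \<in> Hom C (FObj T z) z" "f \<in> Hom C x y" "g \<in> Hom C y z"
      and f: "Comp C (FObj T x) x y f h = Comp C (FObj T x) (FObj T y) y k (FArr T x y f)"
      and g: "Comp C (FObj T y) y z g k = Comp C (FObj T y) (FObj T z) z l (FArr T y z g)"
      using 2 by (simp_all add: e em_cat_def)
    have "Comp C (FObj T x) x z (Comp C x y z g f) h = Comp C (FObj T x) (FObj T y) z (Comp C (FObj T y) y z g k) (FArr T x y f)"
      using * TO TA f by (simp add: Comp_assoc)
    also have "\<dots> = Comp C (FObj T x) (FObj T z) z l (FArr T x z (Comp C x y z g f))"
      using * TO TA by (simp add: g TC Comp_assoc)
    finally show ?case using * by (simp add: e em_cat_def Comp_in_Hom)
  next
    case (3 a b f)
    then show ?case by (cases a; cases b) (simp add: em_cat_def Comp_Id_right)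
  next
    case (4 a b f)
    then show ?case by (cases a; cases b) (simp add: em_cat_def Comp_Id_left)
  next
    case (5 a b c d f g h)
    then show ?case by (cases a; cases b; cases c; cases d) (simp add: em_cat_def Comp_assoc)
  qed
qed

lemma is_functor_comp_func:
  assumes "is_functor C D F" "is_functor D E G"
  shows "is_functor C E (comp_func G F)"
  using assms by (simp add: is_functor_def comp_func_def)

lemma is_functor_comparison:
  fixes C :: "('x, 'f) cat" and D :: "('y, 'g) cat"
  assumes adj: "adjunction C D F U \<eta> \<epsilon>"
  shows "is_functor D (em_cat C (comp_func U F) \<eta>
         (\<lambda>x. FArr U (FObj F (FObj U (FObj F x))) (FObj F x) (\<epsilon> (FObj F x)))) (comparison F U \<epsilon>)"
proof -
  note F = adjunction_functors(1)[OF adj] and U = adjunction_functors(2)[OF adj]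
  interpret D: category D using F by (rule functor_cod)
  note FO = functor_Obj[OF F] and UO = functor_Obj[OF U] and FA = functor_Hom[OF F]
    and UA = functor_Hom[OF U] and UI = functor_Id[OF U] and UC = functor_Comp[OF U]
    and \<epsilon> = adjunction_counit[OF adj] and \<epsilon>_nat = adjunction_counit_natural[OF adj]
    and tri = adjunction_triangle_right[OF adj]
  \<comment> \<open>Naturality of the counit, seen through \<open>U\<close>. At f = \<epsilon> y it
    is the associative law of the algebra on \<open>U y\<close>; at general \<open>f\<close> it says
    that \<open>U f\<close> is a map of algebras.\<close>
  have U\<epsilon>: "Comp C (FObj U (FObj F (FObj U x))) (FObj U (FObj F (FObj U y))) (FObj U y) (FArr U (FObj F (FObj U y)) y (\<epsilon> y))
          (FArr U (FObj F (FObj U x)) (FObj F (FObj U y)) (FArr F (FObj U x) (FObj U y) (FArr U x y f)))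
        = Comp C (FObj U (FObj F (FObj U x))) (FObj U x) (FObj U y) (FArr U x y f) (FArr U (FObj F (FObj U x)) x (\<epsilon> x))"
    if "x \<in> Obj D" "y \<in> Obj D" "f \<in> Hom D x y" for x y f
    using \<epsilon>_nat[OF that] that FO UO FA UA \<epsilon> by (simp flip: UC)
  show ?thesis
    unfolding is_functor_def
  proof (intro conjI ballI, goal_cases)
    case 1
    show ?case by (rule D.category_axioms)
  next
    case 2
    show ?case by (rule category_em_cat[OF is_functor_comp_func[OF F U]])
  next
    case (3 y)
    then show ?case using FO UO UA \<epsilon> tri U\<epsilon>[of "FObj F (FObj U y)" y "\<epsilon> y"]
      by (simp add: em_cat_def comparison_def comp_func_def)
  next
    case (4 x y f)
    then show ?case using UA U\<epsilon>[of x y f]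
      by (simp add: em_cat_def comparison_def comp_func_def)
  next
    case (5 y)
    then show ?case by (simp add: em_cat_def comparison_def UI)
  next
    case (6 x y z f g)
    then show ?case by (simp add: em_cat_def comparison_def UC)
  qed
qed

text \<open>Functors are records of total functions, so composites that agree on the category may
  still be unequal records. Identities then serve as the natural isomorphism.\<close>

lemma nat_iso_of_equal:
  assumes D: "category D" and F: "is_functor C D F" and G: "is_functor C D G"
    and O: "\<And>x. x \<in> Obj C \<Longrightarrow> FObj F x = FObj G x"
    and A: "\<And>x y f. \<lbrakk>x \<in> Obj C; y \<in> Obj C; f \<in> Hom C x y\<rbrakk> \<Longrightarrow> FArr F x y f = FArr G x y f"
  shows "nat_iso C D F G (\<lambda>x. Id D (FObj F x))"
proof -
  interpret category D by fact
  note FO = functor_Obj[OF G] and FA = functor_Hom[OF G]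
  have "is_iso D x x (Id D x)" if "x \<in> Obj D" for x
    using that Id_in_Hom Comp_Id_left unfolding is_iso_def by blast
  then show ?thesis
    by (simp add: nat_iso_def nat_trans_def O A FO FA Id_in_Hom Comp_Id_left Comp_Id_right)
qed

lemma is_functor_id_func: "category C \<Longrightarrow> is_functor C C id_func"
  by (simp add: is_functor_def id_func_def)

section \<open>Free crossed monoids over \<open>G\<close>\<close>

context crossed_group_over begin

text \<open>The sections of \<open>X\<close> with their own restrictions and degrees are the
  generators, and there are no relations. A valuation is then an arrow over \<open>G\<close> out of
  \<open>X\<close>, up to its values off the sections.\<close>

lemma free_exists:
  assumes x: "x \<in> Obj C"
  shows "\<exists>K \<eta>. K \<in> Obj M \<and> \<eta> \<in> Hom C x (FObj forget K) \<and>
    (\<forall>E f. E \<in> Obj M \<and> f \<in> Hom C x (FObj forget E) \<longrightarrow>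
      (\<exists>!g. g \<in> Hom M K E \<and> Comp C x (FObj forget K) (FObj forget E) g \<eta> = f))"
proof -
  obtain X p where xp: "x = (X, p)" by (cases x)
  have X: "is_presheaf A X" and p: "p \<in> Hom (psh_cat A) X gpsh" using x by (simp_all add: xp)
  have pc: "p a s \<in> carrier (Grp G a)" if "a \<in> Obj A" "s \<in> Sec X a" for a s
    using psh_Hom_closed[OF p that] by simp
  interpret generators A G T "Sec X" "Res X" p
    using X psh_Hom_natural[OF p]
    by unfold_locales (auto simp: pc presheaf_Res_closed presheaf_Res_Id presheaf_Res_Comp, simp add: is_presheaf_def)
  obtain K u where K: "presented {} K u" using presented_exists[of "{}"] by auto
  then have KM: "K \<in> Obj M" and u: "valuation K u" by (simp_all add: presented_def)
  let ?\<eta> = "psh_map A X u"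
  have \<eta>: "?\<eta> \<in> Hom C x (FObj forget K)"
  proof -
    have "?\<eta> \<in> Hom (psh_cat A) X (psh K)"
      by (rule psh_map_in_HomI) (simp_all add: valuation_closed[OF KM u] valuation_rs[OF KM u] presheaf_Res_closed[OF X])
    then show ?thesis using x forget_in_Obj[OF KM]
      by (simp add: xp Hom_C_iff pr_valuation[OF KM u] del: Hom_slice Obj_slice)
  qed
  moreover have "\<exists>!g. g \<in> Hom M K E \<and> Comp C x (FObj forget K) (FObj forget E) g ?\<eta> = f"
    if E: "E \<in> Obj M" and f: "f \<in> Hom C x (FObj forget E)" for E f
  proof -
    have fp: "f \<in> Hom (psh_cat A) X (psh E)" and fpr: "\<forall>a \<in> Obj A. \<forall>s \<in> Sec X a. snd E a (f a s) = p a s"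
      using f x forget_in_Obj[OF E] by (simp_all add: xp Hom_C_iff del: Hom_slice Obj_slice)
    then have "valuation E f"
      using psh_Hom_closed[OF fp] psh_Hom_natural[OF fp] by (simp add: valuation_def)
    then have ex: "\<exists>!g. g \<in> Hom M K E \<and> (\<forall>a \<in> Obj A. \<forall>s \<in> Sec X a. g a (u a s) = f a s)"
      using K E unfolding presented_def sat_def by blast
    have "Comp C x (FObj forget K) (FObj forget E) g ?\<eta> = f \<longleftrightarrow> (\<forall>a \<in> Obj A. \<forall>s \<in> Sec X a. g a (u a s) = f a s)"
      if g: "g \<in> Hom M K E" for g
    proof -
      have "?\<eta> \<in> Hom (psh_cat A) X (psh K)" using \<eta> by (simp add: xp)
      then have "Comp (psh_cat A) X (psh K) (psh E) g ?\<eta> \<in> Hom (psh_cat A) X (psh E)"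
        using M_Hom_psh[OF KM E g] X by (intro psh_Comp_in_Hom)
      from psh_Hom_eqI[OF this fp] show ?thesis by (auto simp: xp)
    qed
    then show ?thesis using ex by (simp cong: conj_cong)
  qed
  ultimately show ?thesis using KM by blast
qed

lemma adjunction_exists: "\<exists>F \<eta> \<epsilon>. adjunction C M F forget \<eta> \<epsilon>"
proof -
  have "\<forall>x. \<exists>K \<eta>. x \<in> Obj C \<longrightarrow> K \<in> Obj M \<and> \<eta> \<in> Hom C x (FObj forget K) \<and>
    (\<forall>E f. E \<in> Obj M \<and> f \<in> Hom C x (FObj forget E) \<longrightarrow>
      (\<exists>!g. g \<in> Hom M K E \<and> Comp C x (FObj forget K) (FObj forget E) g \<eta> = f))"
    using free_exists by blast
  then obtain F0 \<eta> where *: "\<And>x. x \<in> Obj C \<Longrightarrow> F0 x \<in> Obj M \<and> \<eta> x \<in> Hom C x (FObj forget (F0 x)) \<and>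
    (\<forall>E f. E \<in> Obj M \<and> f \<in> Hom C x (FObj forget E) \<longrightarrow>
      (\<exists>!g. g \<in> Hom M (F0 x) E \<and> Comp C x (FObj forget (F0 x)) (FObj forget E) g (\<eta> x) = f))"
    by metis
  have "\<exists>F \<epsilon>. adjunction C M F forget \<eta> \<epsilon>"
    by (rule adjunction_of_universal_arrows[OF functor_forget, of F0])
       (use * in \<open>simp_all only: FArr_forget\<close>)
  then show ?thesis by blast
qed

section \<open>Algebras as crossed monoids\<close>

context
  fixes F :: "(('o, 'm, 'u) presheaf \<times> ('o \<Rightarrow> 'u \<Rightarrow> 'u), 'o \<Rightarrow> 'u \<Rightarrow> 'u,
    ('o, 'm, 'u) crs_monoid \<times> ('o \<Rightarrow> 'u \<Rightarrow> 'u), 'o \<Rightarrow> 'u \<Rightarrow> 'u) func"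
    and \<eta> \<epsilon>
  assumes adj: "adjunction C M F forget \<eta> \<epsilon>"
begin

private lemmas F = adjunction_functors(1)[OF adj]

private abbreviation "F0 \<equiv> FObj F"
private abbreviation "EM \<equiv> em_cat C (comp_func forget F) \<eta>
  (\<lambda>x. FArr forget (F0 (FObj forget (F0 x))) (F0 x) (\<epsilon> (F0 x)))"

private lemmas F0 = functor_Obj[OF F]

private lemmas FA = functor_Hom[OF F]

private lemmas \<eta> = adjunction_unit[OF adj, unfolded FObj_forget]

private lemma \<eta>_psh: "(X, p) \<in> Obj C \<Longrightarrow> \<eta> (X, p) \<in> Hom (psh_cat A) X (psh (F0 (X, p)))"
  using \<eta>[of "(X, p)"] by (simp add: Hom_slice)

private lemma \<eta>_closed: "\<lbrakk>(X, p) \<in> Obj C; a \<in> Obj A; s \<in> Sec X a\<rbrakk> \<Longrightarrow> \<eta> (X, p) a s \<in> Sec (psh (F0 (X, p))) a"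
  using psh_Hom_closed[OF \<eta>_psh] .

private lemma \<eta>_Res: "\<lbrakk>(X, p) \<in> Obj C; a \<in> Obj A; b \<in> Obj A; \<phi> \<in> Hom A a b; s \<in> Sec X b\<rbrakk>
    \<Longrightarrow> \<eta> (X, p) a (Res X a b \<phi> s) = Res (psh (F0 (X, p))) a b \<phi> (\<eta> (X, p) b s)"
  using psh_Hom_natural[OF \<eta>_psh] .

private lemma \<eta>_pr: "\<lbrakk>(X, p) \<in> Obj C; a \<in> Obj A; s \<in> Sec X a\<rbrakk> \<Longrightarrow> snd (F0 (X, p)) a (\<eta> (X, p) a s) = p a s"
  using \<eta>[of "(X, p)"] forget_in_Obj[OF F0[of "(X, p)"]] by (simp add: Hom_C_iff del: Hom_slice Obj_slice)

private lemma \<eta>_nat: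
  assumes "(X, p) \<in> Obj C" "(Y, q) \<in> Obj C" "f \<in> Hom C (X, p) (Y, q)" "a \<in> Obj A" "s \<in> Sec X a"
  shows "FArr F (X, p) (Y, q) f a (\<eta> (X, p) a s) = \<eta> (Y, q) a (f a s)"
proof -
  have "Comp C (X, p) (Y, q) (psh (F0 (Y, q)), snd (F0 (Y, q))) (\<eta> (Y, q)) f
     = Comp C (X, p) (psh (F0 (X, p)), snd (F0 (X, p))) (psh (F0 (Y, q)), snd (F0 (Y, q))) (FArr F (X, p) (Y, q) f) (\<eta> (X, p))"
    using adjunction_unit_natural[OF adj assms(1-3)] by (simp del: Comp_slice)
  from fun_cong[OF fun_cong[OF this], of a s] show ?thesis using assms by simp
qed

private lemmas \<epsilon> = adjunction_counit[OF adj, unfolded FObj_forget]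

private lemma \<epsilon>_nat: "\<lbrakk>D \<in> Obj M; E \<in> Obj M; f \<in> Hom M D E; a \<in> Obj A; s \<in> Sec (psh (F0 (psh D, snd D))) a\<rbrakk>
   \<Longrightarrow> \<epsilon> E a (FArr F (psh D, snd D) (psh E, snd E) f a s) = f a (\<epsilon> D a s)"
proof -
  assume *: "D \<in> Obj M" "E \<in> Obj M" "f \<in> Hom M D E" "a \<in> Obj A" "s \<in> Sec (psh (F0 (psh D, snd D))) a"
  have "Comp M (F0 (psh D, snd D)) (F0 (psh E, snd E)) E (\<epsilon> E) (FArr F (psh D, snd D) (psh E, snd E) f)
    = Comp M (F0 (psh D, snd D)) D E f (\<epsilon> D)"
    using adjunction_counit_natural[OF adj *(1-3)] by (simp del: Comp_M)
  from fun_cong[OF fun_cong[OF this], of a s] show ?thesis using * by simp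
qed

private lemma \<epsilon>_F\<eta>: "\<lbrakk>(X, p) \<in> Obj C; a \<in> Obj A; s \<in> Sec (psh (F0 (X, p))) a\<rbrakk>
   \<Longrightarrow> \<epsilon> (F0 (X, p)) a (FArr F (X, p) (psh (F0 (X, p)), snd (F0 (X, p))) (\<eta> (X, p)) a s) = s"
proof -
  assume *: "(X, p) \<in> Obj C" "a \<in> Obj A" "s \<in> Sec (psh (F0 (X, p))) a"
  let ?x = "(X, p)"
  have "Comp M (F0 ?x) (F0 (psh (F0 ?x), snd (F0 ?x))) (F0 ?x) (\<epsilon> (F0 ?x)) (FArr F ?x (psh (F0 ?x), snd (F0 ?x)) (\<eta> ?x)) = Id M (F0 ?x)"
    using adjunction_triangle_left[OF adj *(1)] by (simp del: Comp_M Id_M)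
  from fun_cong[OF fun_cong[OF this], of a s] show ?thesis using * by simp
qed

private lemma \<epsilon>_\<eta>: "\<lbrakk>E \<in> Obj M; a \<in> Obj A; s \<in> Sec (psh E) a\<rbrakk> \<Longrightarrow> \<epsilon> E a (\<eta> (psh E, snd E) a s) = s"
proof -
  assume *: "E \<in> Obj M" "a \<in> Obj A" "s \<in> Sec (psh E) a"
  have "Comp C (psh E, snd E) (psh (F0 (psh E, snd E)), snd (F0 (psh E, snd E))) (psh E, snd E)
      (\<epsilon> E) (\<eta> (psh E, snd E)) = Id C (psh E, snd E)"
    using adjunction_triangle_right[OF adj *(1)] by (simp del: Comp_slice Id_slice)
  from fun_cong[OF fun_cong[OF this], of a s] show ?thesis using * by simp
qed

context
  fixes X p h assumes xh: "((X, p), h) \<in> Obj EM"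
begin

private abbreviation "K \<equiv> F0 (X, p)"

private lemma x: "(X, p) \<in> Obj C" using xh by (simp add: em_cat_def)

private lemma em_X: "is_presheaf A X" and em_p: "p \<in> Hom (psh_cat A) X gpsh" using x by simp_all

private lemmas K [simp] = F0[OF x]

private lemma h: "h \<in> Hom C (psh K, snd K) (X, p)"
  using xh by (simp add: em_cat_def comp_func_def)

private lemma h_psh: "h \<in> Hom (psh_cat A) (psh K) X" using h by simp

private lemma h_closed: "\<lbrakk>a \<in> Obj A; s \<in> Sec (psh K) a\<rbrakk> \<Longrightarrow> h a s \<in> Sec X a"
  by (rule psh_Hom_closed[OF h_psh])

private lemma h_Res: "\<lbrakk>a \<in> Obj A; b \<in> Obj A; \<phi> \<in> Hom A a b; s \<in> Sec (psh K) b\<rbrakk>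
    \<Longrightarrow> h a (Res (psh K) a b \<phi> s) = Res X a b \<phi> (h b s)"
  by (rule psh_Hom_natural[OF h_psh])

private lemma h_pr: "\<lbrakk>a \<in> Obj A; s \<in> Sec (psh K) a\<rbrakk> \<Longrightarrow> p a (h a s) = snd K a s"
  using h x forget_in_Obj[OF K] by (simp add: Hom_C_iff del: Hom_slice Obj_slice)

private lemma h_\<eta>: "\<lbrakk>a \<in> Obj A; s \<in> Sec X a\<rbrakk> \<Longrightarrow> h a (\<eta> (X, p) a s) = s"
proof -
  assume *: "a \<in> Obj A" "s \<in> Sec X a"
  have "Comp C (X, p) (psh K, snd K) (X, p) h (\<eta> (X, p)) = Id C (X, p)"
    using xh by (simp add: em_cat_def comp_func_def)
  from fun_cong[OF fun_cong[OF this], of a s] show ?thesis using * by simp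
qed

private abbreviation "KK \<equiv> F0 (psh K, snd K)"

private lemma KC: "(psh K, snd K) \<in> Obj C" by (rule forget_in_Obj[OF K])

private lemmas KK [simp] = F0[OF KC]

private lemma h_alg: "\<lbrakk>a \<in> Obj A; s \<in> Sec (psh KK) a\<rbrakk>
    \<Longrightarrow> h a (FArr F (psh K, snd K) (X, p) h a s) = h a (\<epsilon> K a s)"
proof -
  assume *: "a \<in> Obj A" "s \<in> Sec (psh KK) a"
  have "Comp C (psh KK, snd KK) (psh K, snd K) (X, p) h (FArr F (psh K, snd K) (X, p) h)
      = Comp C (psh KK, snd KK) (psh K, snd K) (X, p) h (\<epsilon> K)"
    using xh by (simp add: em_cat_def comp_func_def)
  from fun_cong[OF fun_cong[OF this], of a s] show ?thesis using * by simp
qed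

definition em_ml where "em_ml = (\<lambda>a s t. h a (ml K a (\<eta> (X, p) a s) (\<eta> (X, p) a t)))"
definition em_un where "em_un = (\<lambda>a. h a (un K a))"

private lemmas \<eta>c = \<eta>_closed[OF x]
private lemmas Fh = FA[OF KC x h]
private lemmas \<mu> = \<epsilon>[OF K]

text \<open>Products in \<open>K\<close> are images of products of units in \<open>F (U K)\<close>, so the algebra law applies to them.\<close>

private lemma h_ml:
  assumes "a \<in> Obj A" "s \<in> Sec (psh K) a" "t \<in> Sec (psh K) a"
  shows "h a (ml K a s t) = em_ml a (h a s) (h a t)"
proof -
  let ?\<eta> = "\<eta> (psh K, snd K) a"
  have c: "?\<eta> s \<in> Sec (psh KK) a" "?\<eta> t \<in> Sec (psh KK) a"
    using \<eta>_closed[OF KC] assms by simp_all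
  have "em_ml a (h a s) (h a t)
      = h a (ml K a (FArr F (psh K, snd K) (X, p) h a (?\<eta> s)) (FArr F (psh K, snd K) (X, p) h a (?\<eta> t)))"
    using assms by (simp add: em_ml_def \<eta>_nat[OF KC x h])
  also have "\<dots> = h a (FArr F (psh K, snd K) (X, p) h a (ml KK a (?\<eta> s) (?\<eta> t)))"
    using assms c by (simp add: M_Hom_ml[OF KK K Fh])
  also have "\<dots> = h a (\<epsilon> K a (ml KK a (?\<eta> s) (?\<eta> t)))"
    using assms c by (simp add: h_alg)
  also have "\<dots> = h a (ml K a s t)"
    using assms c by (simp add: M_Hom_ml[OF KK K \<mu>] \<epsilon>_\<eta>)
  finally show ?thesis ..
qed

text \<open>\<open>h\<close> preserves products by \<open>h_ml\<close> and retracts the unit \<eta>,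
  so every law is the image under \<open>h\<close> of the same law in \<open>K\<close>, read at
  elements coming from \<open>X\<close> along \<eta>.\<close>

private lemma em_struct: "crs_mon_struct X p em_ml em_un"
  unfolding crs_mon_struct_def
proof (intro conjI ballI em_X em_p, goal_cases)
  case (1 a)
  then show ?case by (simp add: em_un_def h_closed)
next
  case (2 a)
  then show ?case by (simp add: em_un_def h_pr)
next
  case (3 a s)
  then show ?case using h_ml[of a "un K a" "\<eta> (X, p) a s"] by (simp add: em_un_def \<eta>c h_\<eta>)
next
  case (4 a s)
  then show ?case using h_ml[of a "\<eta> (X, p) a s" "un K a"] by (simp add: em_un_def \<eta>c h_\<eta>)
next
  case (5 a s t)
  then show ?case by (simp add: em_ml_def h_closed \<eta>c)
next
  case (6 a s t)
  then show ?case by (simp add: em_ml_def h_pr \<eta>c \<eta>_pr[OF x])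
next
  case (7 a s t v)
  let ?\<eta> = "\<eta> (X, p) a"
  have "em_ml a (em_ml a s t) v = h a (ml K a (ml K a (?\<eta> s) (?\<eta> t)) (?\<eta> v))"
    using 7 h_ml[of a "ml K a (?\<eta> s) (?\<eta> t)" "?\<eta> v"] h_ml[of a "?\<eta> s" "?\<eta> t"] by (simp add: \<eta>c h_\<eta>)
  also have "\<dots> = h a (ml K a (?\<eta> s) (ml K a (?\<eta> t) (?\<eta> v)))"
    using 7 by (simp add: ml_assoc \<eta>c)
  also have "\<dots> = em_ml a s (em_ml a t v)"
    using 7 h_ml[of a "?\<eta> s" "ml K a (?\<eta> t) (?\<eta> v)"] h_ml[of a "?\<eta> t" "?\<eta> v"] by (simp add: \<eta>c h_\<eta>)
  finally show ?case .
next
  case (8 a b \<phi>)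
  then show ?case using h_Res[of a b \<phi> "un K b"] by (simp add: em_un_def)
next
  case (9 a b \<phi> s t)
  then have "p b t \<in> carrier (Grp G b)" using psh_Hom_closed[OF em_p] by simp
  then show ?case using 9 h_Res[of a b \<phi> "ml K b (\<eta> (X, p) b s) (\<eta> (X, p) b t)"]
    by (simp add: em_ml_def \<eta>c Res_ml \<eta>_pr[OF x] \<eta>_Res[OF x])
qed

private abbreviation "EE \<equiv> mk_over X p em_ml em_un"

lemma em_mk_in_Obj: "EE \<in> Obj M"
  by (rule mk_over_in_Obj[OF em_struct])

lemma em_h_Hom: "h \<in> Hom M K EE"
  unfolding Hom_M_iff[OF K em_mk_in_Obj] psh_mk_over snd_mk_over
  using h_psh by (simp add: h_pr h_ml h_closed em_un_def)

text \<open>As \<open>h\<close> retracts \<eta>, every \<open>s\<close> in \<open>K\<close> is the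
  image under F h of F \<eta> applied to \<open>s\<close>. Naturality of the counit at the
  homomorphism \<open>h\<close> moves it past F h, and the triangle identity cancels F \<eta>. Thus
  the algebra is recovered on the nose.\<close>

lemma em_counit: "\<epsilon> EE = h"
proof -
  have \<epsilon>': "\<epsilon> EE \<in> Hom M K EE" using \<epsilon>[OF em_mk_in_Obj] by simp
  show ?thesis
  proof (rule M_Hom_eqI[OF K em_mk_in_Obj \<epsilon>' em_h_Hom])
    fix a s assume *: "a \<in> Obj A" "s \<in> Sec (psh K) a"
    let ?t = "FArr F (X, p) (psh K, snd K) (\<eta> (X, p))"
    have t: "?t \<in> Hom M K KK" using x KC \<eta>[OF x] by (rule FA)
    have c: "Comp C (X, p) (psh K, snd K) (X, p) h (\<eta> (X, p)) = Id C (X, p)"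
      using xh by (simp add: em_cat_def comp_func_def)
    have Fc: "Comp M K KK K (FArr F (psh K, snd K) (X, p) h) ?t = Id M K"
    proof -
      have "FArr F (X, p) (X, p) (Comp C (X, p) (psh K, snd K) (X, p) h (\<eta> (X, p)))
        = Comp M K KK K (FArr F (psh K, snd K) (X, p) h) ?t"
        using F x KC h \<eta>[OF x] unfolding is_functor_def by blast
      moreover have "FArr F (X, p) (X, p) (Id C (X, p)) = Id M K"
        using F x unfolding is_functor_def by blast
      ultimately show ?thesis using c by simp
    qed
    have "s = FArr F (psh K, snd K) (X, p) h a (?t a s)"
      using fun_cong[OF fun_cong[OF Fc], of a s] * by simp
    then have "\<epsilon> EE a s = \<epsilon> EE a (FArr F (psh K, snd K) (X, p) h a (?t a s))" by simp
    also have "\<dots> = h a (\<epsilon> K a (?t a s))"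
      using \<epsilon>_nat[OF K em_mk_in_Obj em_h_Hom, of a "?t a s"] * M_Hom_closed[OF K KK t] by simp
    also have "\<dots> = h a s" using \<epsilon>_F\<eta>[OF x *] by simp
    finally show "\<epsilon> EE a s = h a s" .
  qed
qed

end

text \<open>An algebra map commutes with the structure maps, \<eta> is natural and F f is a
  homomorphism; products of algebras are built from just these three.\<close>

lemma em_Hom:
  assumes x: "((X, p), h) \<in> Obj EM" and y: "((Y, q), k) \<in> Obj EM"
    and f: "f \<in> Hom EM ((X, p), h) ((Y, q), k)"
  shows "f \<in> Hom M (mk_over X p (em_ml X p h) (em_un X p h)) (mk_over Y q (em_ml Y q k) (em_un Y q k))"
proof -
  have xC: "(X, p) \<in> Obj C" and yC: "(Y, q) \<in> Obj C" using x y by (simp_all add: em_cat_def)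
  have fC: "f \<in> Hom C (X, p) (Y, q)" using f by (simp add: em_cat_def)
  note K = F0[OF xC] and L = F0[OF yC] and Ff = FA[OF xC yC fC]
  have fh: "f a (h a s) = k a (FArr F (X, p) (Y, q) f a s)" if "a \<in> Obj A" "s \<in> Sec (psh (F0 (X, p))) a" for a s
  proof -
    have "Comp C (psh (F0 (X, p)), snd (F0 (X, p))) (X, p) (Y, q) f h
       = Comp C (psh (F0 (X, p)), snd (F0 (X, p))) (psh (F0 (Y, q)), snd (F0 (Y, q))) (Y, q) k (FArr F (X, p) (Y, q) f)"
      using f by (simp add: em_cat_def comp_func_def)
    from fun_cong[OF fun_cong[OF this], of a s] show ?thesis using that by simp
  qed
  have fc: "f a s \<in> Sec Y a" "q a (f a s) = p a s" if "a \<in> Obj A" "s \<in> Sec X a" for a s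
    using fC xC yC that psh_Hom_closed[of f A X Y a s] by (simp_all add: Hom_C_iff del: Hom_slice Obj_slice)
  have fml: "f a (em_ml X p h a s t) = em_ml Y q k a (f a s) (f a t)" if "a \<in> Obj A" "s \<in> Sec X a" "t \<in> Sec X a" for a s t
    using that xC yC fC fh K by (simp add: em_ml_def[OF x] em_ml_def[OF y] \<eta>_closed M_Hom_ml[OF K L Ff] \<eta>_nat
        del: Hom_slice Obj_slice)
  have fu: "f a (em_un X p h a) = em_un Y q k a" if "a \<in> Obj A" for a
    using that fh K by (simp add: em_un_def[OF x] em_un_def[OF y] M_Hom_un[OF K L Ff])
  have fP: "f \<in> Hom (psh_cat A) X Y" using fC by simp
  show ?thesis
    unfolding Hom_M_iff[OF em_mk_in_Obj[OF x] em_mk_in_Obj[OF y]] psh_mk_over snd_mk_over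
    using fP by (simp add: fc fml fu)
qed

text \<open>The inverse takes an algebra to its carrier with \<open>em_ml\<close> and
  \<open>em_un\<close> and leaves arrows alone. Both composites are strict identities, so the
  comparison functor is even an isomorphism of categories.\<close>

lemma monadic_forget: "monadic C M F forget \<eta> \<epsilon>"
proof -
  define G where "G = \<lparr>FObj = (\<lambda>((X, p), h). mk_over X p (em_ml X p h) (em_un X p h)),
    FArr = (\<lambda>x y (f :: 'o \<Rightarrow> 'u \<Rightarrow> 'u). f)\<rparr>"
  let ?c = "comparison F forget \<epsilon>"
  have c: "is_functor M EM ?c" by (rule is_functor_comparison[OF adj])
  then have EM: "category EM" by (simp add: is_functor_def)
  have cO: "FObj ?c E = ((psh E, snd E), \<epsilon> E)" for E by (simp add: comparison_def)
  \<comment> \<open>The counit is a homomorphism and sends \<eta> s back to \<open>s\<close>, so the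
    product rebuilt from it is the original product; \<open>over_eqI\<close> turns this into
    equality of objects.\<close>
  have Gc: "FObj G ((psh E, snd E), \<epsilon> E) = E" if E: "E \<in> Obj M" for E
  proof -
    have "FObj ?c E \<in> Obj EM" using c E unfolding is_functor_def by blast
    then have x: "((psh E, snd E), \<epsilon> E) \<in> Obj EM" unfolding cO .
    note xC = forget_in_Obj[OF E]
    note K = F0[OF xC]
    show ?thesis
      unfolding G_def func.select_convs prod.case
    proof (rule over_eqI[OF em_mk_in_Obj[OF x] E], unfold psh_mk_over snd_mk_over)
      fix a s t assume "a \<in> Obj A" "s \<in> Sec (psh E) a" "t \<in> Sec (psh E) a"
      then show "ml (mk_over (psh E) (snd E) (em_ml (psh E) (snd E) (\<epsilon> E)) (em_un (psh E) (snd E) (\<epsilon> E))) a s t = ml E a s t"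
        by (simp add: em_ml_def[OF x] \<eta>_closed[OF xC] M_Hom_ml[OF K E \<epsilon>[OF E]] \<epsilon>_\<eta>[OF E])
    qed (simp_all add: em_un_def[OF x] M_Hom_un[OF K E \<epsilon>[OF E]])
  qed
  have cG: "FObj ?c (FObj G z) = z" if "z \<in> Obj EM" for z
  proof -
    obtain X p h where z: "z = ((X, p), h)" by (metis surj_pair)
    show ?thesis using em_counit[of X p h] that by (simp add: z cO G_def)
  qed
  have G: "is_functor EM M G"
    unfolding is_functor_def
  proof (intro conjI ballI EM category_M, goal_cases)
    case (1 z)
    then show ?case by (cases z) (auto simp: G_def em_mk_in_Obj)
  next
    case (2 z z' f)
    obtain X p h Y q k where z: "z = ((X, p), h)" "z' = ((Y, q), k)" by (metis surj_pair)
    show ?case using em_Hom[of X p h Y q k f] 2 by (simp add: G_def z)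
  next
    case (3 z)
    then show ?case by (cases z) (auto simp: G_def em_cat_def)
  next
    case (4 z z' z'' f g)
    then show ?case by (cases z; cases z'; cases z'') (auto simp: G_def em_cat_def)
  qed
  have "\<exists>\<alpha>. nat_iso M M id_func (comp_func G ?c) \<alpha>"
    by (rule exI, rule nat_iso_of_equal[OF category_M is_functor_id_func[OF category_M] is_functor_comp_func[OF c G]])
       (simp_all only: id_func_def comp_func_def func.select_convs cO Gc, simp add: G_def comparison_def)
  moreover have "\<exists>\<beta>. nat_iso EM EM (comp_func ?c G) id_func \<beta>"
    by (rule exI, rule nat_iso_of_equal[OF EM is_functor_comp_func[OF G c] is_functor_id_func[OF EM]])
       (simp_all only: id_func_def comp_func_def func.select_convs cG, simp add: G_def comparison_def)
  ultimately show ?thesis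
    unfolding monadic_def equivalence_def using c G by blast
qed

end

end

section \<open>Colimits of crossed monoids\<close>

lemma ordLess_cong_ordIso: "r =o r' \<Longrightarrow> |S| <o r \<longleftrightarrow> |S| <o r'"
  by (meson ordIso_symmetric ordLess_ordIso_trans)

lemma filtered_ordIso: "r =o r' \<Longrightarrow> filtered r J \<longleftrightarrow> filtered r' J"
  unfolding filtered_def by (simp only: ordLess_cong_ordIso)

lemma filtered_natLeq_boundE:
  assumes "filtered natLeq J" "finite S" "S \<subseteq> Obj J"
  obtains c where "c \<in> Obj J" "\<And>a. a \<in> S \<Longrightarrow> Hom J a c \<noteq> {}"
proof -
  have "\<exists>c \<in> Obj J. \<forall>a \<in> S. Hom J a c \<noteq> {}"
    using conjunct1[OF assms(1)[unfolded filtered_def], rule_format, of S] assms(2,3)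
    by (simp add: finite_iff_ordLess_natLeq)
  then show ?thesis using that by auto
qed

lemma filtered_natLeq_coeqE:
  assumes "filtered natLeq J" "a \<in> Obj J" "b \<in> Obj J" "f \<in> Hom J a b" "g \<in> Hom J a b"
  obtains c h where "c \<in> Obj J" "h \<in> Hom J b c" "Comp J a b c h f = Comp J a b c h g"
proof -
  have "|{f, g}| <o natLeq" by (simp flip: finite_iff_ordLess_natLeq)
  moreover have "{f, g} \<subseteq> Hom J a b" using assms by simp
  ultimately have "\<exists>c \<in> Obj J. \<exists>h \<in> Hom J b c. \<forall>f' \<in> {f, g}. \<forall>g' \<in> {f, g}. Comp J a b c h f' = Comp J a b c h g'"
    using conjunct2[OF assms(1)[unfolded filtered_def], rule_format, OF assms(2,3), of "{f, g}"] by blast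
  then show ?thesis using that by auto
qed

section \<open>Arbitrary small colimits of crossed monoids over \<open>G\<close>\<close>

locale diagram = crossed_group_over A G T
  for A :: "('o, 'm) cat" and G T :: "('o, 'm, 'u) crs_group" +
  fixes J :: "('i, 'j) cat"
    and D :: "('i, 'j, ('o, 'm, 'u) crs_monoid \<times> ('o \<Rightarrow> 'u \<Rightarrow> 'u), 'o \<Rightarrow> 'u \<Rightarrow> 'u) func"
  assumes functor_D: "is_functor J M D" and small_J: "small TYPE('u) (Obj J)"
begin

sublocale J: category J using functor_D by (simp add: is_functor_def)

abbreviation "D0 \<equiv> FObj D"
abbreviation "D1 \<equiv> FArr D"

lemma D0 [simp]: "i \<in> Obj J \<Longrightarrow> D0 i \<in> Obj M"
  by (rule functor_Obj[OF functor_D])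

lemma D1: "\<lbrakk>i \<in> Obj J; j \<in> Obj J; f \<in> Hom J i j\<rbrakk> \<Longrightarrow> D1 i j f \<in> Hom M (D0 i) (D0 j)"
  by (rule functor_Hom[OF functor_D])

lemma D1_closed [simp]: "\<lbrakk>i \<in> Obj J; j \<in> Obj J; f \<in> Hom J i j; a \<in> Obj A; s \<in> Sec (psh (D0 i)) a\<rbrakk>
    \<Longrightarrow> D1 i j f a s \<in> Sec (psh (D0 j)) a"
  by (rule M_Hom_closed[OF _ _ D1]) simp_all

lemma D1_Id [simp]: "\<lbrakk>i \<in> Obj J; a \<in> Obj A; s \<in> Sec (psh (D0 i)) a\<rbrakk> \<Longrightarrow> D1 i i (Id J i) a s = s"
  using functor_D by (simp add: is_functor_def)

lemma D1_Comp: "\<lbrakk>i \<in> Obj J; j \<in> Obj J; k \<in> Obj J; f \<in> Hom J i j; g \<in> Hom J j k; a \<in> Obj A; s \<in> Sec (psh (D0 i)) a\<rbrakk>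
    \<Longrightarrow> D1 i k (Comp J i j k g f) a s = D1 j k g a (D1 i j f a s)"
  using functor_D by (simp add: is_functor_def)

lemmas D1_ml = M_Hom_ml[OF D0 D0 D1]
lemmas D1_un = M_Hom_un[OF D0 D0 D1]
lemmas D1_pr = M_Hom_pr[OF D0 D0 D1]
lemmas D1_Res = M_Hom_Res[OF D0 D0 D1]

text \<open>The coproduct of the underlying presheaves over \<open>G\<close>, which supplies the
  generators of the colimit.\<close>

definition cop_Sec where "cop_Sec a = Sigma (Obj J) (\<lambda>i. Sec (psh (D0 i)) a)"
definition cop_Res where "cop_Res a b \<phi> x = (fst x, Res (psh (D0 (fst x))) a b \<phi> (snd x))"
definition cop_pr where "cop_pr a x = snd (D0 (fst x)) a (snd x)"

lemma in_cop_Sec [simp]: "(i, s) \<in> cop_Sec a \<longleftrightarrow> i \<in> Obj J \<and> s \<in> Sec (psh (D0 i)) a"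
  by (simp add: cop_Sec_def)

sublocale generators A G T cop_Sec cop_Res cop_pr
proof
  show "small TYPE('u) (cop_Sec a)" if "a \<in> Obj A" for a
    unfolding cop_Sec_def using that by (intro small_Sigma universe small_J small_Sec) simp_all
qed (auto simp: cop_Sec_def cop_Res_def cop_pr_def Res_Comp)

lemma colimit_exists: "\<exists>c \<iota>. is_colimit J M D c \<iota>"
proof -
  \<comment> \<open>The first family identifies elements along the diagram; the other two make the
    inclusions preserve products and units. Restrictions and degrees are built into the generators,
    so satisfying \<open>R\<close> amounts to being a cocone of homomorphisms.\<close>
  define R where "R = {(a, [(i, s)], [(j, D1 i j f a s)]) | a i j f s.
        a \<in> Obj A \<and> i \<in> Obj J \<and> j \<in> Obj J \<and> f \<in> Hom J i j \<and> s \<in> Sec (psh (D0 i)) a}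
     \<union> {(a, [(i, s), (i, t)], [(i, ml (D0 i) a s t)]) | a i s t.
        a \<in> Obj A \<and> i \<in> Obj J \<and> s \<in> Sec (psh (D0 i)) a \<and> t \<in> Sec (psh (D0 i)) a}
     \<union> {(a, [], [(i, un (D0 i) a)]) | a i. a \<in> Obj A \<and> i \<in> Obj J}"
  have "\<exists>K u. presented R K u"
    by (rule presented_exists) (auto simp: R_def cop_pr_def D1_pr)
  then obtain K u where Ku: "presented R K u" by blast
  then have K: "K \<in> Obj M" and u: "valuation K u" and s: "sat R K u" by (simp_all add: presented_def)
  have sat_iff: "sat R E e \<longleftrightarrow>
      (\<forall>a \<in> Obj A. \<forall>i \<in> Obj J. \<forall>j \<in> Obj J. \<forall>f \<in> Hom J i j. \<forall>s \<in> Sec (psh (D0 i)) a. e a (i, s) = e a (j, D1 i j f a s)) \<and>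
      (\<forall>a \<in> Obj A. \<forall>i \<in> Obj J. \<forall>s \<in> Sec (psh (D0 i)) a. \<forall>t \<in> Sec (psh (D0 i)) a.
         ml E a (e a (i, s)) (e a (i, t)) = e a (i, ml (D0 i) a s t)) \<and>
      (\<forall>a \<in> Obj A. \<forall>i \<in> Obj J. un E a = e a (i, un (D0 i) a))" (is "_ \<longleftrightarrow> ?P")
    if E: "E \<in> Obj M" and e: "valuation E e" for E e
  proof -
    have c: "e a (i, s) \<in> Sec (psh E) a" if "a \<in> Obj A" "i \<in> Obj J" "s \<in> Sec (psh (D0 i)) a" for a i s
      using valuation_closed[OF E e] that by simp
    have "sat R E e \<longleftrightarrow>
      (\<forall>a \<in> Obj A. \<forall>i \<in> Obj J. \<forall>j \<in> Obj J. \<forall>f \<in> Hom J i j. \<forall>s \<in> Sec (psh (D0 i)) a. ev E e a [(i, s)] = ev E e a [(j, D1 i j f a s)]) \<and>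
      (\<forall>a \<in> Obj A. \<forall>i \<in> Obj J. \<forall>s \<in> Sec (psh (D0 i)) a. \<forall>t \<in> Sec (psh (D0 i)) a.
         ev E e a [(i, s), (i, t)] = ev E e a [(i, ml (D0 i) a s t)]) \<and>
      (\<forall>a \<in> Obj A. \<forall>i \<in> Obj J. ev E e a [] = ev E e a [(i, un (D0 i) a)])"
      unfolding sat_def R_def by blast
    also have "\<dots> \<longleftrightarrow> ?P" using E c by (simp cong: ball_cong)
    finally show ?thesis .
  qed
  define \<iota> where "\<iota> i = psh_map A (psh (D0 i)) (\<lambda>a s. u a (i, s))" for i
  note su = s[unfolded sat_iff[OF K u]]
  have \<iota>: "\<iota> i \<in> Hom M (D0 i) K" if i: "i \<in> Obj J" for i
    unfolding \<iota>_def
  proof (rule psh_map_in_Hom_M[OF D0[OF i] K], goal_cases)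
    case (2 a b \<phi> s)
    then show ?case using valuation_rs[OF K u, of a b \<phi> "(i, s)"] i by (simp add: cop_Res_def)
  next
    case (3 a s)
    then show ?case using pr_valuation[OF K u, of a "(i, s)"] i by (simp add: cop_pr_def)
  qed (use i su in \<open>simp_all add: valuation_closed[OF K u]\<close>)
  have cc: "cocone J M D K \<iota>"
    unfolding cocone_def
  proof (intro conjI ballI K \<iota>)
    fix i j f assume *: "i \<in> Obj J" "j \<in> Obj J" "f \<in> Hom J i j"
    then have "Comp M (D0 i) (D0 j) K (\<iota> j) (D1 i j f) \<in> Hom M (D0 i) K"
      by (intro category.Comp_in_Hom[OF category_M] K D0 D1 \<iota>)
    then show "Comp M (D0 i) (D0 j) K (\<iota> j) (D1 i j f) = \<iota> i"
    proof (rule M_Hom_eqI[OF D0[OF *(1)] K _ \<iota>[OF *(1)]])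
      fix a s assume as: "a \<in> Obj A" "s \<in> Sec (psh (D0 i)) a"
      have "u a (i, s) = u a (j, D1 i j f a s)" using su as * by blast
      then show "Comp M (D0 i) (D0 j) K (\<iota> j) (D1 i j f) a s = \<iota> i a s"
        using as * by (simp add: \<iota>_def)
    qed
  qed
  moreover have "\<exists>!f. f \<in> Hom M K E \<and> (\<forall>i \<in> Obj J. Comp M (D0 i) K E f (\<iota> i) = \<kappa> i)"
    if "cocone J M D E \<kappa>" for E \<kappa>
  proof -
    have E: "E \<in> Obj M" and \<kappa>: "\<And>i. i \<in> Obj J \<Longrightarrow> \<kappa> i \<in> Hom M (D0 i) E"
      and \<kappa>c: "\<And>i j f. \<lbrakk>i \<in> Obj J; j \<in> Obj J; f \<in> Hom J i j\<rbrakk> \<Longrightarrow> Comp M (D0 i) (D0 j) E (\<kappa> j) (D1 i j f) = \<kappa> i"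
      using that unfolding cocone_def by blast+
    define e where "e a x = \<kappa> (fst x) a (snd x)" for a x
    have e: "valuation E e"
      using M_Hom_closed[OF D0 E \<kappa>] M_Hom_pr[OF D0 E \<kappa>] M_Hom_Res[OF D0 E \<kappa>]
      by (auto simp: valuation_def e_def cop_Sec_def cop_Res_def cop_pr_def)
    have "\<kappa> j a (D1 i j f a s) = \<kappa> i a s"
      if "i \<in> Obj J" "j \<in> Obj J" "f \<in> Hom J i j" "a \<in> Obj A" "s \<in> Sec (psh (D0 i)) a" for i j f a s
      using \<kappa>c[OF that(1-3)] that(4,5) by (auto dest!: fun_cong[of _ _ a] fun_cong[of _ _ s])
    then have "sat R E e"
      unfolding sat_iff[OF E e] using M_Hom_ml[OF D0 E \<kappa>] M_Hom_un[OF D0 E \<kappa>] by (simp add: e_def)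
    then have ex: "\<exists>!f. f \<in> Hom M K E \<and> (\<forall>a \<in> Obj A. \<forall>x \<in> cop_Sec a. f a (u a x) = e a x)"
      using Ku E e unfolding presented_def by blast
    have "(\<forall>i \<in> Obj J. Comp M (D0 i) K E f (\<iota> i) = \<kappa> i) \<longleftrightarrow> (\<forall>a \<in> Obj A. \<forall>x \<in> cop_Sec a. f a (u a x) = e a x)"
      if f: "f \<in> Hom M K E" for f
    proof
      assume l: "\<forall>i \<in> Obj J. Comp M (D0 i) K E f (\<iota> i) = \<kappa> i"
      show "\<forall>a \<in> Obj A. \<forall>x \<in> cop_Sec a. f a (u a x) = e a x"
      proof (intro ballI)
        fix a x assume *: "a \<in> Obj A" "x \<in> cop_Sec a"
        then obtain i s where x: "x = (i, s)" "i \<in> Obj J" "s \<in> Sec (psh (D0 i)) a" by (cases x) auto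
        have "Comp M (D0 i) K E f (\<iota> i) a s = \<kappa> i a s" using l x by simp
        then show "f a (u a x) = e a x" using * x by (simp add: \<iota>_def e_def)
      qed
    next
      assume r: "\<forall>a \<in> Obj A. \<forall>x \<in> cop_Sec a. f a (u a x) = e a x"
      show "\<forall>i \<in> Obj J. Comp M (D0 i) K E f (\<iota> i) = \<kappa> i"
      proof
        fix i assume i: "i \<in> Obj J"
        then have "Comp M (D0 i) K E f (\<iota> i) \<in> Hom M (D0 i) E"
          by (intro category.Comp_in_Hom[OF category_M] K E D0 f \<iota>)
        then show "Comp M (D0 i) K E f (\<iota> i) = \<kappa> i"
        proof (rule M_Hom_eqI[OF D0[OF i] E _ \<kappa>[OF i]])
          fix a s assume as: "a \<in> Obj A" "s \<in> Sec (psh (D0 i)) a"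
          then have "f a (u a (i, s)) = e a (i, s)" using r i by simp
          then show "Comp M (D0 i) K E f (\<iota> i) a s = \<kappa> i a s" using as by (simp add: \<iota>_def e_def)
        qed
      qed
    qed
    then show ?thesis using ex by (simp cong: conj_cong)
  qed
  ultimately show ?thesis unfolding is_colimit_def by blast
qed

end

context crossed_group_over begin

text \<open>The criterion for a filtered colimit of sets, at each object of \<open>A\<close>.
  Separation is asked only within one stage, since filteredness moves elements of two stages to a
  common one.\<close>

definition concrete :: "('i, 'j) cat \<Rightarrow> ('i \<Rightarrow> ('o, 'm, 'u) presheaf) \<Rightarrow> ('i \<Rightarrow> 'i \<Rightarrow> 'j \<Rightarrow> 'o \<Rightarrow> 'u \<Rightarrow> 'u) \<Rightarrow>
    ('o, 'm, 'u) presheaf \<Rightarrow> ('i \<Rightarrow> 'o \<Rightarrow> 'u \<Rightarrow> 'u) \<Rightarrow> bool" where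
  "concrete J X D Y \<iota> \<longleftrightarrow>
     (\<forall>a \<in> Obj A. \<forall>z \<in> Sec Y a. \<exists>i \<in> Obj J. \<exists>s \<in> Sec (X i) a. z = \<iota> i a s) \<and>
     (\<forall>a \<in> Obj A. \<forall>i \<in> Obj J. \<forall>s \<in> Sec (X i) a. \<forall>t \<in> Sec (X i) a. \<iota> i a s = \<iota> i a t \<longrightarrow>
        (\<exists>k \<in> Obj J. \<exists>f \<in> Hom J i k. D i k f a s = D i k f a t))"

end

section \<open>Evaluation of words along a filtered diagram\<close>

locale filtered_diagram = diagram A G T J D
  for A :: "('o, 'm) cat" and G T :: "('o, 'm, 'u) crs_group"
    and J :: "('i, 'j) cat" and D +
  assumes filtered_J: "filtered natLeq J"
begin

lemma boundE:
  assumes "i \<in> Obj J" "j \<in> Obj J"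
  obtains k f g where "k \<in> Obj J" "f \<in> Hom J i k" "g \<in> Hom J j k"
proof -
  obtain k where k: "k \<in> Obj J" "\<And>a. a \<in> {i, j} \<Longrightarrow> Hom J a k \<noteq> {}"
    by (rule filtered_natLeq_boundE[OF filtered_J, of "{i, j}"]) (use assms in auto)
  obtain f g where "f \<in> Hom J i k" "g \<in> Hom J j k" using k(2)[of i] k(2)[of j] by auto
  then show ?thesis using that k(1) by metis
qed

text \<open>All values at stage \<open>k\<close>, one for each way of pushing the letters there.
  Parallel arrows may give different values, and keeping the whole set avoids a choice of arrows
  that nothing would make coherent.\<close>

primrec evs :: "'o \<Rightarrow> 'i \<Rightarrow> ('i \<times> 'u) list \<Rightarrow> 'u set" where
  "evs a k [] = {un (D0 k) a}"
| "evs a k (x # w) = {ml (D0 k) a (D1 (fst x) k f a (snd x)) z | f z. f \<in> Hom J (fst x) k \<and> z \<in> evs a k w}"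

lemma evs_closed: "\<lbrakk>a \<in> Obj A; k \<in> Obj J; w \<in> lists (cop_Sec a); z \<in> evs a k w\<rbrakk>
    \<Longrightarrow> z \<in> Sec (psh (D0 k)) a \<and> snd (D0 k) a z = dgw a w"
  by (induction w arbitrary: z) (auto simp: cop_pr_def D1_pr)

lemma evs_push: "\<lbrakk>a \<in> Obj A; k \<in> Obj J; l \<in> Obj J; g \<in> Hom J k l; w \<in> lists (cop_Sec a); z \<in> evs a k w\<rbrakk>
    \<Longrightarrow> D1 k l g a z \<in> evs a l w"
proof (induction w arbitrary: z)
  case Nil
  then show ?case by (simp add: D1_un)
next
  case (Cons x w)
  then obtain f y where z: "z = ml (D0 k) a (D1 (fst x) k f a (snd x)) y" "f \<in> Hom J (fst x) k" "y \<in> evs a k w"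
    by auto
  obtain i s where x: "x = (i, s)" "i \<in> Obj J" "s \<in> Sec (psh (D0 i)) a" using Cons.prems by (cases x) auto
  have w: "w \<in> lists (cop_Sec a)" using Cons.prems by simp
  have "D1 k l g a z = ml (D0 l) a (D1 i l (Comp J i k l g f) a s) (D1 k l g a y)"
    using Cons.prems z x evs_closed[OF _ _ w z(3)] by (simp add: D1_ml D1_Comp)
  moreover have "Comp J i k l g f \<in> Hom J i l" using Cons.prems z x by (simp add: J.Comp_in_Hom)
  moreover have "D1 k l g a y \<in> evs a l w" using Cons.IH Cons.prems z by simp
  ultimately show ?case using x by auto
qed

text \<open>Values differ only through parallel arrows. By induction the tails agree at a later
  stage; coequalising the two arrows applied to the head moves on to a stage where heads agree too,
  and the agreement of the tails persists.\<close>

lemma evs_confluent: "\<lbrakk>a \<in> Obj A; k \<in> Obj J; w \<in> lists (cop_Sec a); z \<in> evs a k w; z' \<in> evs a k w\<rbrakk>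
    \<Longrightarrow> \<exists>l \<in> Obj J. \<exists>g \<in> Hom J k l. D1 k l g a z = D1 k l g a z'"
proof (induction w arbitrary: z z')
  case Nil
  then show ?case using J.Id_in_Hom by auto
next
  case (Cons x w)
  obtain i s where x: "x = (i, s)" "i \<in> Obj J" "s \<in> Sec (psh (D0 i)) a" using Cons.prems by (cases x) auto
  have w: "w \<in> lists (cop_Sec a)" using Cons.prems by simp
  note k = Cons.prems(2) and a = Cons.prems(1)
  from Cons.prems(4) obtain f y where z: "z = ml (D0 k) a (D1 i k f a s) y" "f \<in> Hom J i k" "y \<in> evs a k w"
    by (auto simp: x)
  from Cons.prems(5) obtain f' y' where z': "z' = ml (D0 k) a (D1 i k f' a s) y'" "f' \<in> Hom J i k" "y' \<in> evs a k w"
    by (auto simp: x)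
  obtain l g where l: "l \<in> Obj J" "g \<in> Hom J k l" and g: "D1 k l g a y = D1 k l g a y'"
    using Cons.IH[OF a k w z(3) z'(3)] by blast
  obtain m h where m: "m \<in> Obj J" "h \<in> Hom J l m"
    and h: "Comp J i l m h (Comp J i k l g f) = Comp J i l m h (Comp J i k l g f')"
    using filtered_natLeq_coeqE[OF filtered_J x(2) l(1), of "Comp J i k l g f" "Comp J i k l g f'"]
      x l z z' k by (auto simp: J.Comp_in_Hom)
  note yc = evs_closed[OF a k w z(3)] evs_closed[OF a k w z'(3)]
  have "D1 i m (Comp J i l m h (Comp J i k l g f)) a s = D1 i m (Comp J i l m h (Comp J i k l g f')) a s"
    by (simp add: h)
  then have e: "D1 l m h a (D1 k l g a (D1 i k f a s)) = D1 l m h a (D1 k l g a (D1 i k f' a s))"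
    using a k l m x z z' by (simp add: D1_Comp J.Comp_in_Hom)
  have "D1 k m (Comp J k l m h g) a z = D1 k m (Comp J k l m h g) a z'"
    using a k l m x z z' yc e g by (simp add: D1_Comp D1_ml)
  then show ?case using k l m J.Comp_in_Hom by blast
qed

lemma evs_nonempty: "\<lbrakk>a \<in> Obj A; w \<in> lists (cop_Sec a)\<rbrakk> \<Longrightarrow> \<exists>k \<in> Obj J. \<exists>z. z \<in> evs a k w"
proof (induction w)
  case Nil
  \<comment> \<open>The empty word still needs a stage; the bound of the empty set is the
    nonemptiness of \<open>J\<close>.\<close>
  obtain k where "k \<in> Obj J" using filtered_natLeq_boundE[OF filtered_J, of "{}"] by auto
  then show ?case by auto
next
  case (Cons x w)
  obtain i s where x: "x = (i, s)" "i \<in> Obj J" "s \<in> Sec (psh (D0 i)) a" using Cons.prems by (cases x) auto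
  obtain k z where k: "k \<in> Obj J" "z \<in> evs a k w" using Cons by auto
  obtain m f g where "m \<in> Obj J" "f \<in> Hom J i m" "g \<in> Hom J k m" using boundE[OF x(2) k(1)] .
  moreover from this have "D1 k m g a z \<in> evs a m w" using Cons.prems k by (intro evs_push) simp_all
  ultimately have "m \<in> Obj J" "ml (D0 m) a (D1 i m f a s) (D1 k m g a z) \<in> evs a m (x # w)" by (auto simp: x)
  then show ?case by blast
qed

lemma evs_append: "\<lbrakk>a \<in> Obj A; k \<in> Obj J; w \<in> lists (cop_Sec a); w' \<in> lists (cop_Sec a); z \<in> evs a k w; z' \<in> evs a k w'\<rbrakk>
    \<Longrightarrow> ml (D0 k) a z z' \<in> evs a k (w @ w')"
proof (induction w arbitrary: z)
  case Nil
  then show ?case using evs_closed[of a k w' z'] by simp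
next
  case (Cons x w)
  obtain i s where x: "x = (i, s)" "i \<in> Obj J" "s \<in> Sec (psh (D0 i)) a" using Cons.prems by (cases x) auto
  have w: "w \<in> lists (cop_Sec a)" using Cons.prems by simp
  obtain f y where z: "z = ml (D0 k) a (D1 i k f a s) y" "f \<in> Hom J i k" "y \<in> evs a k w"
    using Cons.prems by (auto simp: x)
  have "ml (D0 k) a z z' = ml (D0 k) a (D1 i k f a s) (ml (D0 k) a y z')"
    using Cons.prems x z evs_closed[of a k w y] evs_closed[of a k w' z'] by (simp add: ml_assoc)
  then show ?case using Cons.IH[of y] Cons.prems z by (auto simp: x)
qed

lemma evs_rw: "\<lbrakk>a \<in> Obj A; b \<in> Obj A; \<phi> \<in> Hom A a b; k \<in> Obj J; w \<in> lists (cop_Sec b); z \<in> evs b k w\<rbrakk>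
    \<Longrightarrow> Res (psh (D0 k)) a b \<phi> z \<in> evs a k (rw a b \<phi> w)"
proof (induction w arbitrary: z)
  case Nil
  then show ?case by simp
next
  case (Cons x w)
  obtain i s where x: "x = (i, s)" "i \<in> Obj J" "s \<in> Sec (psh (D0 i)) b" using Cons.prems by (cases x) auto
  have w: "w \<in> lists (cop_Sec b)" using Cons.prems by simp
  obtain f y where z: "z = ml (D0 k) b (D1 i k f b s) y" "f \<in> Hom J i k" "y \<in> evs b k w"
    using Cons.prems by (auto simp: x)
  have "Res (psh (D0 k)) a b \<phi> z
     = ml (D0 k) a (D1 i k f a (Res (psh (D0 i)) a b (act a b (dgw b w) \<phi>) s)) (Res (psh (D0 k)) a b \<phi> y)"
    using Cons.prems x z w evs_closed[of b k w y] by (simp add: Res_ml D1_Res)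
  moreover have "Res (psh (D0 k)) a b \<phi> y \<in> evs a k (rw a b \<phi> w)"
    using Cons.IH[of y] Cons.prems z by simp
  moreover have "cop_Res a b \<psi> x = (i, Res (psh (D0 i)) a b \<psi> s)" for \<psi>
    by (simp add: cop_Res_def x)
  ultimately show ?case using z(2) by auto
qed

text \<open>One common value at one stage is enough: other values of the two words become equal to
  it later, by \<open>evs_confluent\<close>.\<close>

definition ceq where "ceq a w w' \<longleftrightarrow> (\<exists>k \<in> Obj J. \<exists>z. z \<in> evs a k w \<and> z \<in> evs a k w')"

lemma ceq_common:
  assumes a: "a \<in> Obj A" and w: "w \<in> lists (cop_Sec a)" "w' \<in> lists (cop_Sec a)" "ceq a w w'"
    and v: "v \<in> lists (cop_Sec a)" "v' \<in> lists (cop_Sec a)" "ceq a v v'"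
  obtains k y z where "k \<in> Obj J" "y \<in> evs a k w" "y \<in> evs a k w'" "z \<in> evs a k v" "z \<in> evs a k v'"
proof -
  obtain k y where k: "k \<in> Obj J" "y \<in> evs a k w" "y \<in> evs a k w'" using w by (auto simp: ceq_def)
  obtain l z where l: "l \<in> Obj J" "z \<in> evs a l v" "z \<in> evs a l v'" using v by (auto simp: ceq_def)
  obtain m f g where "m \<in> Obj J" "f \<in> Hom J k m" "g \<in> Hom J l m" using boundE[OF k(1) l(1)] .
  then show ?thesis using that[of m "D1 k m f a y" "D1 l m g a z"] a w v k l evs_push by blast
qed

sublocale ceq: generators_cong A G T cop_Sec cop_Res cop_pr ceq
proof
  fix a w assume "a \<in> Obj A" "w \<in> lists (cop_Sec a)"
  then show "ceq a w w" using evs_nonempty by (auto simp: ceq_def)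
next
  fix a w w' assume "ceq a w w'"
  then show "ceq a w' w" by (auto simp: ceq_def)
next
  fix a w w' w'' assume a: "a \<in> Obj A" and w: "w \<in> lists (cop_Sec a)" "w' \<in> lists (cop_Sec a)" "w'' \<in> lists (cop_Sec a)"
    and c: "ceq a w w'" "ceq a w' w''"
  obtain k y z where k: "k \<in> Obj J" "y \<in> evs a k w" "y \<in> evs a k w'" "z \<in> evs a k w'" "z \<in> evs a k w''"
    using ceq_common[OF a w(1,2) c(1) w(2,3) c(2)] .
  \<comment> \<open>The middle word may have two different values here; confluence merges them at a
    later stage, which gives transitivity.\<close>
  obtain l g where l: "l \<in> Obj J" "g \<in> Hom J k l" "D1 k l g a y = D1 k l g a z"
    using evs_confluent[OF a k(1) w(2) k(3,4)] by blast
  then show "ceq a w w''"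
    using evs_push[OF a k(1) l(1,2) w(1) k(2)] evs_push[OF a k(1) l(1,2) w(3) k(5)] by (auto simp: ceq_def)
next
  fix a w w' assume "a \<in> Obj A" "w \<in> lists (cop_Sec a)" "w' \<in> lists (cop_Sec a)" "ceq a w w'"
  then show "dgw a w = dgw a w'" using evs_closed unfolding ceq_def by metis
next
  fix a w w' v v' assume *: "a \<in> Obj A" "w \<in> lists (cop_Sec a)" "w' \<in> lists (cop_Sec a)" "ceq a w w'"
    "v \<in> lists (cop_Sec a)" "v' \<in> lists (cop_Sec a)" "ceq a v v'"
  obtain k y z where "k \<in> Obj J" "y \<in> evs a k w" "y \<in> evs a k w'" "z \<in> evs a k v" "z \<in> evs a k v'"
    using ceq_common[OF *] .
  then show "ceq a (w @ v) (w' @ v')" using evs_append * unfolding ceq_def by metis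
next
  fix a b \<phi> w w' assume "a \<in> Obj A" "b \<in> Obj A" "\<phi> \<in> Hom A a b"
    "w \<in> lists (cop_Sec b)" "w' \<in> lists (cop_Sec b)" "ceq b w w'"
  then show "ceq a (rw a b \<phi> w) (rw a b \<phi> w')" using evs_rw unfolding ceq_def by metis
qed

text \<open>Since a whole word can be multiplied out at one stage, each class contains a one-letter
  word. So the quotient by \<open>ceq\<close> contains nothing beyond the stages.\<close>

lemma concrete_cocone_exists:
  "\<exists>E \<iota>. cocone J M D E \<iota> \<and> concrete J (\<lambda>i. psh (D0 i)) D1 (psh E) \<iota>"
proof -
  obtain E q where E: "E \<in> Obj M"
    and q_closed: "\<And>a w. \<lbrakk>a \<in> Obj A; w \<in> lists (cop_Sec a)\<rbrakk> \<Longrightarrow> q a w \<in> Sec (psh E) a"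
    and q_surj: "\<And>a z. \<lbrakk>a \<in> Obj A; z \<in> Sec (psh E) a\<rbrakk> \<Longrightarrow> \<exists>w \<in> lists (cop_Sec a). z = q a w"
    and q_iff: "\<And>a w w'. \<lbrakk>a \<in> Obj A; w \<in> lists (cop_Sec a); w' \<in> lists (cop_Sec a)\<rbrakk> \<Longrightarrow> q a w = q a w' \<longleftrightarrow> ceq a w w'"
    and pr_q: "\<And>a w. \<lbrakk>a \<in> Obj A; w \<in> lists (cop_Sec a)\<rbrakk> \<Longrightarrow> snd E a (q a w) = dgw a w"
    and q_Nil: "\<And>a. a \<in> Obj A \<Longrightarrow> q a [] = un E a"
    and q_append: "\<And>a w w'. \<lbrakk>a \<in> Obj A; w \<in> lists (cop_Sec a); w' \<in> lists (cop_Sec a)\<rbrakk> \<Longrightarrow> q a (w @ w') = ml E a (q a w) (q a w')"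
    and Res_q: "\<And>a b \<phi> w. \<lbrakk>a \<in> Obj A; b \<in> Obj A; \<phi> \<in> Hom A a b; w \<in> lists (cop_Sec b)\<rbrakk>
      \<Longrightarrow> Res (psh E) a b \<phi> (q b w) = q a (rw a b \<phi> w)"
    by (rule ceq.quotient_exists) blast
  define \<iota> where "\<iota> i = psh_map A (psh (D0 i)) (\<lambda>a s. q a [(i, s)])" for i
  have evsI: "D1 i k f a s \<in> evs a k [(i, s)]"
    if "a \<in> Obj A" "i \<in> Obj J" "k \<in> Obj J" "f \<in> Hom J i k" "s \<in> Sec (psh (D0 i)) a" for a i k f s
    using that by (auto intro!: exI[of _ f])
  have evs_Id: "s \<in> evs a i [(i, s)]" if "a \<in> Obj A" "i \<in> Obj J" "s \<in> Sec (psh (D0 i)) a" for a i s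
    using evsI[of a i i "Id J i" s] that by (simp add: J.Id_in_Hom)
  have \<iota>: "\<iota> i \<in> Hom M (D0 i) E" if i: "i \<in> Obj J" for i
    unfolding \<iota>_def
  proof (rule psh_map_in_Hom_M[OF D0[OF i] E], goal_cases)
    case (1 a s)
    then show ?case using i by (simp add: q_closed)
  next
    case (2 a b \<phi> s)
    then show ?case using i by (simp add: Res_q cop_Res_def)
  next
    case (3 a s)
    then show ?case using i by (simp add: pr_q cop_pr_def)
  next
    case (4 a s t)
    have "ml (D0 i) a s t \<in> evs a i [(i, ml (D0 i) a s t)]" using i 4 by (intro evs_Id) simp_all
    moreover have "ml (D0 i) a s t \<in> evs a i ([(i, s)] @ [(i, t)])"
      by (rule evs_append) (use i 4 evs_Id in simp_all)
    ultimately have "ceq a [(i, ml (D0 i) a s t)] ([(i, s)] @ [(i, t)])" unfolding ceq_def using i by blast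
    then have "q a [(i, ml (D0 i) a s t)] = q a ([(i, s)] @ [(i, t)])" using i 4 by (subst q_iff) simp_all
    also have "\<dots> = ml E a (q a [(i, s)]) (q a [(i, t)])" using i 4 by (intro q_append) simp_all
    finally show ?case .
  next
    case (5 a)
    have "ceq a [(i, un (D0 i) a)] []" using evs_Id[of a i "un (D0 i) a"] i 5 by (auto simp: ceq_def)
    then show ?case using i 5 by (simp add: q_iff flip: q_Nil)
  qed
  have "cocone J M D E \<iota>"
    unfolding cocone_def
  proof (intro conjI ballI E \<iota>)
    fix i j f assume *: "i \<in> Obj J" "j \<in> Obj J" "f \<in> Hom J i j"
    then have c: "Comp M (D0 i) (D0 j) E (\<iota> j) (D1 i j f) \<in> Hom M (D0 i) E"
      using * by (intro category.Comp_in_Hom[OF category_M] E D0 D1 \<iota>)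
    show "Comp M (D0 i) (D0 j) E (\<iota> j) (D1 i j f) = \<iota> i"
    proof (rule M_Hom_eqI[OF D0 E c \<iota>])
      fix a s assume as: "a \<in> Obj A" "s \<in> Sec (psh (D0 i)) a"
      then have "ceq a [(j, D1 i j f a s)] [(i, s)]"
        unfolding ceq_def using evsI[OF as(1) * as(2)] evs_Id[OF as(1) *(2) D1_closed[OF * as]] *(2) by blast
      then show "Comp M (D0 i) (D0 j) E (\<iota> j) (D1 i j f) a s = \<iota> i a s"
        using * as by (simp add: \<iota>_def q_iff)
    qed (use * in simp_all)
  qed
  moreover have "concrete J (\<lambda>i. psh (D0 i)) D1 (psh E) \<iota>"
    unfolding concrete_def
  proof (intro conjI ballI impI)
    fix a z assume a: "a \<in> Obj A" and "z \<in> Sec (psh E) a"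
    then obtain w where w: "w \<in> lists (cop_Sec a)" "z = q a w" using q_surj by blast
    obtain k y where k: "k \<in> Obj J" "y \<in> evs a k w" using evs_nonempty[OF a w(1)] by blast
    then have y: "y \<in> Sec (psh (D0 k)) a" using evs_closed a w by blast
    then have "ceq a w [(k, y)]" unfolding ceq_def using k evs_Id[OF a k(1) y] by blast
    then have "z = q a [(k, y)]" using w a k y q_iff[of a w "[(k, y)]"] by simp
    then show "\<exists>i \<in> Obj J. \<exists>s \<in> Sec (psh (D0 i)) a. z = \<iota> i a s" using k y a by (auto simp: \<iota>_def)
  next
    fix a i s t assume *: "a \<in> Obj A" "i \<in> Obj J" "s \<in> Sec (psh (D0 i)) a" "t \<in> Sec (psh (D0 i)) a"
      and "\<iota> i a s = \<iota> i a t"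
    then have "ceq a [(i, s)] [(i, t)]" by (simp add: \<iota>_def q_iff)
    then obtain k f g where k: "k \<in> Obj J" "f \<in> Hom J i k" "g \<in> Hom J i k" "D1 i k f a s = D1 i k g a t"
      using * by (auto simp: ceq_def)
    \<comment> \<open>The two letters have so far met along possibly different arrows
      \<open>f\<close> and \<open>g\<close>, whereas separation asks for a single one.\<close>
    obtain m h where h: "m \<in> Obj J" "h \<in> Hom J k m" "Comp J i k m h f = Comp J i k m h g"
      using filtered_natLeq_coeqE[OF filtered_J *(2) k(1,2,3)] .
    have "D1 i m (Comp J i k m h f) a s = D1 k m h a (D1 i k g a t)" using * k h(1,2) by (simp add: D1_Comp)
    also have "\<dots> = D1 i m (Comp J i k m h g) a t" using * k h(1,2) by (simp add: D1_Comp)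
    finally have "D1 i m (Comp J i k m h f) a s = D1 i m (Comp J i k m h f) a t" by (simp add: h(3))
    then show "\<exists>k \<in> Obj J. \<exists>f \<in> Hom J i k. D1 i k f a s = D1 i k f a t"
      using J.Comp_in_Hom[OF *(2) k(1) h(1) k(2) h(2)] h(1) by blast
  qed
  ultimately show ?thesis by blast
qed

end

section \<open>Filtered colimits\<close>

lemma functor_cocone:
  assumes F: "is_functor C D F" and X: "is_functor J C X" and cc: "cocone J C X c \<iota>"
  shows "cocone J D (comp_func F X) (FObj F c) (\<lambda>i. FArr F (FObj X i) c (\<iota> i))"
proof -
  note XO = functor_Obj[OF X] and XA = functor_Hom[OF X] and FC = functor_Comp[OF F]
  have "FObj F c \<in> Obj D" "\<And>i. i \<in> Obj J \<Longrightarrow> FArr F (FObj X i) c (\<iota> i) \<in> Hom D (FObj F (FObj X i)) (FObj F c)"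
    using functor_Obj[OF F] functor_Hom[OF F] cc XO by (simp_all add: cocone_def)
  then show ?thesis
    using cc XO XA by (simp add: cocone_def comp_func_def flip: FC)
qed

text \<open>Well-definedness of a map out of a filtered colimit of sets: move both representatives
  to a common stage, merge them later, and use that \<kappa> is constant along arrows. It is stated
  for bare families so as to apply both to sections at one object and to hom-sets.\<close>

lemma filtered_cocone_compat:
  assumes fil: "filtered natLeq J"
    and closed: "\<And>i j f s. \<lbrakk>i \<in> Obj J; j \<in> Obj J; f \<in> Hom J i j; s \<in> X i\<rbrakk> \<Longrightarrow> D i j f s \<in> X j"
    and \<iota>: "\<And>i j f s. \<lbrakk>i \<in> Obj J; j \<in> Obj J; f \<in> Hom J i j; s \<in> X i\<rbrakk> \<Longrightarrow> \<iota> j (D i j f s) = \<iota> i s"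
    and sep: "\<And>i s t. \<lbrakk>i \<in> Obj J; s \<in> X i; t \<in> X i; \<iota> i s = \<iota> i t\<rbrakk> \<Longrightarrow> \<exists>k \<in> Obj J. \<exists>f \<in> Hom J i k. D i k f s = D i k f t"
    and \<kappa>: "\<And>i j f s. \<lbrakk>i \<in> Obj J; j \<in> Obj J; f \<in> Hom J i j; s \<in> X i\<rbrakk> \<Longrightarrow> \<kappa> j (D i j f s) = \<kappa> i s"
    and *: "i \<in> Obj J" "j \<in> Obj J" "s \<in> X i" "t \<in> X j" "\<iota> i s = \<iota> j t"
  shows "\<kappa> i s = \<kappa> j t"
proof -
  obtain k where k: "k \<in> Obj J" "\<And>a. a \<in> {i, j} \<Longrightarrow> Hom J a k \<noteq> {}"
    by (rule filtered_natLeq_boundE[OF fil, of "{i, j}"]) (use * in auto)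
  obtain f g where fg: "f \<in> Hom J i k" "g \<in> Hom J j k" using k(2)[of i] k(2)[of j] by auto
  have "\<iota> k (D i k f s) = \<iota> k (D j k g t)"
    using * k fg \<iota> by simp
  then obtain m h where m: "m \<in> Obj J" "h \<in> Hom J k m"
    "D k m h (D i k f s) = D k m h (D j k g t)"
    using sep[OF k(1) closed[OF *(1) k(1) fg(1) *(3)] closed[OF *(2) k(1) fg(2) *(4)]] by blast
  have "\<kappa> i s = \<kappa> m (D k m h (D i k f s))"
    using * k(1) fg m(1,2) \<kappa> closed by simp
  also have "\<dots> = \<kappa> j t"
    unfolding m(3) using * k(1) fg m(1,2) \<kappa> closed by simp
  finally show ?thesis .
qed

text \<open>Transposition turns a cocone \<kappa> on the image diagram into a cocone \<beta> on the
  original one. \<open>tri'\<close> undoes transposition and thereby gives both commutation and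
  uniqueness.\<close>

lemma left_adjoint_preserves_colimit:
  fixes C :: "('x, 'f) cat" and D :: "('y, 'g) cat"
  assumes adj: "adjunction C D F U \<eta> \<epsilon>" and X: "is_functor J C X" and c: "is_colimit J C X c \<iota>"
  shows "is_colimit J D (comp_func F X) (FObj F c) (\<lambda>i. FArr F (FObj X i) c (\<iota> i))"
proof -
  note F = adjunction_functors(1)[OF adj] and U = adjunction_functors(2)[OF adj]
  interpret D: category D using F by (rule functor_cod)
  interpret C: category C using F by (rule functor_dom)
  note FO = functor_Obj[OF F] and UO = functor_Obj[OF U] and XO = functor_Obj[OF X]
    and FA = functor_Hom[OF F] and UA = functor_Hom[OF U] and XA = functor_Hom[OF X]
    and FC = functor_Comp[OF F] and UC = functor_Comp[OF U]
    and \<epsilon> = adjunction_counit[OF adj] and \<epsilon>_nat = adjunction_counit_natural[OF adj]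
    and \<eta> = adjunction_unit[OF adj] and \<eta>_nat = adjunction_unit_natural[OF adj]
    and tri = adjunction_triangle_left[OF adj]
  have cO: "c \<in> Obj C" and \<iota>: "\<And>i. i \<in> Obj J \<Longrightarrow> \<iota> i \<in> Hom C (FObj X i) c"
    and univ: "\<And>d \<kappa>. cocone J C X d \<kappa> \<Longrightarrow> \<exists>!f. f \<in> Hom C c d \<and> (\<forall>i \<in> Obj J. Comp C (FObj X i) c d f (\<iota> i) = \<kappa> i)"
    using c by (simp_all add: is_colimit_def cocone_def)
  have tri': "Comp D (FObj F x) (FObj F (FObj U d)) d (\<epsilon> d) (FArr F x (FObj U d)
      (Comp C x (FObj U (FObj F x)) (FObj U d) (FArr U (FObj F x) d g) (\<eta> x))) = g"
    if x: "x \<in> Obj C" and d: "d \<in> Obj D" and g: "g \<in> Hom D (FObj F x) d" for x d g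
  proof -
    note O = x d FO[OF x] UO[OF d] UO[OF FO[OF x]] FO[OF UO[OF d]] FO[OF UO[OF FO[OF x]]]
    have "Comp D (FObj F x) (FObj F (FObj U d)) d (\<epsilon> d) (FArr F x (FObj U d)
      (Comp C x (FObj U (FObj F x)) (FObj U d) (FArr U (FObj F x) d g) (\<eta> x)))
      = Comp D (FObj F x) (FObj F (FObj U (FObj F x))) d
          (Comp D (FObj F (FObj U (FObj F x))) (FObj F (FObj U d)) d (\<epsilon> d) (FArr F (FObj U (FObj F x)) (FObj U d) (FArr U (FObj F x) d g)))
          (FArr F x (FObj U (FObj F x)) (\<eta> x))"
      using O g \<epsilon> \<eta> FA UA by (simp add: FC D.Comp_assoc)
    also have "\<dots> = g"
      using O g \<epsilon> \<eta> FA UA tri by (simp add: \<epsilon>_nat D.Comp_assoc D.Comp_Id_right)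
    finally show ?thesis .
  qed
  show ?thesis
    unfolding is_colimit_def
  proof (intro conjI allI impI)
    show "cocone J D (comp_func F X) (FObj F c) (\<lambda>i. FArr F (FObj X i) c (\<iota> i))"
      by (rule functor_cocone[OF F X]) (use c in \<open>simp add: is_colimit_def\<close>)
  next
    fix d \<kappa> assume cc: "cocone J D (comp_func F X) d \<kappa>"
    have d: "d \<in> Obj D" and \<kappa>: "\<And>i. i \<in> Obj J \<Longrightarrow> \<kappa> i \<in> Hom D (FObj F (FObj X i)) d"
      and \<kappa>_nat: "\<And>i j f. \<lbrakk>i \<in> Obj J; j \<in> Obj J; f \<in> Hom J i j\<rbrakk>
        \<Longrightarrow> Comp D (FObj F (FObj X i)) (FObj F (FObj X j)) d (\<kappa> j) (FArr F (FObj X i) (FObj X j) (FArr X i j f)) = \<kappa> i"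
      using cc by (simp_all add: cocone_def comp_func_def)
    define \<beta> where "\<beta> i = Comp C (FObj X i) (FObj U (FObj F (FObj X i))) (FObj U d) (FArr U (FObj F (FObj X i)) d (\<kappa> i)) (\<eta> (FObj X i))" for i
    have \<beta>: "\<beta> i \<in> Hom C (FObj X i) (FObj U d)" if "i \<in> Obj J" for i
      unfolding \<beta>_def using that d \<kappa> by (intro C.Comp_in_Hom XO UO FO \<eta> UA)
    have "cocone J C X (FObj U d) \<beta>"
      unfolding cocone_def
    proof (intro conjI ballI UO d \<beta>)
      fix i j f assume *: "i \<in> Obj J" "j \<in> Obj J" "f \<in> Hom J i j"
      note O = XO[OF *(1)] XO[OF *(2)] d FO UO
      show "Comp C (FObj X i) (FObj X j) (FObj U d) (\<beta> j) (FArr X i j f) = \<beta> i"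
        unfolding \<beta>_def using O XA[OF *] \<kappa>[OF *(2)] \<eta> UA FA
        by (simp add: C.Comp_assoc \<eta>_nat flip: \<kappa>_nat[OF *])
           (simp add: UC C.Comp_assoc)
    qed
    then obtain f where f: "f \<in> Hom C c (FObj U d)" "\<And>i. i \<in> Obj J \<Longrightarrow> Comp C (FObj X i) c (FObj U d) f (\<iota> i) = \<beta> i"
      and fu: "\<And>f'. \<lbrakk>f' \<in> Hom C c (FObj U d); \<And>i. i \<in> Obj J \<Longrightarrow> Comp C (FObj X i) c (FObj U d) f' (\<iota> i) = \<beta> i\<rbrakk> \<Longrightarrow> f' = f"
      using univ by (metis (no_types, lifting))
    define g where "g = Comp D (FObj F c) (FObj F (FObj U d)) d (\<epsilon> d) (FArr F c (FObj U d) f)"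
    have g: "g \<in> Hom D (FObj F c) d"
      unfolding g_def using f d cO by (intro D.Comp_in_Hom FO UO FA \<epsilon>)
    show "\<exists>!g. g \<in> Hom D (FObj F c) d \<and>
       (\<forall>i \<in> Obj J. Comp D (FObj (comp_func F X) i) (FObj F c) d g (FArr F (FObj X i) c (\<iota> i)) = \<kappa> i)"
    proof (rule ex1I[of _ g], intro conjI ballI g)
      fix i assume i: "i \<in> Obj J"
      have "Comp D (FObj F (FObj X i)) (FObj F c) d g (FArr F (FObj X i) c (\<iota> i))
        = Comp D (FObj F (FObj X i)) (FObj F (FObj U d)) d (\<epsilon> d) (FArr F (FObj X i) (FObj U d) (\<beta> i))"
        using i f(1) d cO FO UO XO \<iota>[OF i] FA \<epsilon> by (simp add: g_def D.Comp_assoc flip: f(2)) (simp add: FC)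
      also have "\<dots> = \<kappa> i" unfolding \<beta>_def by (rule tri'[OF XO[OF i] d \<kappa>[OF i]])
      finally show "Comp D (FObj (comp_func F X) i) (FObj F c) d g (FArr F (FObj X i) c (\<iota> i)) = \<kappa> i"
        by (simp add: comp_func_def)
    next
      fix g' assume g': "g' \<in> Hom D (FObj F c) d \<and>
       (\<forall>i \<in> Obj J. Comp D (FObj (comp_func F X) i) (FObj F c) d g' (FArr F (FObj X i) c (\<iota> i)) = \<kappa> i)"
      let ?f = "Comp C c (FObj U (FObj F c)) (FObj U d) (FArr U (FObj F c) d g') (\<eta> c)"
      have "?f = f"
      proof (rule fu)
        show "?f \<in> Hom C c (FObj U d)" using g' cO d by (intro C.Comp_in_Hom UO FO \<eta> UA) auto
        fix i assume i: "i \<in> Obj J"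
        then have k: "\<kappa> i = Comp D (FObj F (FObj X i)) (FObj F c) d g' (FArr F (FObj X i) c (\<iota> i))"
          using g' by (simp add: comp_func_def)
        show "Comp C (FObj X i) c (FObj U d) ?f (\<iota> i) = \<beta> i"
          unfolding \<beta>_def k using i g' cO d FO UO XO \<iota>[OF i] FA UA \<eta>
          by (simp add: UC C.Comp_assoc \<eta>_nat)
      qed
      then show "g' = g" using tri'[OF cO d, of g'] g' by (simp add: g_def)
    qed
  qed
qed

section \<open>Filtered colimits of presheaves over \<open>G\<close>\<close>

context crossed_group_over begin

lemma Comp_C [simp]: "Comp C x y z = Comp (psh_cat A) (fst x) (fst y) (fst z)"
  by (cases x; cases y; cases z) simp

lemma Hom_C_iff':
  "\<lbrakk>x \<in> Obj C; y \<in> Obj C\<rbrakk> \<Longrightarrow> f \<in> Hom C x y \<longleftrightarrow> f \<in> Hom (psh_cat A) (fst x) (fst y) \<and>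
     (\<forall>a \<in> Obj A. \<forall>s \<in> Sec (fst x) a. snd y a (f a s) = snd x a s)"
  using Hom_C_iff[of "fst x" "snd x" "fst y" "snd y"] by simp

text \<open>Every element comes from a stage, so a map out is forced on elements, and
  \<open>filtered_cocone_compat\<close> makes the forced value independent of the
  representative.\<close>

lemma concrete_is_colimit_C:
  assumes fil: "filtered natLeq J" and X: "is_functor J C X" and cc: "cocone J C X c \<iota>"
    and con: "concrete J (\<lambda>i. fst (FObj X i)) (FArr X) (fst c) \<iota>"
  shows "is_colimit J C X c \<iota>"
proof -
  let ?X = "\<lambda>i. fst (FObj X i)"
  interpret J: category J using X by (simp add: is_functor_def)
  note XO = functor_Obj[OF X] and XA = functor_Hom[OF X]
  have XA_closed: "FArr X i j f a s \<in> Sec (?X j) a"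
    if "i \<in> Obj J" "j \<in> Obj J" "f \<in> Hom J i j" "a \<in> Obj A" "s \<in> Sec (?X i) a" for i j f a s
    using psh_Hom_closed[OF _ that(4,5)] XA[OF that(1-3)] Hom_C_iff'[OF XO[OF that(1)] XO[OF that(2)]]
    by simp
  have \<iota>: "\<iota> i \<in> Hom C (FObj X i) c" if "i \<in> Obj J" for i
    using cc that by (simp add: cocone_def)
  have cO: "c \<in> Obj C" using cc by (simp add: cocone_def)
  have \<iota>_psh: "\<iota> i \<in> Hom (psh_cat A) (?X i) (fst c)" and \<iota>_pr: "\<And>a s. a \<in> Obj A \<Longrightarrow> s \<in> Sec (?X i) a \<Longrightarrow> snd c a (\<iota> i a s) = snd (FObj X i) a s"
    if "i \<in> Obj J" for i
    using \<iota>[OF that] Hom_C_iff'[OF XO[OF that] cO] by auto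
  have surj: "\<exists>i \<in> Obj J. \<exists>s \<in> Sec (?X i) a. z = \<iota> i a s" if "a \<in> Obj A" "z \<in> Sec (fst c) a" for a z
    using con that unfolding concrete_def by blast
  show ?thesis
    unfolding is_colimit_def
  proof (intro conjI allI impI cc)
    fix d \<kappa> assume cd: "cocone J C X d \<kappa>"
    then have dO: "d \<in> Obj C" and \<kappa>: "\<And>i. i \<in> Obj J \<Longrightarrow> \<kappa> i \<in> Hom C (FObj X i) d"
      by (simp_all add: cocone_def)
    have \<kappa>_psh: "\<kappa> i \<in> Hom (psh_cat A) (?X i) (fst d)"
      and \<kappa>_pr: "\<And>a s. a \<in> Obj A \<Longrightarrow> s \<in> Sec (?X i) a \<Longrightarrow> snd d a (\<kappa> i a s) = snd (FObj X i) a s"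
      if "i \<in> Obj J" for i
      using \<kappa>[OF that] Hom_C_iff'[OF XO[OF that] dO] by auto
    have nat: "\<theta> j a (FArr X i j f a s) = \<theta> i a s"
      if "cocone J C X e \<theta>" "i \<in> Obj J" "j \<in> Obj J" "f \<in> Hom J i j" "a \<in> Obj A" "s \<in> Sec (?X i) a" for e \<theta> i j f a s
    proof -
      have "Comp C (FObj X i) (FObj X j) e (\<theta> j) (FArr X i j f) = \<theta> i"
        using that unfolding cocone_def by blast
      from fun_cong[OF fun_cong[OF this], of a s] show ?thesis using that by simp
    qed
    have wd: "\<kappa> i a s = \<kappa> j a t"
      if *: "a \<in> Obj A" "i \<in> Obj J" "j \<in> Obj J" "s \<in> Sec (?X i) a" "t \<in> Sec (?X j) a" "\<iota> i a s = \<iota> j a t" for a i j s t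
      by (rule filtered_cocone_compat[OF fil, where X = "\<lambda>i. Sec (?X i) a" and D = "\<lambda>i j f. FArr X i j f a"
            and \<iota> = "\<lambda>i. \<iota> i a" and \<kappa> = "\<lambda>i. \<kappa> i a", OF _ _ _ _ *(2-6)])
         (use *(1) con XA_closed nat[OF cc] nat[OF cd] in \<open>simp_all add: concrete_def\<close>)
    \<comment> \<open>\<open>SOME\<close> ranges over the values at all representatives of
      \<open>z\<close>; by \<open>wd\<close> there is only one such value.\<close>
    define f where "f = psh_map A (fst c) (\<lambda>a z. SOME v. \<exists>i \<in> Obj J. \<exists>s \<in> Sec (?X i) a. z = \<iota> i a s \<and> v = \<kappa> i a s)"
    have f\<iota>: "f a (\<iota> i a s) = \<kappa> i a s" if "a \<in> Obj A" "i \<in> Obj J" "s \<in> Sec (?X i) a" for a i s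
    proof -
      have "(SOME v. \<exists>j \<in> Obj J. \<exists>t \<in> Sec (?X j) a. \<iota> i a s = \<iota> j a t \<and> v = \<kappa> j a t) = \<kappa> i a s"
      proof (rule some_equality)
        show "\<exists>j \<in> Obj J. \<exists>t \<in> Sec (?X j) a. \<iota> i a s = \<iota> j a t \<and> \<kappa> i a s = \<kappa> j a t" using that by blast
        fix v assume "\<exists>j \<in> Obj J. \<exists>t \<in> Sec (?X j) a. \<iota> i a s = \<iota> j a t \<and> v = \<kappa> j a t"
        then obtain j t where "j \<in> Obj J" "t \<in> Sec (?X j) a" "\<iota> i a s = \<iota> j a t" "v = \<kappa> j a t" by blast
        then show "v = \<kappa> i a s" using wd[OF that(1,2), of j s t] that by simp
      qed
      then show ?thesis
        using that(1) psh_Hom_closed[OF \<iota>_psh[OF that(2)] that(1,3)] by (simp only: f_def psh_map_apply)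
    qed
    have fp: "f \<in> Hom (psh_cat A) (fst c) (fst d)"
    proof -
      have "is_presheaf A (fst c)" using cO by (cases c) simp
      note Rc = presheaf_Res_closed[OF this]
      have "psh_map A (fst c) f \<in> Hom (psh_cat A) (fst c) (fst d)"
      proof (rule psh_map_in_HomI, goal_cases)
        case (1 a z)
        then obtain i s where "i \<in> Obj J" "s \<in> Sec (?X i) a" "z = \<iota> i a s" using surj by blast
        then show ?case using 1 psh_Hom_closed[OF \<kappa>_psh] by (simp add: f\<iota>)
      next
        case (2 a b \<phi> z)
        then obtain i s where i: "i \<in> Obj J" "s \<in> Sec (?X i) b" "z = \<iota> i b s" using surj by blast
        have "is_presheaf A (?X i)" using XO[OF i(1)] by (cases "FObj X i") simp
        then have "Res (?X i) a b \<phi> s \<in> Sec (?X i) a" using 2 i by (simp add: presheaf_Res_closed)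
        then have "f a (Res (fst c) a b \<phi> z) = Res (fst d) a b \<phi> (f b z)"
          using 2 i psh_Hom_natural[OF \<iota>_psh[OF i(1)], of a b \<phi> s] psh_Hom_natural[OF \<kappa>_psh[OF i(1)], of a b \<phi> s] f\<iota>
          by metis
        then show ?case using 2 Rc by simp
      qed
      moreover have "psh_map A (fst c) f = f" by (auto simp: f_def psh_map_def fun_eq_iff restrict_def)
      ultimately show ?thesis by simp
    qed
    have f: "f \<in> Hom C c d"
      unfolding Hom_C_iff'[OF cO dO]
    proof (intro conjI ballI fp)
      fix a z assume "a \<in> Obj A" "z \<in> Sec (fst c) a"
      then show "snd d a (f a z) = snd c a z"
        using surj[of a z] f\<iota> \<iota>_pr \<kappa>_pr by auto
    qed
    have comp: "Comp C (FObj X i) c d g (\<iota> i) = \<kappa> i \<longleftrightarrow> (\<forall>a \<in> Obj A. \<forall>s \<in> Sec (?X i) a. g a (\<iota> i a s) = \<kappa> i a s)"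
      if g: "g \<in> Hom C c d" and i: "i \<in> Obj J" for g i
    proof -
      have "is_presheaf A (?X i)" using XO[OF i] by (cases "FObj X i") simp
      then have "Comp (psh_cat A) (?X i) (fst c) (fst d) g (\<iota> i) \<in> Hom (psh_cat A) (?X i) (fst d)"
        using g Hom_C_iff'[OF cO dO] \<iota>_psh[OF i] by (intro psh_Comp_in_Hom) auto
      note eqI = psh_Hom_eqI[OF this \<kappa>_psh[OF i]]
      show ?thesis
      proof
        assume *: "Comp C (FObj X i) c d g (\<iota> i) = \<kappa> i"
        show "\<forall>a \<in> Obj A. \<forall>s \<in> Sec (?X i) a. g a (\<iota> i a s) = \<kappa> i a s"
          using fun_cong[OF fun_cong[OF *]] by (metis Comp_C psh_Comp_apply)
      qed (simp add: eqI)
    qed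
    show "\<exists>!f. f \<in> Hom C c d \<and> (\<forall>i \<in> Obj J. Comp C (FObj X i) c d f (\<iota> i) = \<kappa> i)"
    proof (rule ex1I[of _ f])
      show "f \<in> Hom C c d \<and> (\<forall>i \<in> Obj J. Comp C (FObj X i) c d f (\<iota> i) = \<kappa> i)"
        using f comp[OF f] f\<iota> by blast
    next
      fix g assume g: "g \<in> Hom C c d \<and> (\<forall>i \<in> Obj J. Comp C (FObj X i) c d g (\<iota> i) = \<kappa> i)"
      then have gp: "g \<in> Hom (psh_cat A) (fst c) (fst d)" using Hom_C_iff'[OF cO dO] by blast
      show "g = f"
      proof (rule psh_Hom_eqI[OF gp fp])
        fix a z assume a: "a \<in> Obj A" "z \<in> Sec (fst c) a"
        obtain i s where i: "i \<in> Obj J" "s \<in> Sec (?X i) a" "z = \<iota> i a s" using surj[OF a] by blast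
        have "g a (\<iota> i a s) = \<kappa> i a s" using g comp[of g i] i a by blast
        then show "g a z = f a z" using i a f\<iota> by simp
      qed
    qed
  qed
qed

lemma forget_cocone:
  assumes D: "is_functor J M D" and cc: "cocone J M D c \<iota>"
  shows "cocone J C (comp_func forget D) (FObj forget c) \<iota>"
  using functor_cocone[OF functor_forget D cc] by simp

end

section \<open>Filtered colimits under the forgetful functor\<close>

context filtered_diagram begin

text \<open>The induced map of underlying presheaves is automatically a homomorphism: two elements
  have representatives at a common stage, and their product may be formed there. So both universal
  properties single out the same maps, which is what \<open>iff\<close> records.\<close>

lemma concrete_is_colimit:
  assumes cc: "cocone J M D E \<iota>" and con: "concrete J (\<lambda>i. psh (D0 i)) D1 (psh E) \<iota>"
  shows "is_colimit J M D E \<iota>"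
proof -
  let ?UD = "comp_func forget D"
  have UD: "is_functor J C ?UD" by (rule is_functor_comp_func[OF functor_D functor_forget])
  have con': "concrete J (\<lambda>i. fst (FObj ?UD i)) (FArr ?UD) (fst (FObj forget E)) \<iota>"
    using con by (simp add: comp_func_def)
  note col = concrete_is_colimit_C[OF filtered_J UD forget_cocone[OF functor_D cc] con']
  have E: "E \<in> Obj M" and \<iota>: "\<And>i. i \<in> Obj J \<Longrightarrow> \<iota> i \<in> Hom M (D0 i) E"
    and nat: "\<And>i j f. \<lbrakk>i \<in> Obj J; j \<in> Obj J; f \<in> Hom J i j\<rbrakk> \<Longrightarrow> Comp M (D0 i) (D0 j) E (\<iota> j) (D1 i j f) = \<iota> i"
    using cc by (simp_all add: cocone_def)
  have nat': "\<iota> j a (D1 i j f a s) = \<iota> i a s"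
    if "i \<in> Obj J" "j \<in> Obj J" "f \<in> Hom J i j" "a \<in> Obj A" "s \<in> Sec (psh (D0 i)) a" for i j f a s
    using fun_cong[OF fun_cong[OF nat[OF that(1-3)]], of a s] that by simp
  have surj: "\<exists>i \<in> Obj J. \<exists>s \<in> Sec (psh (D0 i)) a. z = \<iota> i a s" if "a \<in> Obj A" "z \<in> Sec (psh E) a" for a z
    using con that unfolding concrete_def by blast
  show ?thesis
    unfolding is_colimit_def
  proof (intro conjI allI impI cc)
    fix F \<kappa> assume cd: "cocone J M D F \<kappa>"
    then have F: "F \<in> Obj M" and \<kappa>: "\<And>i. i \<in> Obj J \<Longrightarrow> \<kappa> i \<in> Hom M (D0 i) F" by (simp_all add: cocone_def)
    have ex: "\<exists>!f. f \<in> Hom C (FObj forget E) (FObj forget F) \<and>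
       (\<forall>i \<in> Obj J. Comp C (FObj ?UD i) (FObj forget E) (FObj forget F) f (\<iota> i) = \<kappa> i)"
      using col forget_cocone[OF functor_D cd] unfolding is_colimit_def by blast
    have iff: "f \<in> Hom C (FObj forget E) (FObj forget F) \<and>
       (\<forall>i \<in> Obj J. Comp C (FObj ?UD i) (FObj forget E) (FObj forget F) f (\<iota> i) = \<kappa> i) \<longleftrightarrow>
       f \<in> Hom M E F \<and> (\<forall>i \<in> Obj J. Comp M (D0 i) E F f (\<iota> i) = \<kappa> i)" for f
    proof (intro iffI conjI; elim conjE)
      assume fC: "f \<in> Hom C (FObj forget E) (FObj forget F)"
        and fi: "\<forall>i \<in> Obj J. Comp C (FObj ?UD i) (FObj forget E) (FObj forget F) f (\<iota> i) = \<kappa> i"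
      have fP: "f \<in> Hom (psh_cat A) (psh E) (psh F)"
        and fpr: "\<forall>a \<in> Obj A. \<forall>s \<in> Sec (psh E) a. snd F a (f a s) = snd E a s"
        using fC Hom_C_iff[OF forget_in_Obj[OF E] forget_in_Obj[OF F]] by simp_all
      have f\<iota>: "f a (\<iota> i a s) = \<kappa> i a s" if "a \<in> Obj A" "i \<in> Obj J" "s \<in> Sec (psh (D0 i)) a" for a i s
      proof -
        have "Comp C (FObj ?UD i) (FObj forget E) (FObj forget F) f (\<iota> i) = \<kappa> i" using fi that by blast
        from fun_cong[OF fun_cong[OF this], of a s] show ?thesis using that by (simp add: comp_func_def)
      qed
      have fml: "f a (ml E a x y) = ml F a (f a x) (f a y)"
        if axy: "a \<in> Obj A" "x \<in> Sec (psh E) a" "y \<in> Sec (psh E) a" for a x y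
      proof -
        obtain i s where i: "i \<in> Obj J" "s \<in> Sec (psh (D0 i)) a" "x = \<iota> i a s" using surj[OF axy(1,2)] by blast
        obtain j t where j: "j \<in> Obj J" "t \<in> Sec (psh (D0 j)) a" "y = \<iota> j a t" using surj[OF axy(1,3)] by blast
        obtain k p q where k: "k \<in> Obj J" "p \<in> Hom J i k" "q \<in> Hom J j k" using boundE[OF i(1) j(1)] .
        have xy: "x = \<iota> k a (D1 i k p a s)" "y = \<iota> k a (D1 j k q a t)"
          using i j k that nat' by simp_all
        note c = D1_closed[OF i(1) k(1,2) that(1) i(2)] D1_closed[OF j(1) k(1,3) that(1) j(2)]
        show ?thesis
          unfolding xy using that c k
          by (simp add: f\<iota> M_Hom_ml[OF D0 F \<kappa>] flip: M_Hom_ml[OF D0 E \<iota>])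
      qed
      have funit: "f a (un E a) = un F a" if "a \<in> Obj A" for a
      proof -
        obtain k where "k \<in> Obj J" by (rule filtered_natLeq_boundE[OF filtered_J, of "{}"]) auto
        then show ?thesis using that f\<iota>[of a k "un (D0 k) a"]
          by (simp add: M_Hom_un[OF D0 F \<kappa>] M_Hom_un[OF D0 E \<iota>])
      qed
      show "f \<in> Hom M E F"
        unfolding Hom_M_iff[OF E F] using fP fpr fml funit by blast
      show "\<forall>i \<in> Obj J. Comp M (D0 i) E F f (\<iota> i) = \<kappa> i"
        using fi by (simp add: comp_func_def)
    next
      assume "f \<in> Hom M E F"
      then show "f \<in> Hom C (FObj forget E) (FObj forget F)"
        using M_Hom_forget[OF E F] by simp
    next
      assume "\<forall>i \<in> Obj J. Comp M (D0 i) E F f (\<iota> i) = \<kappa> i"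
      then show "\<forall>i \<in> Obj J. Comp C (FObj ?UD i) (FObj forget E) (FObj forget F) f (\<iota> i) = \<kappa> i"
        by (simp add: comp_func_def)
    qed
    show "\<exists>!f. f \<in> Hom M E F \<and> (\<forall>i \<in> Obj J. Comp M (D0 i) E F f (\<iota> i) = \<kappa> i)"
      using ex unfolding iff .
  qed
qed

text \<open>Colimits are unique up to isomorphism, and one concrete colimit exists. The comparison
  maps \<open>f\<close> and \<open>g\<close> carry the elementwise criterion over to the given
  one.\<close>

lemma colimit_concrete:
  assumes c: "is_colimit J M D c \<iota>"
  shows "concrete J (\<lambda>i. psh (D0 i)) D1 (psh c) \<iota>"
proof -
  obtain E \<iota>' where E: "cocone J M D E \<iota>'" and con: "concrete J (\<lambda>i. psh (D0 i)) D1 (psh E) \<iota>'"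
    using concrete_cocone_exists by blast
  note cE = concrete_is_colimit[OF E con]
  have cc: "cocone J M D c \<iota>" using c by (simp add: is_colimit_def)
  have EM: "E \<in> Obj M" and cM: "c \<in> Obj M" using E cc by (simp_all add: cocone_def)
  have \<iota>: "\<iota> i \<in> Hom M (D0 i) c" if "i \<in> Obj J" for i using cc that by (simp add: cocone_def)
  obtain f where f: "f \<in> Hom M c E" "\<forall>i \<in> Obj J. Comp M (D0 i) c E f (\<iota> i) = \<iota>' i"
    using c E unfolding is_colimit_def by blast
  obtain g where g: "g \<in> Hom M E c" "\<forall>i \<in> Obj J. Comp M (D0 i) E c g (\<iota>' i) = \<iota> i"
    using cE cc unfolding is_colimit_def by blast
  interpret M: category M by (rule category_M)
  have gf: "Comp M c E c g f = Id M c"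
  proof -
    have "\<exists>!h. h \<in> Hom M c c \<and> (\<forall>i \<in> Obj J. Comp M (D0 i) c c h (\<iota> i) = \<iota> i)"
      using c cc unfolding is_colimit_def by blast
    moreover have "Comp M c E c g f \<in> Hom M c c" by (rule M.Comp_in_Hom[OF cM EM cM f(1) g(1)])
    moreover have "Comp M (D0 i) c c (Comp M c E c g f) (\<iota> i) = \<iota> i" if "i \<in> Obj J" for i
      using M.Comp_assoc[OF D0[OF that] cM EM cM \<iota>[OF that] f(1) g(1)] f(2) g(2) that by simp
    moreover have "Id M c \<in> Hom M c c" by (rule M.Id_in_Hom[OF cM])
    moreover have "Comp M (D0 i) c c (Id M c) (\<iota> i) = \<iota> i" if "i \<in> Obj J" for i
      by (rule M.Comp_Id_left[OF D0[OF that] cM \<iota>[OF that]])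
    ultimately show ?thesis by blast
  qed
  have f\<iota>: "f a (\<iota> i a s) = \<iota>' i a s" and g\<iota>: "g a (\<iota>' i a s) = \<iota> i a s"
    if "a \<in> Obj A" "i \<in> Obj J" "s \<in> Sec (psh (D0 i)) a" for a i s
    using fun_cong[OF fun_cong[OF f(2)[rule_format, OF that(2)]], of a s]
      fun_cong[OF fun_cong[OF g(2)[rule_format, OF that(2)]], of a s] that by simp_all
  show ?thesis
    unfolding concrete_def
  proof (intro conjI ballI impI)
    fix a z assume a: "a \<in> Obj A" and z: "z \<in> Sec (psh c) a"
    then have "f a z \<in> Sec (psh E) a" using M_Hom_closed[OF cM EM f(1)] by blast
    then obtain i s where i: "i \<in> Obj J" "s \<in> Sec (psh (D0 i)) a" "f a z = \<iota>' i a s"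
      using con a unfolding concrete_def by blast
    have "z = g a (f a z)" using fun_cong[OF fun_cong[OF gf], of a z] a z by simp
    then show "\<exists>i \<in> Obj J. \<exists>s \<in> Sec (psh (D0 i)) a. z = \<iota> i a s" using i a g\<iota> by auto
  next
    fix a i s t assume *: "a \<in> Obj A" "i \<in> Obj J" "s \<in> Sec (psh (D0 i)) a" "t \<in> Sec (psh (D0 i)) a" "\<iota> i a s = \<iota> i a t"
    then have "\<iota>' i a s = \<iota>' i a t" by (metis f\<iota>)
    then show "\<exists>k \<in> Obj J. \<exists>f \<in> Hom J i k. D1 i k f a s = D1 i k f a t"
      using con * unfolding concrete_def by blast
  qed
qed

text \<open>Concreteness mentions only sections, so it passes unchanged to the underlying
  presheaves, where it again implies being a colimit.\<close>

lemma forget_preserves: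
  assumes c: "is_colimit J M D c \<iota>"
  shows "is_colimit J C (comp_func forget D) (FObj forget c) \<iota>"
proof (rule concrete_is_colimit_C[OF filtered_J is_functor_comp_func[OF functor_D functor_forget] forget_cocone[OF functor_D]])
  show "cocone J M D c \<iota>" using c by (simp add: is_colimit_def)
  show "concrete J (\<lambda>i. fst (FObj (comp_func forget D) i)) (FArr (comp_func forget D)) (fst (FObj forget c)) \<iota>"
    using colimit_concrete[OF c] by (simp add: comp_func_def)
qed

end

context crossed_group_over begin

text \<open>The free functor preserves all colimits as a left adjoint, and the forgetful functor
  preserves the filtered ones.\<close>

lemma finitary_forget:
  assumes adj: "adjunction C M F forget \<eta> \<epsilon>"
  shows "finitary TYPE('u) C (comp_func forget F)"
  unfolding finitary_def preserves_filtered_colimits_def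
proof (intro allI impI, elim conjE)
  fix J :: "('u, 'u) cat" and D c \<iota>
  assume J: "small_category TYPE('u) J" and fil: "filtered natLeq J" and D: "is_functor J C D"
    and c: "is_colimit J C D c \<iota>"
  have F: "is_functor C M F" using adj by (simp add: adjunction_def)
  interpret filtered_diagram A G T J "comp_func F D"
    by unfold_locales (use is_functor_comp_func[OF D F] J fil in \<open>simp_all add: small_category_def\<close>)
  show "is_colimit J C (comp_func (comp_func forget F) D) (FObj (comp_func forget F) c)
     (\<lambda>i. FArr (comp_func forget F) (FObj D i) c (\<iota> i))"
    using forget_preserves[OF left_adjoint_preserves_colimit[OF adj D c]]
    by (simp add: comp_func_def)
qed

end

section \<open>Finitely presented crossed monoids\<close>

lemma category_set_cat: "category (set_cat U)"
  by unfold_locales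
    (auto simp: set_cat_def compose_def fun_eq_iff PiE_iff extensional_def restrict_def)

lemma set_cat_Comp_apply: "x \<in> S \<Longrightarrow> Comp (set_cat U) S T V g f x = g (f x)"
  by (simp add: set_cat_def compose_def)

text \<open>Smallness is asked of hom-sets out of \<open>k\<close> only; between arbitrary
  presheaves hom-sets may be large unless the universe is a strong limit.\<close>

lemma is_functor_hom_func:
  assumes C: "category C" and k: "k \<in> Obj C" and small: "\<And>x. x \<in> Obj C \<Longrightarrow> small U (Hom C k x)"
  shows "is_functor C (set_cat U) (hom_func C k)"
proof -
  interpret category C by fact
  show ?thesis
    unfolding is_functor_def
  proof (intro conjI ballI C category_set_cat, goal_cases)
    case (1 x)
    then show ?case by (simp add: set_cat_def hom_func_def small)
  next
    case (2 x y f)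
    then show ?case using k by (simp add: set_cat_def hom_func_def Comp_in_Hom)
  next
    case (3 x)
    then show ?case using k by (auto simp: set_cat_def hom_func_def Comp_Id_left fun_eq_iff)
  next
    case (4 x y z f g)
    then show ?case using k
      by (auto simp: set_cat_def hom_func_def compose_def Comp_assoc Comp_in_Hom fun_eq_iff)
  qed
qed

section \<open>Presentations on sorted variables\<close>

context crossed_group_over begin

text \<open>A variable \<open>v\<close> stands for one element, whose object and degree are recorded
  in \<open>srt v\<close>. A letter is a variable with an arrow along which it is restricted, and
  products of such letters are the normal forms of terms.\<close>

definition terms :: "'n set \<Rightarrow> ('n \<Rightarrow> 'o \<times> 'u) \<Rightarrow> 'o \<Rightarrow> ('n \<times> 'm) list set" where
  "terms V srt b = lists (Sigma V (\<lambda>v. Hom A b (fst (srt v))))"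

primrec tdg :: "('n \<Rightarrow> 'o \<times> 'u) \<Rightarrow> 'o \<Rightarrow> ('n \<times> 'm) list \<Rightarrow> 'u" where
  "tdg srt b [] = g1 b"
| "tdg srt b (x # w) = gm b (gr b (fst (srt (fst x))) (snd x) (snd (srt (fst x)))) (tdg srt b w)"

primrec tev where
  "tev srt E e b [] = un E b"
| "tev srt E e b (x # w) = ml E b (Res (psh E) b (fst (srt (fst x))) (snd x) (e (fst x))) (tev srt E e b w)"

definition asg where
  "asg V srt E e \<longleftrightarrow> (\<forall>v \<in> V. e v \<in> Sec (psh E) (fst (srt v)) \<and> snd E (fst (srt v)) (e v) = snd (srt v))"

definition sats where
  "sats srt R E e \<longleftrightarrow> (\<forall>(b, w, w') \<in> R. tev srt E e b w = tev srt E e b w')"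

text \<open>The lemmas that rest on finiteness of \<open>V\<close> and \<open>R\<close> assume it
  separately.\<close>

definition fp where
  "fp V srt R K u \<longleftrightarrow> K \<in> Obj M \<and> asg V srt K u \<and> sats srt R K u \<and>
     (\<forall>E e. E \<in> Obj M \<and> asg V srt E e \<and> sats srt R E e \<longrightarrow>
        (\<exists>!f. f \<in> Hom M K E \<and> (\<forall>v \<in> V. f (fst (srt v)) (u v) = e v)))"

definition sorts where "sorts = Sigma (Obj A) (\<lambda>a. carrier (Grp G a))"

definition wf_pres where
  "wf_pres V srt R \<longleftrightarrow> srt ` V \<subseteq> sorts \<and>
     (\<forall>(b, w, w') \<in> R. b \<in> Obj A \<and> w \<in> terms V srt b \<and> w' \<in> terms V srt b \<and> tdg srt b w = tdg srt b w')"

lemma wf_presD: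
  assumes "wf_pres V srt R"
  shows "v \<in> V \<Longrightarrow> fst (srt v) \<in> Obj A" "v \<in> V \<Longrightarrow> snd (srt v) \<in> carrier (Grp G (fst (srt v)))"
    "(b, w, w') \<in> R \<Longrightarrow> b \<in> Obj A" "(b, w, w') \<in> R \<Longrightarrow> w \<in> terms V srt b" "(b, w, w') \<in> R \<Longrightarrow> w' \<in> terms V srt b"
proof -
  have "srt v \<in> sorts" if "v \<in> V" using assms that by (auto simp: wf_pres_def)
  then show "v \<in> V \<Longrightarrow> fst (srt v) \<in> Obj A" "v \<in> V \<Longrightarrow> snd (srt v) \<in> carrier (Grp G (fst (srt v)))"
    by (cases "srt v"; simp add: sorts_def)+
  show "(b, w, w') \<in> R \<Longrightarrow> b \<in> Obj A" "(b, w, w') \<in> R \<Longrightarrow> w \<in> terms V srt b" "(b, w, w') \<in> R \<Longrightarrow> w' \<in> terms V srt b"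
    using bspec[OF conjunct2[OF assms[unfolded wf_pres_def]], of "(b, w, w')"] by simp_all
qed

lemma asgD:
  assumes "asg V srt E e" "v \<in> V"
  shows "e v \<in> Sec (psh E) (fst (srt v))" "snd E (fst (srt v)) (e v) = snd (srt v)"
  using assms by (auto simp: asg_def)

lemma tev_closed:
  assumes "E \<in> Obj M" "asg V srt E e" "srt ` V \<subseteq> sorts" "b \<in> Obj A" "w \<in> terms V srt b"
  shows "tev srt E e b w \<in> Sec (psh E) b \<and> snd E b (tev srt E e b w) = tdg srt b w"
  using assms(5) unfolding terms_def
proof (induction w)
  case Nil
  show ?case using assms(1,4) by simp
next
  case (Cons x w)
  then obtain v \<phi> where x: "x = (v, \<phi>)" "v \<in> V" "\<phi> \<in> Hom A b (fst (srt v))" by (cases x) auto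
  then have "fst (srt v) \<in> Obj A" using assms(3) by (auto simp: sorts_def)
  then show ?case using Cons.IH x assms(1,4) asgD[OF assms(2) x(2)] by simp
qed

lemma hom_tev:
  assumes E: "E \<in> Obj M" "E' \<in> Obj M" "f \<in> Hom M E E'" "asg V srt E e" "srt ` V \<subseteq> sorts" "b \<in> Obj A" "w \<in> terms V srt b"
  shows "f b (tev srt E e b w) = tev srt E' (\<lambda>v. f (fst (srt v)) (e v)) b w"
  using assms(7) unfolding terms_def
proof (induction w)
  case Nil
  show ?case using assms(6) by (simp add: M_Hom_un[OF E(1-3)])
next
  case (Cons x w)
  then obtain v \<phi> where x: "x = (v, \<phi>)" "v \<in> V" "\<phi> \<in> Hom A b (fst (srt v))" by (cases x) auto
  then have v: "fst (srt v) \<in> Obj A" using assms(5) by (auto simp: sorts_def)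
  have w: "w \<in> lists (Sigma V (\<lambda>v. Hom A b (fst (srt v))))" using Cons by blast
  from tev_closed[OF assms(1,4,5,6), of w] show ?case
    using w Cons.IH x v assms(1,6) asgD[OF assms(4) x(2)] by (simp add: terms_def M_Hom_ml[OF E(1-3)] M_Hom_Res[OF E(1-3)])
qed

lemma hom_asg:
  assumes "E \<in> Obj M" "E' \<in> Obj M" "f \<in> Hom M E E'" "asg V srt E e" "srt ` V \<subseteq> sorts"
  shows "asg V srt E' (\<lambda>v. f (fst (srt v)) (e v))"
  unfolding asg_def
proof (intro ballI)
  fix v assume v: "v \<in> V"
  then have "fst (srt v) \<in> Obj A" using assms(5) by (auto simp: sorts_def)
  then show "f (fst (srt v)) (e v) \<in> Sec (psh E') (fst (srt v)) \<and> snd E' (fst (srt v)) (f (fst (srt v)) (e v)) = snd (srt v)"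
    using asgD[OF assms(4) v] M_Hom_closed[OF assms(1-3)] M_Hom_pr[OF assms(1-3)] by simp
qed

lemma tev_cong: "\<lbrakk>w \<in> terms V srt b; \<And>v. v \<in> V \<Longrightarrow> e v = e' v\<rbrakk> \<Longrightarrow> tev srt E e b w = tev srt E e' b w"
  unfolding terms_def by (induction w) auto

lemma satsI: "(\<And>b w w'. (b, w, w') \<in> R \<Longrightarrow> tev srt E e b w = tev srt E e b w') \<Longrightarrow> sats srt R E e"
  by (auto simp: sats_def)

lemma satsD: "sats srt R E e \<Longrightarrow> (b, w, w') \<in> R \<Longrightarrow> tev srt E e b w = tev srt E e b w'"
  by (auto simp: sats_def)

lemma sats_cong:
  assumes wf: "wf_pres V srt R" and eq: "\<And>v. v \<in> V \<Longrightarrow> e v = e' v" and s: "sats srt R E e"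
  shows "sats srt R E e'"
proof (rule satsI)
  fix b w w' assume r: "(b, w, w') \<in> R"
  show "tev srt E e' b w = tev srt E e' b w'"
    using satsD[OF s r] tev_cong[OF wf_presD(4)[OF wf r], of e e' E] tev_cong[OF wf_presD(5)[OF wf r], of e e' E] eq by simp
qed

lemma hom_sats:
  assumes E: "E \<in> Obj M" "E' \<in> Obj M" "f \<in> Hom M E E'" "asg V srt E e" "wf_pres V srt R" "sats srt R E e"
  shows "sats srt R E' (\<lambda>v. f (fst (srt v)) (e v))"
proof (rule satsI)
  fix b w w' assume r: "(b, w, w') \<in> R"
  have s: "srt ` V \<subseteq> sorts" using assms(5) by (simp add: wf_pres_def)
  note c = wf_presD[OF assms(5)]
  have "tev srt E e b w = tev srt E e b w'" by (rule satsD[OF assms(6) r])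
  then show "tev srt E' (\<lambda>v. f (fst (srt v)) (e v)) b w = tev srt E' (\<lambda>v. f (fst (srt v)) (e v)) b w'"
    using hom_tev[OF assms(1-4) s c(3)[OF r] c(4)[OF r]] hom_tev[OF assms(1-4) s c(3)[OF r] c(5)[OF r]] by simp
qed

text \<open>Reduction to \<open>presented_exists\<close> by the Yoneda lemma: the letters form a sum
  of representable presheaves over \<open>G\<close>, and a valuation on it is determined by its
  values at variables paired with identities, as \<open>yon\<close> states.\<close>

lemma fp_exists:
  assumes V: "small TYPE('u) V" and wf: "wf_pres V srt R"
  shows "\<exists>K u. fp V srt R K u"
proof -
  define Xs where "Xs b = Sigma V (\<lambda>v. Hom A b (fst (srt v)))" for b
  define rs where "rs a b \<psi> x = (fst x, Comp A a b (fst (srt (fst x))) (snd x) \<psi>)" for a b \<psi> and x :: "'a \<times> 'm"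
  define dg where "dg b x = gr b (fst (srt (fst x))) (snd x) (snd (srt (fst x)))" for b and x :: "'a \<times> 'm"
  note sO = wf_presD(1,2)[OF wf]
  interpret generators A G T Xs rs dg
  proof
    fix b assume b: "b \<in> Obj A"
    show "small TYPE('u) (Xs b)"
      unfolding Xs_def using small_A b sO
      by (intro small_Sigma universe V) (auto simp: small_category_def locally_small_def)
  qed (auto simp: Xs_def rs_def dg_def sO Comp_in_Hom Comp_Id_right Comp_assoc gr_Comp)
  have lists_Xs: "lists (Xs b) = terms V srt b" for b by (simp add: terms_def Xs_def)
  have dgw: "dgw b w = tdg srt b w" for b w by (induction w, simp_all only: dgw.simps tdg.simps, simp only: dg_def)
  define ext where "ext E e b x = Res (psh E) b (fst (srt (fst x))) (snd x) (e (fst x))"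
    for E and e :: "'a \<Rightarrow> 'u" and b and x :: "'a \<times> 'm"
  have tev: "ev E (ext E e) b w = tev srt E e b w" for E e b w
    by (induction w, simp_all only: ev.simps tev.simps, simp only: ext_def)
  have sat: "sat R E (ext E e) \<longleftrightarrow> sats srt R E e" for E e by (simp add: sat_def sats_def tev)
  have "\<exists>K u. presented R K u"
    using wf by (intro presented_exists) (auto simp: wf_pres_def lists_Xs dgw)
  then obtain K u where K: "presented R K u" by blast
  then have KM: "K \<in> Obj M" and u: "valuation K u" and s: "sat R K u" by (simp_all add: presented_def)
  define u0 where "u0 v = u (fst (srt v)) (v, Id A (fst (srt v)))" for v
  have yon: "e b (v, \<phi>) = Res (psh E) b (fst (srt v)) \<phi> (e (fst (srt v)) (v, Id A (fst (srt v))))"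
    if "E \<in> Obj M" "valuation E e" "b \<in> Obj A" "v \<in> V" "\<phi> \<in> Hom A b (fst (srt v))" for E e b v \<phi>
    using valuation_rs[OF that(1,2,3), of "fst (srt v)" \<phi> "(v, Id A (fst (srt v)))"] that sO
    by (simp add: rs_def Xs_def Id_in_Hom Comp_Id_left)
  have u0: "u b x = ext K u0 b x" if "b \<in> Obj A" "x \<in> Xs b" for b x
    using yon[OF KM u that(1)] that by (cases x) (auto simp: ext_def u0_def Xs_def)
  have "asg V srt K u0"
    using valuation_closed[OF KM u] pr_valuation[OF KM u] sO
    by (auto simp: asg_def u0_def Xs_def Id_in_Hom dg_def)
  moreover have "sats srt R K u0"
  proof -
    have "ev K u b w = ev K (ext K u0) b w" if "b \<in> Obj A" "w \<in> terms V srt b" for b w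
      by (rule ev_cong[of w b]) (use that u0 in \<open>simp_all add: lists_Xs\<close>)
    moreover have "ev K u b w = ev K u b w'" if "(b, w, w') \<in> R" for b w w'
      using s that by (auto simp: sat_def)
    ultimately show ?thesis using wf_presD(3-5)[OF wf] by (intro satsI) (metis tev)
  qed
  moreover have "\<exists>!f. f \<in> Hom M K E \<and> (\<forall>v \<in> V. f (fst (srt v)) (u0 v) = e v)"
    if E: "E \<in> Obj M" and e: "asg V srt E e" "sats srt R E e" for E e
  proof -
    have "valuation E (ext E e)"
      using E sO asgD[OF e(1)] by (auto simp: valuation_def ext_def rs_def dg_def Xs_def Res_Comp)
    then have "\<exists>!f. f \<in> Hom M K E \<and> (\<forall>b \<in> Obj A. \<forall>x \<in> Xs b. f b (u b x) = ext E e b x)"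
      using K E e sat unfolding presented_def by blast
    moreover have "(\<forall>b \<in> Obj A. \<forall>x \<in> Xs b. f b (u b x) = ext E e b x) \<longleftrightarrow> (\<forall>v \<in> V. f (fst (srt v)) (u0 v) = e v)"
      if f: "f \<in> Hom M K E" for f
    proof
      assume l: "\<forall>b \<in> Obj A. \<forall>x \<in> Xs b. f b (u b x) = ext E e b x"
      show "\<forall>v \<in> V. f (fst (srt v)) (u0 v) = e v"
      proof
        fix v assume v: "v \<in> V"
        then have "f (fst (srt v)) (u0 v) = ext E e (fst (srt v)) (v, Id A (fst (srt v)))"
          unfolding u0_def using l sO by (simp add: Xs_def Id_in_Hom)
        then show "f (fst (srt v)) (u0 v) = e v" using v E sO asgD[OF e(1) v] by (simp add: ext_def)
      qed
    next
      assume r: "\<forall>v \<in> V. f (fst (srt v)) (u0 v) = e v"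
      show "\<forall>b \<in> Obj A. \<forall>x \<in> Xs b. f b (u b x) = ext E e b x"
      proof (intro ballI)
        fix b x assume b: "b \<in> Obj A" "x \<in> Xs b"
        then obtain v \<phi> where x: "x = (v, \<phi>)" "v \<in> V" "\<phi> \<in> Hom A b (fst (srt v))" by (auto simp: Xs_def)
        have "u0 v \<in> Sec (psh K) (fst (srt v))" using asgD[OF \<open>asg V srt K u0\<close> x(2)] by simp
        then show "f b (u b x) = ext E e b x"
          using u0[OF b] x r b sO M_Hom_Res[OF KM E f] by (simp add: ext_def)
      qed
    qed
    ultimately show ?thesis by (simp cong: conj_cong)
  qed
  ultimately show ?thesis unfolding fp_def using KM by blast
qed

text \<open>Allows a finite set of variables to be numbered, so that a small set of presentations on
  natural numbers covers all finite ones.\<close>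

lemma fp_rename:
  assumes fp: "fp V' srt' ((\<lambda>(b, w, w'). (b, map (apfst \<sigma>) w, map (apfst \<sigma>) w')) ` R) K u"
    and bij: "bij_betw \<sigma> V V'" and srt: "\<And>v. v \<in> V \<Longrightarrow> srt' (\<sigma> v) = srt v" and wf: "wf_pres V srt R"
  shows "fp V srt R K (\<lambda>v. u (\<sigma> v))"
proof -
  have tev: "tev srt' E e b (map (apfst \<sigma>) w) = tev srt E (\<lambda>v. e (\<sigma> v)) b w" if "w \<in> terms V srt b" for E e b w
    using that unfolding terms_def by (induction w) (auto simp: srt)
  have sats: "sats srt' ((\<lambda>(b, w, w'). (b, map (apfst \<sigma>) w, map (apfst \<sigma>) w')) ` R) E e \<longleftrightarrow> sats srt R E (\<lambda>v. e (\<sigma> v))" for E e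
  proof
    assume s: "sats srt' ((\<lambda>(b, w, w'). (b, map (apfst \<sigma>) w, map (apfst \<sigma>) w')) ` R) E e"
    show "sats srt R E (\<lambda>v. e (\<sigma> v))"
    proof (rule satsI)
      fix b w w' assume r: "(b, w, w') \<in> R"
      have "(b, map (apfst \<sigma>) w, map (apfst \<sigma>) w') \<in> (\<lambda>(b, w, w'). (b, map (apfst \<sigma>) w, map (apfst \<sigma>) w')) ` R"
        by (rule image_eqI[OF _ r]) simp
      from satsD[OF s this] show "tev srt E (\<lambda>v. e (\<sigma> v)) b w = tev srt E (\<lambda>v. e (\<sigma> v)) b w'"
        using wf_presD(4,5)[OF wf r] by (simp add: tev)
    qed
  next
    assume s: "sats srt R E (\<lambda>v. e (\<sigma> v))"
    show "sats srt' ((\<lambda>(b, w, w'). (b, map (apfst \<sigma>) w, map (apfst \<sigma>) w')) ` R) E e"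
    proof (rule satsI)
      fix b v v' assume "(b, v, v') \<in> (\<lambda>(b, w, w'). (b, map (apfst \<sigma>) w, map (apfst \<sigma>) w')) ` R"
      then obtain w w' where r: "(b, w, w') \<in> R" "v = map (apfst \<sigma>) w" "v' = map (apfst \<sigma>) w'" by auto
      then show "tev srt' E e b v = tev srt' E e b v'"
        using satsD[OF s r(1)] wf_presD(4,5)[OF wf r(1)] by (simp add: tev)
    qed
  qed
  have V': "V' = \<sigma> ` V" using bij by (simp add: bij_betw_def)
  have asg: "asg V' srt' E e \<longleftrightarrow> asg V srt E (\<lambda>v. e (\<sigma> v))" for E e
    by (simp add: asg_def V' srt)
  show ?thesis
    unfolding fp_def
  proof (intro conjI allI impI)
    show "K \<in> Obj M" "asg V srt K (\<lambda>v. u (\<sigma> v))" "sats srt R K (\<lambda>v. u (\<sigma> v))"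
      using fp asg sats by (auto simp: fp_def)
    fix E e assume *: "E \<in> Obj M \<and> asg V srt E e \<and> sats srt R E e"
    define e' where "e' n = e (inv_into V \<sigma> n)" for n
    have e': "e' (\<sigma> v) = e v" if "v \<in> V" for v
      using that bij by (simp add: e'_def bij_betw_def)
    have "asg V' srt' E e'" using * by (simp add: asg) (simp add: asg_def e')
    moreover have "sats srt R E (\<lambda>v. e' (\<sigma> v))" using * sats_cong[OF wf, of e "\<lambda>v. e' (\<sigma> v)"] e' by simp
    ultimately have "\<exists>!f. f \<in> Hom M K E \<and> (\<forall>v \<in> V'. f (fst (srt' v)) (u v) = e' v)"
      using fp * sats unfolding fp_def by blast
    then show "\<exists>!f. f \<in> Hom M K E \<and> (\<forall>v \<in> V. f (fst (srt v)) (u (\<sigma> v)) = e v)"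
      by (simp add: V' srt e')
  qed
qed

text \<open>The images of the generators under \<open>g\<close> satisfy the relations, so the
  uniqueness part of the universal property applies to this assignment and to both maps.\<close>

lemma fp_Hom_eqI:
  assumes fp: "fp V srt R K u" and wf: "wf_pres V srt R" and E: "E \<in> Obj M" and f: "f \<in> Hom M K E" and g: "g \<in> Hom M K E"
    and eq: "\<And>v. v \<in> V \<Longrightarrow> f (fst (srt v)) (u v) = g (fst (srt v)) (u v)"
  shows "f = g"
proof -
  have K: "K \<in> Obj M" and u: "asg V srt K u" "sats srt R K u" using fp by (auto simp: fp_def)
  have s: "srt ` V \<subseteq> sorts" using wf by (simp add: wf_pres_def)
  have "\<exists>!h. h \<in> Hom M K E \<and> (\<forall>v \<in> V. h (fst (srt v)) (u v) = g (fst (srt v)) (u v))"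
    using fp E hom_asg[OF K E g u(1) s] hom_sats[OF K E g u(1) wf u(2)] unfolding fp_def by blast
  then show ?thesis using f g eq by blast
qed

text \<open>A map is determined by its values on finitely many generators, so the hom-set embeds
  into lists over a small set. No power set is involved, hence regularity suffices.\<close>

lemma fp_small_Hom:
  assumes fp: "fp V srt R K u" and wf: "wf_pres V srt R" and V: "finite V" and E: "E \<in> Obj M"
  shows "small TYPE('u) (Hom M K E)"
proof -
  obtain vs where vs: "set vs = V" using finite_list[OF V] by blast
  have K: "K \<in> Obj M" and u: "asg V srt K u" using fp by (auto simp: fp_def)
  let ?h = "\<lambda>f. map (\<lambda>v. f (fst (srt v)) (u v)) vs"
  have inj: "inj_on ?h (Hom M K E)"
    by (rule inj_onI, rule fp_Hom_eqI[OF fp wf E]) (simp_all add: vs)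
  have sub: "?h ` Hom M K E \<subseteq> lists (\<Union>a\<in>Obj A. Sec (psh E) a)"
    using M_Hom_closed[OF K E] wf_presD(1)[OF wf] asgD[OF u] by (fastforce simp: vs)
  have sm: "small TYPE('u) (lists (\<Union>a\<in>Obj A. Sec (psh E) a))"
    using small_A E by (intro small_lists small_UN universe) (auto simp: small_category_def small_Sec)
  show ?thesis by (rule small_inj_onD[OF inj small_subset[OF sm sub]])
qed

end

section \<open>Maps from finitely presented objects into filtered colimits\<close>

context filtered_diagram begin

context
  fixes c \<iota> assumes col: "is_colimit J M D c \<iota>"
begin

lemma colimit_Obj: "c \<in> Obj M"
  and colimit_\<iota>: "i \<in> Obj J \<Longrightarrow> \<iota> i \<in> Hom M (D0 i) c"
  using col by (simp_all add: is_colimit_def cocone_def)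

lemma colimit_nat: "\<lbrakk>i \<in> Obj J; j \<in> Obj J; f \<in> Hom J i j; a \<in> Obj A; s \<in> Sec (psh (D0 i)) a\<rbrakk> \<Longrightarrow> \<iota> j a (D1 i j f a s) = \<iota> i a s"
proof -
  assume *: "i \<in> Obj J" "j \<in> Obj J" "f \<in> Hom J i j" "a \<in> Obj A" "s \<in> Sec (psh (D0 i)) a"
  then have "Comp M (D0 i) (D0 j) c (\<iota> j) (D1 i j f) = \<iota> i"
    using col unfolding is_colimit_def cocone_def by blast
  from fun_cong[OF fun_cong[OF this], of a s] show ?thesis using * by simp
qed

lemma colimit_surj:
  assumes "a \<in> Obj A" "z \<in> Sec (psh c) a"
  obtains i s where "i \<in> Obj J" "s \<in> Sec (psh (D0 i)) a" "z = \<iota> i a s"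
  using colimit_concrete[OF col] assms unfolding concrete_def by blast

text \<open>The pairs are merged one after another; equalities reached at a stage persist along all
  later arrows.\<close>

lemma colimit_sep_finite:
  assumes "finite Q" "k \<in> Obj J"
    and "\<And>b y y'. (b, y, y') \<in> Q \<Longrightarrow> b \<in> Obj A \<and> y \<in> Sec (psh (D0 k)) b \<and> y' \<in> Sec (psh (D0 k)) b \<and> \<iota> k b y = \<iota> k b y'"
  shows "\<exists>m \<in> Obj J. \<exists>h \<in> Hom J k m. \<forall>(b, y, y') \<in> Q. D1 k m h b y = D1 k m h b y'"
  using assms(1,3)
proof (induction Q)
  case empty
  then show ?case using assms(2) J.Id_in_Hom by auto
next
  case (insert q Q)
  obtain b y y' where q: "q = (b, y, y')" by (metis surj_pair)
  have b: "b \<in> Obj A" "y \<in> Sec (psh (D0 k)) b" "y' \<in> Sec (psh (D0 k)) b" "\<iota> k b y = \<iota> k b y'"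
    using insert.prems[of b y y'] by (simp_all add: q)
  have "\<exists>m \<in> Obj J. \<exists>h \<in> Hom J k m. \<forall>(b, y, y') \<in> Q. D1 k m h b y = D1 k m h b y'"
    using insert by blast
  then obtain m h where m: "m \<in> Obj J" "h \<in> Hom J k m" "\<And>b y y'. (b, y, y') \<in> Q \<Longrightarrow> D1 k m h b y = D1 k m h b y'"
    by blast
  have c: "D1 k m h b y \<in> Sec (psh (D0 m)) b" "D1 k m h b y' \<in> Sec (psh (D0 m)) b"
    using b m assms(2) by simp_all
  have "\<iota> m b (D1 k m h b y) = \<iota> m b (D1 k m h b y')"
    using b m assms(2) by (simp add: colimit_nat)
  then obtain n g where n: "n \<in> Obj J" "g \<in> Hom J m n" "D1 m n g b (D1 k m h b y) = D1 m n g b (D1 k m h b y')"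
    using colimit_concrete[OF col] b(1) m(1) c unfolding concrete_def by blast
  let ?h = "Comp J k m n g h"
  have "D1 k n ?h b' z = D1 k n ?h b' z'" if "(b', z, z') \<in> insert q Q" for b' z z'
  proof -
    have "b' \<in> Obj A \<and> z \<in> Sec (psh (D0 k)) b' \<and> z' \<in> Sec (psh (D0 k)) b' \<and> \<iota> k b' z = \<iota> k b' z'"
      using insert.prems that by blast
    then show ?thesis using that m n assms(2) by (auto simp: D1_Comp q)
  qed
  moreover have "?h \<in> Hom J k n" using m n assms(2) by (simp add: J.Comp_in_Hom)
  ultimately show ?case using n(1) by blast
qed

context
  fixes V srt R K u assumes fp: "fp V srt R K u" and wf: "wf_pres V srt R" and V: "finite V" and R: "finite R"
begin

private lemma K: "K \<in> Obj M" and u: "asg V srt K u" and su: "sats srt R K u"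
  and univ: "\<lbrakk>E \<in> Obj M; asg V srt E e; sats srt R E e\<rbrakk> \<Longrightarrow> \<exists>!f. f \<in> Hom M K E \<and> (\<forall>v \<in> V. f (fst (srt v)) (u v) = e v)"
  using fp unfolding fp_def by blast+

private lemmas sO = wf_presD(1,2)[OF wf]
private lemma sorts: "srt ` V \<subseteq> sorts" using wf by (simp add: wf_pres_def)

text \<open>The images of the finitely many generators lift to a common stage. The finitely many
  relations hold in the colimit, hence at some later stage, and there the universal property yields
  the factorisation.\<close>

lemma fp_hom_surj:
  assumes z: "z \<in> Hom M K c"
  shows "\<exists>i \<in> Obj J. \<exists>g \<in> Hom M K (D0 i). Comp M K (D0 i) c (\<iota> i) g = z"
proof -
  have zc: "z (fst (srt v)) (u v) \<in> Sec (psh c) (fst (srt v))" if "v \<in> V" for v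
    using M_Hom_closed[OF K colimit_Obj z] asgD[OF u that] sO[OF that] by simp
  have "\<exists>i s. i \<in> Obj J \<and> s \<in> Sec (psh (D0 i)) (fst (srt v)) \<and> z (fst (srt v)) (u v) = \<iota> i (fst (srt v)) s" if v: "v \<in> V" for v
    using colimit_surj[OF sO(1)[OF v] zc[OF v]] by metis
  then obtain i s where i: "\<And>v. v \<in> V \<Longrightarrow> i v \<in> Obj J" "\<And>v. v \<in> V \<Longrightarrow> s v \<in> Sec (psh (D0 (i v))) (fst (srt v))"
    "\<And>v. v \<in> V \<Longrightarrow> z (fst (srt v)) (u v) = \<iota> (i v) (fst (srt v)) (s v)"
    by metis
  obtain k where k: "k \<in> Obj J" "\<And>j. j \<in> i ` V \<Longrightarrow> Hom J j k \<noteq> {}"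
    by (rule filtered_natLeq_boundE[OF filtered_J, of "i ` V"]) (use V i(1) in auto)
  have "\<exists>p. p \<in> Hom J (i v) k" if "v \<in> V" for v using k(2)[of "i v"] that by auto
  then obtain p where p: "\<And>v. v \<in> V \<Longrightarrow> p v \<in> Hom J (i v) k" by metis
  define e where "e v = D1 (i v) k (p v) (fst (srt v)) (s v)" for v
  have ec: "e v \<in> Sec (psh (D0 k)) (fst (srt v))" if "v \<in> V" for v
    unfolding e_def using that i k(1) p sO by simp
  have \<iota>e: "\<iota> k (fst (srt v)) (e v) = z (fst (srt v)) (u v)" if "v \<in> V" for v
    unfolding e_def using that i k(1) p sO by (simp add: colimit_nat)
  have e: "asg V srt (D0 k) e"
    unfolding asg_def
  proof (intro ballI conjI ec)
    fix v assume v: "v \<in> V"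
    have "snd (D0 k) (fst (srt v)) (e v) = snd c (fst (srt v)) (\<iota> k (fst (srt v)) (e v))"
      using M_Hom_pr[OF D0[OF k(1)] colimit_Obj colimit_\<iota>[OF k(1)] sO(1)[OF v] ec[OF v]] by simp
    also have "\<dots> = snd (srt v)"
      using \<iota>e[OF v] M_Hom_pr[OF K colimit_Obj z sO(1)[OF v] asgD(1)[OF u v]] asgD(2)[OF u v] by simp
    finally show "snd (D0 k) (fst (srt v)) (e v) = snd (srt v)" .
  qed
  \<comment> \<open>The two sides of each relation, evaluated at stage \<open>k\<close>, where they
    need not agree yet.\<close>
  define Q where "Q = (\<lambda>(b, w, w'). (b, tev srt (D0 k) e b w, tev srt (D0 k) e b w')) ` R"
  have "\<exists>m \<in> Obj J. \<exists>h \<in> Hom J k m. \<forall>(b, y, y') \<in> Q. D1 k m h b y = D1 k m h b y'"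
  proof (rule colimit_sep_finite[OF _ k(1)])
    show "finite Q" unfolding Q_def using R by simp
    fix b y y' assume "(b, y, y') \<in> Q"
    then obtain w w' where r: "(b, w, w') \<in> R" and y: "y = tev srt (D0 k) e b w" "y' = tev srt (D0 k) e b w'"
      by (auto simp: Q_def)
    note t = wf_presD(3-5)[OF wf r]
    have eq: "\<iota> k b (tev srt (D0 k) e b w'') = z b (tev srt K u b w'')" if "w'' \<in> terms V srt b" for w''
    proof -
      have "\<iota> k b (tev srt (D0 k) e b w'') = tev srt c (\<lambda>v. \<iota> k (fst (srt v)) (e v)) b w''"
        by (rule hom_tev[OF D0[OF k(1)] colimit_Obj colimit_\<iota>[OF k(1)] e sorts t(1) that])
      also have "\<dots> = tev srt c (\<lambda>v. z (fst (srt v)) (u v)) b w''"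
        by (rule tev_cong[OF that]) (rule \<iota>e)
      also have "\<dots> = z b (tev srt K u b w'')"
        by (rule hom_tev[OF K colimit_Obj z u sorts t(1) that, symmetric])
      finally show ?thesis .
    qed
    have "tev srt K u b w = tev srt K u b w'" by (rule satsD[OF su r])
    then show "b \<in> Obj A \<and> y \<in> Sec (psh (D0 k)) b \<and> y' \<in> Sec (psh (D0 k)) b \<and> \<iota> k b y = \<iota> k b y'"
      using t eq tev_closed[OF D0[OF k(1)] e sorts t(1)] by (simp add: y)
  qed
  then obtain m h where m: "m \<in> Obj J" "h \<in> Hom J k m" "\<And>b y y'. (b, y, y') \<in> Q \<Longrightarrow> D1 k m h b y = D1 k m h b y'"
    by blast
  note Dh = D1[OF k(1) m(1,2)]
  let ?e = "\<lambda>v. D1 k m h (fst (srt v)) (e v)"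
  have e': "asg V srt (D0 m) ?e" by (rule hom_asg[OF D0[OF k(1)] D0[OF m(1)] Dh e sorts])
  have "sats srt R (D0 m) ?e"
  proof (rule satsI)
    fix b w w' assume r: "(b, w, w') \<in> R"
    note t = wf_presD(3-5)[OF wf r]
    have "(b, tev srt (D0 k) e b w, tev srt (D0 k) e b w') \<in> Q" using r by (force simp: Q_def)
    from m(3)[OF this] show "tev srt (D0 m) ?e b w = tev srt (D0 m) ?e b w'"
      using hom_tev[OF D0[OF k(1)] D0[OF m(1)] Dh e sorts t(1)] t by simp
  qed
  then obtain g where g: "g \<in> Hom M K (D0 m)" "\<And>v. v \<in> V \<Longrightarrow> g (fst (srt v)) (u v) = ?e v"
    using univ[OF D0[OF m(1)] e'] by blast
  have cH: "Comp M K (D0 m) c (\<iota> m) g \<in> Hom M K c"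
    by (rule category.Comp_in_Hom[OF category_M K D0[OF m(1)] colimit_Obj g(1) colimit_\<iota>[OF m(1)]])
  have "Comp M K (D0 m) c (\<iota> m) g = z"
  proof (rule fp_Hom_eqI[OF fp wf colimit_Obj cH z])
    fix v assume v: "v \<in> V"
    show "Comp M K (D0 m) c (\<iota> m) g (fst (srt v)) (u v) = z (fst (srt v)) (u v)"
      using sO[OF v] asgD[OF u v] g(2)[OF v] \<iota>e[OF v] ec[OF v] k(1) m(1,2) by (simp add: colimit_nat)
  qed
  then show ?thesis using m(1) g(1) by blast
qed

text \<open>The two maps agree in the colimit on finitely many generators, so they agree on them at
  some later stage, and generators determine maps.\<close>

lemma fp_hom_sep:
  assumes i: "i \<in> Obj J" and g: "g \<in> Hom M K (D0 i)" "g' \<in> Hom M K (D0 i)"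
    and eq: "Comp M K (D0 i) c (\<iota> i) g = Comp M K (D0 i) c (\<iota> i) g'"
  shows "\<exists>k \<in> Obj J. \<exists>f \<in> Hom J i k. Comp M K (D0 i) (D0 k) (D1 i k f) g = Comp M K (D0 i) (D0 k) (D1 i k f) g'"
proof -
  define Q where "Q = (\<lambda>v. (fst (srt v), g (fst (srt v)) (u v), g' (fst (srt v)) (u v))) ` V"
  have "\<exists>m \<in> Obj J. \<exists>h \<in> Hom J i m. \<forall>(b, y, y') \<in> Q. D1 i m h b y = D1 i m h b y'"
  proof (rule colimit_sep_finite[OF _ i])
    show "finite Q" unfolding Q_def using V by simp
    fix b y y' assume "(b, y, y') \<in> Q"
    then obtain v where v: "v \<in> V" "b = fst (srt v)" "y = g (fst (srt v)) (u v)" "y' = g' (fst (srt v)) (u v)"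
      by (auto simp: Q_def)
    have "\<iota> i b y = \<iota> i b y'"
      using fun_cong[OF fun_cong[OF eq], of b "u v"] v sO[OF v(1)] asgD[OF u v(1)] by simp
    then show "b \<in> Obj A \<and> y \<in> Sec (psh (D0 i)) b \<and> y' \<in> Sec (psh (D0 i)) b \<and> \<iota> i b y = \<iota> i b y'"
      using v sO[OF v(1)] asgD[OF u v(1)] M_Hom_closed[OF K D0[OF i]] g by simp
  qed
  then obtain m h where m: "m \<in> Obj J" "h \<in> Hom J i m" "\<And>b y y'. (b, y, y') \<in> Q \<Longrightarrow> D1 i m h b y = D1 i m h b y'"
    by blast
  note Dh = D1[OF i m(1,2)]
  have cH: "Comp M K (D0 i) (D0 m) (D1 i m h) f \<in> Hom M K (D0 m)" if "f \<in> Hom M K (D0 i)" for f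
    by (rule category.Comp_in_Hom[OF category_M K D0[OF i] D0[OF m(1)] that Dh])
  have "Comp M K (D0 i) (D0 m) (D1 i m h) g = Comp M K (D0 i) (D0 m) (D1 i m h) g'"
  proof (rule fp_Hom_eqI[OF fp wf D0[OF m(1)] cH[OF g(1)] cH[OF g(2)]])
    fix v assume v: "v \<in> V"
    have "(fst (srt v), g (fst (srt v)) (u v), g' (fst (srt v)) (u v)) \<in> Q" using v by (simp add: Q_def)
    from m(3)[OF this] show "Comp M K (D0 i) (D0 m) (D1 i m h) g (fst (srt v)) (u v) = Comp M K (D0 i) (D0 m) (D1 i m h) g' (fst (srt v)) (u v)"
      using sO[OF v] asgD[OF u v] by simp
  qed
  then show ?thesis using m(1,2) by blast
qed

text \<open>\<open>fp_hom_surj\<close> and \<open>fp_hom_sep\<close> are the elementwise criterion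
  for the hom-sets; from it the universal property in sets follows as in
  \<open>concrete_is_colimit_C\<close>.\<close>

lemma fp_hom_preserves:
  "is_colimit J (set_cat TYPE('u)) (comp_func (hom_func M K) D) (FObj (hom_func M K) c)
     (\<lambda>i. FArr (hom_func M K) (D0 i) c (\<iota> i))"
proof -
  let ?S = "set_cat TYPE('u)" and ?H = "hom_func M K"
  let ?X = "\<lambda>i. Hom M K (D0 i)" and ?D = "\<lambda>i j f g. Comp M K (D0 i) (D0 j) (D1 i j f) g"
    and ?\<iota> = "\<lambda>i g. Comp M K (D0 i) c (\<iota> i) g"
  interpret M: category M by (rule category_M)
  have H: "is_functor M ?S ?H"
    by (rule is_functor_hom_func[OF category_M K fp_small_Hom[OF fp wf V]])
  have cc: "cocone J ?S (comp_func ?H D) (FObj ?H c) (\<lambda>i. FArr ?H (D0 i) c (\<iota> i))"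
    by (rule functor_cocone[OF H functor_D]) (use col in \<open>simp add: is_colimit_def\<close>)
  have Dc: "?D i j f g \<in> ?X j" if "i \<in> Obj J" "j \<in> Obj J" "f \<in> Hom J i j" "g \<in> ?X i" for i j f g
    by (rule M.Comp_in_Hom[OF K D0[OF that(1)] D0[OF that(2)] that(4) D1[OF that(1-3)]])
  have \<iota>c: "?\<iota> i g \<in> Hom M K c" if "i \<in> Obj J" "g \<in> ?X i" for i g
    by (rule M.Comp_in_Hom[OF K D0[OF that(1)] colimit_Obj that(2) colimit_\<iota>[OF that(1)]])
  have \<iota>n: "?\<iota> j (?D i j f g) = ?\<iota> i g" if "i \<in> Obj J" "j \<in> Obj J" "f \<in> Hom J i j" "g \<in> ?X i" for i j f g
  proof -
    have "Comp M (D0 i) (D0 j) c (\<iota> j) (D1 i j f) = \<iota> i"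
      using col that unfolding is_colimit_def cocone_def by blast
    then show ?thesis
      using M.Comp_assoc[OF K D0[OF that(1)] D0[OF that(2)] colimit_Obj that(4) D1[OF that(1-3)] colimit_\<iota>[OF that(2)]] by simp
  qed
  show ?thesis
    unfolding is_colimit_def
  proof (intro conjI allI impI cc)
    fix Z \<kappa> assume cZ: "cocone J ?S (comp_func ?H D) Z \<kappa>"
    have Z: "small TYPE('u) Z" and \<kappa>: "\<And>i. i \<in> Obj J \<Longrightarrow> \<kappa> i \<in> ?X i \<rightarrow>\<^sub>E Z"
      using cZ by (simp_all add: cocone_def set_cat_def comp_func_def hom_func_def)
    have \<kappa>n: "\<kappa> j (?D i j f g) = \<kappa> i g" if "i \<in> Obj J" "j \<in> Obj J" "f \<in> Hom J i j" "g \<in> ?X i" for i j f g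
    proof -
      have "Comp ?S (FObj (comp_func ?H D) i) (FObj (comp_func ?H D) j) Z (\<kappa> j) (FArr (comp_func ?H D) i j f) = \<kappa> i"
        using cZ that unfolding cocone_def by blast
      from fun_cong[OF this, of g] show ?thesis
        using that by (simp add: comp_func_def hom_func_def set_cat_Comp_apply)
    qed
    have wd: "\<kappa> i g = \<kappa> j g'" if "i \<in> Obj J" "j \<in> Obj J" "g \<in> ?X i" "g' \<in> ?X j" "?\<iota> i g = ?\<iota> j g'" for i j g g'
      by (rule filtered_cocone_compat[OF filtered_J, where X = ?X and D = ?D and \<iota> = ?\<iota> and \<kappa> = \<kappa>,
            OF Dc \<iota>n fp_hom_sep \<kappa>n that])
    define f where "f = (\<lambda>z \<in> Hom M K c. SOME v. \<exists>i \<in> Obj J. \<exists>g \<in> ?X i. ?\<iota> i g = z \<and> v = \<kappa> i g)"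
    have f\<iota>: "f (?\<iota> i g) = \<kappa> i g" if i: "i \<in> Obj J" "g \<in> ?X i" for i g
    proof -
      have "(SOME v. \<exists>j \<in> Obj J. \<exists>g' \<in> ?X j. ?\<iota> j g' = ?\<iota> i g \<and> v = \<kappa> j g') = \<kappa> i g"
      proof (rule some_equality)
        show "\<exists>j \<in> Obj J. \<exists>g' \<in> ?X j. ?\<iota> j g' = ?\<iota> i g \<and> \<kappa> i g = \<kappa> j g'" using i by blast
        fix v assume "\<exists>j \<in> Obj J. \<exists>g' \<in> ?X j. ?\<iota> j g' = ?\<iota> i g \<and> v = \<kappa> j g'"
        then obtain j g' where "j \<in> Obj J" "g' \<in> ?X j" "?\<iota> j g' = ?\<iota> i g" "v = \<kappa> j g'" by blast
        then show "v = \<kappa> i g" using wd[of j i g' g] i by simp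
      qed
      then show ?thesis using \<iota>c[OF i] by (simp only: f_def restrict_apply')
    qed
    have f: "f \<in> Hom M K c \<rightarrow>\<^sub>E Z"
    proof (rule PiE_I)
      fix z assume "z \<in> Hom M K c"
      then obtain i g where i: "i \<in> Obj J" "g \<in> ?X i" "?\<iota> i g = z" using fp_hom_surj by blast
      then show "f z \<in> Z" using f\<iota>[OF i(1,2)] \<kappa>[OF i(1)] by auto
    qed (simp add: f_def)
    have iff: "Comp ?S (?X i) (Hom M K c) Z h (FArr ?H (D0 i) c (\<iota> i)) = \<kappa> i \<longleftrightarrow> (\<forall>g \<in> ?X i. h (?\<iota> i g) = \<kappa> i g)"
      if i: "i \<in> Obj J" for h i
    proof
      assume eq: "Comp ?S (?X i) (Hom M K c) Z h (FArr ?H (D0 i) c (\<iota> i)) = \<kappa> i"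
      show "\<forall>g \<in> ?X i. h (?\<iota> i g) = \<kappa> i g"
      proof
        fix g assume "g \<in> ?X i"
        then show "h (?\<iota> i g) = \<kappa> i g"
          using fun_cong[OF eq, of g] by (simp add: set_cat_Comp_apply hom_func_def)
      qed
    next
      assume *: "\<forall>g \<in> ?X i. h (?\<iota> i g) = \<kappa> i g"
      show "Comp ?S (?X i) (Hom M K c) Z h (FArr ?H (D0 i) c (\<iota> i)) = \<kappa> i"
        by (rule extensionalityI[of _ "?X i"])
          (use * \<kappa>[OF i] in \<open>auto simp: set_cat_def hom_func_def compose_def PiE_iff\<close>)
    qed
    show "\<exists>!f. f \<in> Hom ?S (FObj ?H c) Z \<and>
       (\<forall>i \<in> Obj J. Comp ?S (FObj (comp_func ?H D) i) (FObj ?H c) Z f (FArr ?H (D0 i) c (\<iota> i)) = \<kappa> i)"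
    proof (rule ex1I[of _ f])
      show "f \<in> Hom ?S (FObj ?H c) Z \<and>
       (\<forall>i \<in> Obj J. Comp ?S (FObj (comp_func ?H D) i) (FObj ?H c) Z f (FArr ?H (D0 i) c (\<iota> i)) = \<kappa> i)"
      proof
        show "f \<in> Hom ?S (FObj ?H c) Z" using f by (simp add: set_cat_def hom_func_def)
        show "\<forall>i \<in> Obj J. Comp ?S (FObj (comp_func ?H D) i) (FObj ?H c) Z f (FArr ?H (D0 i) c (\<iota> i)) = \<kappa> i"
        proof
          fix i assume i: "i \<in> Obj J"
          have o: "FObj (comp_func ?H D) i = ?X i" "FObj ?H c = Hom M K c" by (simp_all add: comp_func_def hom_func_def)
          show "Comp ?S (FObj (comp_func ?H D) i) (FObj ?H c) Z f (FArr ?H (D0 i) c (\<iota> i)) = \<kappa> i"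
            unfolding o iff[OF i] using f\<iota>[OF i] by blast
        qed
      qed
    next
      fix h assume h: "h \<in> Hom ?S (FObj ?H c) Z \<and>
       (\<forall>i \<in> Obj J. Comp ?S (FObj (comp_func ?H D) i) (FObj ?H c) Z h (FArr ?H (D0 i) c (\<iota> i)) = \<kappa> i)"
      have o: "FObj (comp_func ?H D) i = ?X i" "FObj ?H c = Hom M K c" for i by (simp_all add: comp_func_def hom_func_def)
      have hP: "h \<in> Hom M K c \<rightarrow>\<^sub>E Z" using h by (simp add: set_cat_def hom_func_def)
      show "h = f"
      proof (rule PiE_ext[OF hP f])
        fix z assume "z \<in> Hom M K c"
        then obtain i g where i: "i \<in> Obj J" "g \<in> ?X i" "?\<iota> i g = z" using fp_hom_surj by blast
        have "h (?\<iota> i g) = \<kappa> i g" using h i iff[OF i(1), of h] unfolding o by blast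
        then show "h z = f z" using f\<iota>[OF i(1,2)] i(3) by metis
      qed
    qed
  qed
qed

end

end

end

context crossed_group_over begin

text \<open>\<open>r\<close> is any copy of the countable cardinal, because local presentability
  takes one carried by \<open>'u\<close>.\<close>

lemma fp_presentable:
  assumes fp: "fp V srt R K u" and wf: "wf_pres V srt R" and V: "finite V" and R: "finite R" and r: "r =o natLeq"
  shows "presentable TYPE('u) r M K"
proof -
  have K: "K \<in> Obj M" using fp by (simp add: fp_def)
  have H: "is_functor M (set_cat TYPE('u)) (hom_func M K)"
    by (rule is_functor_hom_func[OF category_M K fp_small_Hom[OF fp wf V]])
  show ?thesis
    unfolding presentable_def preserves_filtered_colimits_def
  proof (intro conjI allI impI K H, elim conjE)
    fix J :: "('u, 'u) cat" and D c \<iota>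
    assume J: "small_category TYPE('u) J" and fil: "filtered r J" and D: "is_functor J M D"
      and c: "is_colimit J M D c \<iota>"
    interpret filtered_diagram A G T J D
      by unfold_locales (use D J fil filtered_ordIso[OF r, of J] in \<open>simp_all add: small_category_def\<close>)
    show "is_colimit J (set_cat TYPE('u)) (comp_func (hom_func M K) D) (FObj (hom_func M K) c)
      (\<lambda>i. FArr (hom_func M K) (FObj D i) c (\<iota> i))"
      by (rule fp_hom_preserves[OF c fp wf V R])
  qed
qed

end

section \<open>Local presentability\<close>

context crossed_group_over begin

text \<open>Hom-sets may overlap; their union serves to bound the letters that can occur in
  terms.\<close>

definition mors where "mors = (\<Union>a\<in>Obj A. \<Union>b\<in>Obj A. Hom A a b)"

lemma small_mors: "small TYPE('u) mors"
  unfolding mors_def using small_A by (intro small_UN universe) (auto simp: small_category_def locally_small_def)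

lemma small_sorts: "small TYPE('u) sorts"
  unfolding sorts_def using small_A crs_presheaf
  by (intro small_Sigma universe) (auto simp: small_category_def is_presheaf_def)

lemma terms_subset:
  assumes "srt ` V \<subseteq> sorts" "b \<in> Obj A"
  shows "terms V srt b \<subseteq> lists (V \<times> mors)"
  unfolding terms_def using assms by (intro lists_mono) (fastforce simp: sorts_def mors_def)

lemma small_presentations:
  assumes "small TYPE('u) V"
  shows "small TYPE('u) {R. R \<subseteq> Obj A \<times> lists (V \<times> mors) \<times> lists (V \<times> mors) \<and> finite R}"
  using small_A by (intro small_finite_subsets small_Sigma small_lists assms small_mors universe)
    (auto simp: small_category_def)

lemma wf_pres_subset:
  assumes "wf_pres V srt R"
  shows "R \<subseteq> Obj A \<times> lists (V \<times> mors) \<times> lists (V \<times> mors)"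
proof
  fix q assume q: "q \<in> R"
  obtain b w w' where bw: "q = (b, w, w')" by (metis surj_pair)
  have "srt ` V \<subseteq> sorts" using assms by (simp add: wf_pres_def)
  then show "q \<in> Obj A \<times> lists (V \<times> mors) \<times> lists (V \<times> mors)"
    using wf_presD(3-5)[OF assms q[unfolded bw]] terms_subset[of srt V b] by (auto simp: bw)
qed

text \<open>Variables are positions in a list \<open>L\<close> of sorts. This normal form has only a
  small set of instances, and one object is chosen for each of them.\<close>

definition fp_obj :: "('o \<times> 'u) list \<times> ('o \<times> (nat \<times> 'm) list \<times> (nat \<times> 'm) list) set \<Rightarrow>
    ('o, 'm, 'u) crs_monoid \<times> ('o \<Rightarrow> 'u \<Rightarrow> 'u)" where
  "fp_obj = (\<lambda>(L, R). SOME K. \<exists>u. fp {..<length L} ((!) L) R K u)"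

definition fp_set where
  "fp_set = fp_obj ` {(L, R). L \<in> lists sorts \<and> finite R \<and> wf_pres {..<length L} ((!) L) R}"

lemma fp_set_fp:
  assumes "K \<in> fp_set"
  shows "\<exists>L R u. finite R \<and> wf_pres {..<length L} ((!) L) R \<and> fp {..<length L} ((!) L) R K u"
proof -
  obtain L R where K: "K = fp_obj (L, R)" and *: "finite R" "wf_pres {..<length L} ((!) L) R"
    using assms by (auto simp: fp_set_def)
  have "\<exists>K u. fp {..<length L} ((!) L) R K u"
    by (rule fp_exists[OF small_finite[OF universe] *(2)]) simp
  then have "\<exists>u. fp {..<length L} ((!) L) R K u"
    unfolding K fp_obj_def prod.case by (rule someI_ex)
  then show ?thesis using * by blast
qed

lemma small_fp_set: "small TYPE('u) fp_set"
proof -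
  let ?W = "{R. R \<subseteq> Obj A \<times> lists ((UNIV :: nat set) \<times> mors) \<times> lists ((UNIV :: nat set) \<times> mors) \<and> finite R}"
  have "R \<in> ?W" if "finite R" "wf_pres (V :: nat set) srt R" for V srt R
  proof -
    have "lists (V \<times> mors) \<subseteq> lists (UNIV \<times> mors)" by (intro lists_mono) auto
    then show ?thesis using wf_pres_subset[OF that(2)] that(1) by blast
  qed
  then have "{(L, R). L \<in> lists sorts \<and> finite R \<and> wf_pres {..<length L} ((!) L) R} \<subseteq> lists sorts \<times> ?W"
    by blast
  moreover have "small TYPE('u) (lists sorts \<times> ?W)"
    by (intro small_Sigma small_lists small_sorts small_presentations[OF small_nat[OF universe]] universe)
  ultimately show ?thesis unfolding fp_set_def by (intro small_image) (rule small_subset)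
qed

text \<open>Numbering the variables brings the presentation into normal form, and
  \<open>fp_rename\<close> pulls the generators of the chosen object back along the
  numbering.\<close>

lemma fp_in_fp_set:
  assumes V: "finite V" and R: "finite R" and wf: "wf_pres V srt R"
  shows "\<exists>K \<in> fp_set. \<exists>u. fp V srt R K u"
proof -
  obtain vs where vs: "set vs = V" "distinct vs" using finite_distinct_list[OF V] by blast
  define L where "L = map srt vs"
  define \<sigma> where "\<sigma> = inv_into {..<length vs} ((!) vs)"
  have "bij_betw ((!) vs) {..<length vs} V"
    using bij_betw_nth[OF vs(2) refl vs(1)[symmetric]] .
  then have bij: "bij_betw \<sigma> V {..<length L}" and nth: "\<And>v. v \<in> V \<Longrightarrow> vs ! \<sigma> v = v"
    unfolding \<sigma>_def L_def by (auto intro: bij_betw_inv_into bij_betw_inv_into_right)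
  have \<sigma>: "\<sigma> v < length L" "L ! \<sigma> v = srt v" if "v \<in> V" for v
    using bij_betwE[OF bij] nth that by (auto simp: L_def)
  define R' where "R' = (\<lambda>(b, w, w'). (b, map (apfst \<sigma>) w, map (apfst \<sigma>) w')) ` R"
  have L: "L \<in> lists sorts" using wf vs by (auto simp: wf_pres_def L_def)
  have t: "map (apfst \<sigma>) w \<in> terms {..<length L} ((!) L) b \<and> tdg ((!) L) b (map (apfst \<sigma>) w) = tdg srt b w"
    if "w \<in> terms V srt b" for b w
    using that unfolding terms_def by (induction w) (auto simp: \<sigma>)
  have wf': "wf_pres {..<length L} ((!) L) R'"
    unfolding wf_pres_def
  proof (intro conjI ballI)
    show "(!) L ` {..<length L} \<subseteq> sorts" using L by auto
    fix q assume "q \<in> R'"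
    then obtain b w w' where r: "(b, w, w') \<in> R" and q: "q = (b, map (apfst \<sigma>) w, map (apfst \<sigma>) w')"
      by (auto simp: R'_def)
    have "tdg srt b w = tdg srt b w'" using wf r by (auto simp: wf_pres_def)
    then show "case q of (b, w, w') \<Rightarrow> b \<in> Obj A \<and> w \<in> terms {..<length L} ((!) L) b \<and>
        w' \<in> terms {..<length L} ((!) L) b \<and> tdg ((!) L) b w = tdg ((!) L) b w'"
      using t wf_presD(3-5)[OF wf r] by (simp add: q)
  qed
  have R': "finite R'" using R by (simp add: R'_def)
  have "\<exists>K u. fp {..<length L} ((!) L) R' K u"
    by (rule fp_exists[OF small_finite[OF universe] wf']) simp
  then have "\<exists>u. fp {..<length L} ((!) L) R' (fp_obj (L, R')) u"
    unfolding fp_obj_def prod.case by (rule someI_ex)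
  then obtain u where u: "fp {..<length L} ((!) L) R' (fp_obj (L, R')) u" by blast
  have "fp V srt R (fp_obj (L, R')) (\<lambda>v. u (\<sigma> v))"
    by (rule fp_rename[OF u[unfolded R'_def] bij _ wf, folded R'_def]) (rule \<sigma>)
  moreover have "fp_obj (L, R') \<in> fp_set" unfolding fp_set_def using L R' wf' by blast
  ultimately show ?thesis by blast
qed

lemma terms_mono: "V \<subseteq> V' \<Longrightarrow> terms V srt b \<subseteq> terms V' srt b"
  unfolding terms_def by (intro lists_mono Sigma_mono) simp_all

lemma wf_pres_UN:
  assumes "\<And>i. i \<in> S \<Longrightarrow> wf_pres (V i) srt (R i)"
  shows "wf_pres (\<Union>i\<in>S. V i) srt (\<Union>i\<in>S. R i)"
  unfolding wf_pres_def
proof (intro conjI ballI)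
  show "srt ` (\<Union>i\<in>S. V i) \<subseteq> sorts" using assms unfolding wf_pres_def by blast
  fix q assume "q \<in> (\<Union>i\<in>S. R i)"
  then obtain i where i: "i \<in> S" "q \<in> R i" by blast
  obtain b w w' where q: "q = (b, w, w')" by (metis surj_pair)
  have "tdg srt b w = tdg srt b w'" using assms[OF i(1)] i(2) by (auto simp: wf_pres_def q)
  moreover have "terms (V i) srt b \<subseteq> terms (\<Union>i\<in>S. V i) srt b" by (rule terms_mono) (use i in blast)
  ultimately show "case q of (b, w, w') \<Rightarrow> b \<in> Obj A \<and> w \<in> terms (\<Union>i\<in>S. V i) srt b \<and>
      w' \<in> terms (\<Union>i\<in>S. V i) srt b \<and> tdg srt b w = tdg srt b w'"
    using wf_presD(3-5)[OF assms[OF i(1)] i(2)[unfolded q]] by (auto simp: q)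
qed

text \<open>The indices are ordered by inclusion of generators and relations. So parallel arrows are
  equal, and filteredness is closure under finite unions, as supplied by
  \<open>wf_pres_UN\<close>.\<close>

lemma filtered_colimit_of_fp:
  assumes x: "x \<in> Obj M"
  shows "\<exists>(J :: ('u, 'u) cat) D \<iota>. small_category TYPE('u) J \<and> filtered natLeq J \<and> is_functor J M D \<and>
     (\<forall>i \<in> Obj J. FObj D i \<in> fp_set) \<and> is_colimit J M D x \<iota>"
proof -
  define el where "el = Sigma (Obj A) (Sec (psh x))"
  define xs where "xs v = (fst v, snd x (fst v) (snd v))" for v
  have fst_xs [simp]: "fst (xs v) = fst v" for v by (simp add: xs_def)
  have el_sorts: "xs ` el \<subseteq> sorts" using x by (auto simp: el_def sorts_def xs_def)
  have asg0: "asg el xs x snd" by (auto simp: asg_def el_def xs_def)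
  have small_el: "small TYPE('u) el"
    unfolding el_def using small_A x by (intro small_Sigma universe) (auto simp: small_category_def small_Sec)
  define idx where "idx = {(V, R). V \<subseteq> el \<and> finite V \<and> finite R \<and> wf_pres V xs R \<and> sats xs R x snd}"
  have "small TYPE('u) idx"
  proof -
    let ?W = "{R. R \<subseteq> Obj A \<times> lists (el \<times> mors) \<times> lists (el \<times> mors) \<and> finite R}"
    have "R \<in> ?W" if "finite R" "wf_pres V xs R" "V \<subseteq> el" for V R
    proof -
      have "lists (V \<times> mors) \<subseteq> lists (el \<times> mors)" using that by (intro lists_mono) auto
      then show ?thesis using wf_pres_subset[OF that(2)] that(1) by blast
    qed
    then have "idx \<subseteq> {V. V \<subseteq> el \<and> finite V} \<times> ?W" unfolding idx_def by blast
    moreover have "small TYPE('u) ({V. V \<subseteq> el \<and> finite V} \<times> ?W)"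
      by (intro small_Sigma small_finite_subsets small_presentations small_el universe)
    ultimately show ?thesis using small_subset by blast
  qed
  \<comment> \<open>Index categories have objects in \<open>'u\<close>, so presentations are
    replaced by codes; \<open>V\<close> and \<open>R\<close> decode them.\<close>
  then obtain code :: "_ \<Rightarrow> 'u" where code: "inj_on code idx"
    using small_inj_into_universe by blast
  define I where "I = code ` idx"
  define V where "V i = fst (inv_into idx code i)" for i
  define R where "R i = snd (inv_into idx code i)" for i
  have small_I: "small TYPE('u) I" unfolding I_def by (rule small_image) fact
  have "(V i, R i) \<in> idx" if "i \<in> I" for i
    using inv_into_into[of i code idx] that by (simp add: V_def R_def I_def)
  then have V: "V i \<subseteq> el" and fin: "finite (V i)" "finite (R i)" and wf: "wf_pres (V i) xs (R i)"
    and true: "sats xs (R i) x snd" if "i \<in> I" for i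
    using that by (simp_all add: idx_def)
  have ex: "\<exists>i \<in> I. V i = V' \<and> R i = R'"
    if "V' \<subseteq> el" "finite V'" "finite R'" "wf_pres V' xs R'" "sats xs R' x snd" for V' R'
  proof -
    have "(V', R') \<in> idx" using that by (simp add: idx_def)
    then show ?thesis using code by (intro bexI[of _ "code (V', R')"]) (simp_all add: V_def R_def I_def)
  qed
  define Ku where "Ku i = (SOME Ku. fst Ku \<in> fp_set \<and> fp (V i) xs (R i) (fst Ku) (snd Ku))" for i
  define K where "K i = fst (Ku i)" for i
  define u where "u i = snd (Ku i)" for i
  have K: "K i \<in> fp_set" and fp: "fp (V i) xs (R i) (K i) (u i)" if i: "i \<in> I" for i
  proof -
    obtain K0 u0 where "K0 \<in> fp_set" "fp (V i) xs (R i) K0 u0"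
      using fp_in_fp_set[OF fin(1)[OF i] fin(2)[OF i] wf[OF i]] by blast
    then have "\<exists>Ku. fst Ku \<in> fp_set \<and> fp (V i) xs (R i) (fst Ku) (snd Ku)"
      by (intro exI[of _ "(K0, u0)"]) simp
    from someI_ex[OF this] show "K i \<in> fp_set" "fp (V i) xs (R i) (K i) (u i)"
      unfolding K_def u_def Ku_def by blast+
  qed
  have KM: "K i \<in> Obj M" and asgu: "asg (V i) xs (K i) (u i)" and satu: "sats xs (R i) (K i) (u i)" if "i \<in> I" for i
    using fp[OF that] by (simp_all add: fp_def)
  have univ: "\<exists>!f. f \<in> Hom M (K i) E \<and> (\<forall>v \<in> V i. f (fst v) (u i v) = e v)"
    if "i \<in> I" "E \<in> Obj M" "asg (V i) xs E e" "sats xs (R i) E e" for i E e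
    using fp[OF that(1)] that(2-4) unfolding fp_def fst_xs by blast
  have eqI: "f = g" if "i \<in> I" "E \<in> Obj M" "f \<in> Hom M (K i) E" "g \<in> Hom M (K i) E"
    "\<And>v. v \<in> V i \<Longrightarrow> f (fst v) (u i v) = g (fst v) (u i v)" for i E f g
    using fp_Hom_eqI[OF fp[OF that(1)] wf[OF that(1)] that(2-4)] that(5) by simp
  have uc: "u i v \<in> Sec (psh (K i)) (fst v)" "fst v \<in> Obj A" "snd v \<in> Sec (psh x) (fst v)" if "i \<in> I" "v \<in> V i" for i v
    using asgD(1)[OF asgu[OF that(1)] that(2)] V[OF that(1)] that(2) by (auto simp: el_def)
  define le where "le i j \<longleftrightarrow> V i \<subseteq> V j \<and> R i \<subseteq> R j" for i j
  define d where "d i j = (THE f. f \<in> Hom M (K i) (K j) \<and> (\<forall>v \<in> V i. f (fst v) (u i v) = u j v))" for i j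
  have d: "d i j \<in> Hom M (K i) (K j)" "\<And>v. v \<in> V i \<Longrightarrow> d i j (fst v) (u i v) = u j v" if "i \<in> I" "j \<in> I" "le i j" for i j
  proof -
    have "asg (V i) xs (K j) (u j)" "sats xs (R i) (K j) (u j)"
      using asgu[OF that(2)] satu[OF that(2)] that(3) unfolding le_def asg_def sats_def by blast+
    from theI'[OF univ[OF that(1) KM[OF that(2)] this]]
    show "d i j \<in> Hom M (K i) (K j)" "\<And>v. v \<in> V i \<Longrightarrow> d i j (fst v) (u i v) = u j v"
      unfolding d_def by blast+
  qed
  define \<iota> where "\<iota> i = (THE f. f \<in> Hom M (K i) x \<and> (\<forall>v \<in> V i. f (fst v) (u i v) = snd v))" for i
  have \<iota>: "\<iota> i \<in> Hom M (K i) x" "\<And>v. v \<in> V i \<Longrightarrow> \<iota> i (fst v) (u i v) = snd v" if "i \<in> I" for i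
  proof -
    have "asg (V i) xs x snd" using asg0 V[OF that] unfolding asg_def by blast
    from theI'[OF univ[OF that x this true[OF that]]]
    show "\<iota> i \<in> Hom M (K i) x" "\<And>v. v \<in> V i \<Longrightarrow> \<iota> i (fst v) (u i v) = snd v"
      unfolding \<iota>_def by blast+
  qed
  \<comment> \<open>The order as a thin category, whose only possible arrow is
    \<open>undefined\<close>.\<close>
  define J :: "('u, 'u) cat" where "J = \<lparr>Obj = I, Hom = (\<lambda>i j. if le i j then {undefined} else {}),
    Id = (\<lambda>i. undefined), Comp = (\<lambda>i j k g f. undefined)\<rparr>"
  define D where "D = \<lparr>FObj = K, FArr = (\<lambda>i j (f :: 'u). d i j)\<rparr>"
  have le_refl: "le i i" and le_trans: "le i j \<Longrightarrow> le j k \<Longrightarrow> le i k" for i j k by (auto simp: le_def)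
  have catJ: "category J"
    by unfold_locales (auto simp: J_def le_refl intro: le_trans split: if_splits)
  have ObjJ: "Obj J = I" by (simp add: J_def)
  have "locally_small TYPE('u) J"
    unfolding locally_small_def by (intro ballI small_finite[OF universe]) (simp add: J_def)
  then have "small_category TYPE('u) J"
    unfolding small_category_def using catJ small_I ObjJ by simp
  moreover have "filtered natLeq J"
    unfolding filtered_def
  proof (intro conjI allI ballI impI; (elim conjE)?)
    fix S assume S: "S \<subseteq> Obj J" "|S| <o natLeq"
    then have fS: "finite S" and SI: "\<And>i. i \<in> S \<Longrightarrow> i \<in> I" by (auto simp: finite_iff_ordLess_natLeq J_def)
    have "\<exists>c \<in> I. V c = (\<Union>i\<in>S. V i) \<and> R c = (\<Union>i\<in>S. R i)"
    proof (rule ex)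
      show "(\<Union>i\<in>S. V i) \<subseteq> el" using V SI by blast
      show "finite (\<Union>i\<in>S. V i)" "finite (\<Union>i\<in>S. R i)" using fin SI fS by blast+
      show "wf_pres (\<Union>i\<in>S. V i) xs (\<Union>i\<in>S. R i)" by (rule wf_pres_UN[OF wf[OF SI]])
      show "sats xs (\<Union>i\<in>S. R i) x snd" using true SI unfolding sats_def by blast
    qed
    then obtain c where c: "c \<in> I" "V c = (\<Union>i\<in>S. V i)" "R c = (\<Union>i\<in>S. R i)" by blast
    have "le i c" if "i \<in> S" for i unfolding le_def c(2,3) using that by blast
    then show "\<exists>c \<in> Obj J. \<forall>a \<in> S. Hom J a c \<noteq> {}" using c(1) by (auto simp: J_def)
  next
    fix a b F assume "b \<in> Obj J"
    then show "\<exists>c \<in> Obj J. \<exists>h \<in> Hom J b c. \<forall>f \<in> F. \<forall>g \<in> F. Comp J a b c h f = Comp J a b c h g"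
      by (intro bexI[of _ b] bexI[of _ undefined]) (simp_all add: J_def le_refl)
  qed
  moreover have functor_D: "is_functor J M D"
    unfolding is_functor_def
  proof (intro conjI ballI catJ category_M, goal_cases)
    case (1 i)
    then show ?case by (simp add: D_def J_def KM)
  next
    case (2 i j f)
    then show ?case by (simp add: D_def J_def d split: if_splits)
  next
    case (3 i)
    then have i: "i \<in> I" by (simp add: J_def)
    show ?case
      unfolding D_def func.select_convs
    proof (rule eqI[OF i KM[OF i] d(1)[OF i i le_refl] category.Id_in_Hom[OF category_M KM[OF i]]])
      fix v assume v: "v \<in> V i"
      show "d i i (fst v) (u i v) = Id M (K i) (fst v) (u i v)"
        using d(2)[OF i i le_refl v] uc[OF i v] by simp
    qed
  next
    case (4 i j k f g)
    then have I: "i \<in> I" "j \<in> I" "k \<in> I" and l: "le i j" "le j k" by (simp_all add: J_def split: if_splits)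
    note ik = le_trans[OF l]
    show ?case
      unfolding D_def func.select_convs
    proof (rule eqI[OF I(1) KM[OF I(3)] d(1)[OF I(1,3) ik]
          category.Comp_in_Hom[OF category_M KM[OF I(1)] KM[OF I(2)] KM[OF I(3)] d(1)[OF I(1,2) l(1)] d(1)[OF I(2,3) l(2)]]])
      fix v assume v: "v \<in> V i"
      then have "v \<in> V j" using l by (auto simp: le_def)
      then show "d i k (fst v) (u i v) = Comp M (K i) (K j) (K k) (d j k) (d i j) (fst v) (u i v)"
        using d(2)[OF I(1,2) l(1) v] d(2)[OF I(2,3) l(2)] d(2)[OF I(1,3) ik v] uc[OF I(1) v] by simp
    qed
  qed
  moreover have "\<forall>i \<in> Obj J. FObj D i \<in> fp_set" by (simp add: J_def D_def K)
  moreover have "is_colimit J M D x \<iota>"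
    unfolding is_colimit_def
  proof (intro conjI allI impI)
    show "cocone J M D x \<iota>"
      unfolding cocone_def
    proof (intro conjI ballI x)
      fix i assume "i \<in> Obj J"
      then show "\<iota> i \<in> Hom M (FObj D i) x" by (simp add: J_def D_def \<iota>)
    next
      fix i j f assume "i \<in> Obj J" "j \<in> Obj J" "f \<in> Hom J i j"
      then have I: "i \<in> I" "j \<in> I" and l: "le i j" by (simp_all add: J_def split: if_splits)
      show "Comp M (FObj D i) (FObj D j) x (\<iota> j) (FArr D i j f) = \<iota> i"
        unfolding D_def func.select_convs
      proof (rule eqI[OF I(1) x category.Comp_in_Hom[OF category_M KM[OF I(1)] KM[OF I(2)] x d(1)[OF I l] \<iota>(1)[OF I(2)]] \<iota>(1)[OF I(1)]])
        fix v assume v: "v \<in> V i"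
        then have "v \<in> V j" using l by (auto simp: le_def)
        then show "Comp M (K i) (K j) x (\<iota> j) (d i j) (fst v) (u i v) = \<iota> i (fst v) (u i v)"
          using d(2)[OF I l v] \<iota>(2)[OF I(1) v] \<iota>(2)[OF I(2)] uc[OF I(1) v] by simp
      qed
    qed
  next
    fix E \<kappa> assume cE: "cocone J M D E \<kappa>"
    have E: "E \<in> Obj M" and \<kappa>: "\<And>i. i \<in> I \<Longrightarrow> \<kappa> i \<in> Hom M (K i) E"
      using cE by (simp_all add: cocone_def J_def D_def)
    have \<kappa>_nat: "\<kappa> j (fst v) (u j v) = \<kappa> i (fst v) (u i v)" if I: "i \<in> I" "j \<in> I" and l: "le i j" and v: "v \<in> V i" for i j v
    proof -
      have "Comp M (K i) (K j) E (\<kappa> j) (d i j) = \<kappa> i"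
        using cE I l unfolding cocone_def J_def D_def by simp
      from fun_cong[OF fun_cong[OF this], of "fst v" "u i v"] show ?thesis
        using d(2)[OF I l v] uc[OF I(1) v] by simp
    qed
    \<comment> \<open>The presentation by \<open>v\<close> alone without relations lies below every
      index that contains \<open>v\<close>. So the cocone assigns one value to \<open>v\<close>, the
      same at all these indices.\<close>
    have "\<exists>i \<in> I. V i = {v} \<and> R i = {}" if "v \<in> el" for v
      by (rule ex) (use that el_sorts in \<open>auto simp: wf_pres_def sats_def\<close>)
    then obtain i0 where i0: "\<And>v. v \<in> el \<Longrightarrow> i0 v \<in> I \<and> V (i0 v) = {v} \<and> R (i0 v) = {}" by metis
    define e where "e v = \<kappa> (i0 v) (fst v) (u (i0 v) v)" for v
    have \<kappa>e: "\<kappa> i (fst v) (u i v) = e v" if "i \<in> I" "v \<in> V i" for i v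
    proof -
      have v: "v \<in> el" using V that by blast
      then have "le (i0 v) i" using i0[OF v] that by (simp add: le_def)
      then show ?thesis unfolding e_def using \<kappa>_nat[of "i0 v" i v] i0[OF v] that by simp
    qed
    have ec: "e v \<in> Sec (psh E) (fst v)" "snd E (fst v) (e v) = snd x (fst v) (snd v)" if v: "v \<in> el" for v
    proof -
      have i: "i0 v \<in> I" "v \<in> V (i0 v)" using i0[OF v] by simp_all
      show "e v \<in> Sec (psh E) (fst v)" "snd E (fst v) (e v) = snd x (fst v) (snd v)"
        unfolding e_def
        using M_Hom_closed[OF KM[OF i(1)] E \<kappa>[OF i(1)] uc(2,1)[OF i]] M_Hom_pr[OF KM[OF i(1)] E \<kappa>[OF i(1)] uc(2,1)[OF i]]
          asgD(2)[OF asgu[OF i(1)] i(2)] by (simp_all add: xs_def)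
    qed
    \<comment> \<open>A relation true in \<open>x\<close>, with the variables that occur in it, is
      itself an index, so every cocone respects it.\<close>
    have rel: "tev xs E e b w = tev xs E e b w'"
      if t: "b \<in> Obj A" "w \<in> terms el xs b" "w' \<in> terms el xs b" "tev xs x snd b w = tev xs x snd b w'" for b w w'
    proof -
      let ?V = "fst ` (set w \<union> set w')"
      have "\<exists>i \<in> I. V i = ?V \<and> R i = {(b, w, w')}"
      proof (rule ex)
        show V': "?V \<subseteq> el" using t(2,3) by (auto simp: terms_def)
        have "w \<in> terms ?V xs b" "w' \<in> terms ?V xs b"
          using t(2,3) by (auto simp: terms_def image_iff) (force, force)
        moreover have "tdg xs b w = tdg xs b w'"
          using tev_closed[OF x asg0 el_sorts t(1,2)] tev_closed[OF x asg0 el_sorts t(1,3)] t(4) by simp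
        ultimately show "wf_pres ?V xs {(b, w, w')}" using V' el_sorts t(1) by (auto simp: wf_pres_def)
        show "sats xs {(b, w, w')} x snd" using t(4) by (simp add: sats_def)
      qed simp_all
      then obtain i where i: "i \<in> I" "R i = {(b, w, w')}" by blast
      have "sats xs (R i) E (\<lambda>v. \<kappa> i (fst (xs v)) (u i v))"
        by (rule hom_sats[OF KM[OF i(1)] E \<kappa>[OF i(1)] asgu[OF i(1)] wf[OF i(1)] satu[OF i(1)]])
      then have "sats xs (R i) E e"
        by (rule sats_cong[OF wf[OF i(1)], rotated]) (simp add: \<kappa>e[OF i(1)])
      then show ?thesis using i(2) by (simp add: sats_def)
    qed
    have elI: "(a, s) \<in> el \<longleftrightarrow> a \<in> Obj A \<and> s \<in> Sec (psh x) a" for a s by (simp add: el_def)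
    define f where "f = psh_map A (psh x) (\<lambda>a s. e (a, s))"
    have ec': "e (a, s) \<in> Sec (psh E) a" "snd E a (e (a, s)) = snd x a s" if "a \<in> Obj A" "s \<in> Sec (psh x) a" for a s
      using ec[of "(a, s)"] that by (simp_all add: elI)
    have f: "f \<in> Hom M x E"
      unfolding f_def
    proof (rule psh_map_in_Hom_M[OF x E], goal_cases)
      \<comment> \<open>A variable with an identity arrow evaluates to the element itself, and the
        empty word to the unit. So preservation of restrictions, products and units are instances of
        \<open>rel\<close>.\<close>
      case (2 a b \<phi> s)
      then show ?case
        using rel[of a "[((a, Res (psh x) a b \<phi> s), Id A a)]" "[((b, s), \<phi>)]"] x E
        by (simp add: terms_def elI Id_in_Hom ec')
    next
      case (4 a s t)
      then show ?case
        using rel[of a "[((a, ml x a s t), Id A a)]" "[((a, s), Id A a), ((a, t), Id A a)]"] x E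
        by (simp add: terms_def elI Id_in_Hom ec')
    next
      case (5 a)
      then show ?case
        using rel[of a "[((a, un x a), Id A a)]" "[]"] x E
        by (simp add: terms_def elI Id_in_Hom ec')
    qed (simp_all add: ec')
    have fe: "f (fst v) (snd v) = e v" if "v \<in> el" for v
      using that by (auto simp: f_def el_def)
    show "\<exists>!f. f \<in> Hom M x E \<and> (\<forall>i \<in> Obj J. Comp M (FObj D i) x E f (\<iota> i) = \<kappa> i)"
    proof (rule ex1I[of _ f], intro conjI ballI f)
      fix i assume "i \<in> Obj J"
      then have i: "i \<in> I" by (simp add: J_def)
      show "Comp M (FObj D i) x E f (\<iota> i) = \<kappa> i"
        unfolding D_def func.select_convs
      proof (rule eqI[OF i E category.Comp_in_Hom[OF category_M KM[OF i] x E \<iota>(1)[OF i] f] \<kappa>[OF i]])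
        fix v assume v: "v \<in> V i"
        then have "v \<in> el" using V[OF i] by blast
        then show "Comp M (K i) x E f (\<iota> i) (fst v) (u i v) = \<kappa> i (fst v) (u i v)"
          using \<iota>(2)[OF i v] fe \<kappa>e[OF i v] uc[OF i v] by simp
      qed
    next
      fix g assume g: "g \<in> Hom M x E \<and> (\<forall>i \<in> Obj J. Comp M (FObj D i) x E g (\<iota> i) = \<kappa> i)"
      show "g = f"
      proof (rule M_Hom_eqI[OF x E _ f])
        fix a s assume as: "a \<in> Obj A" "s \<in> Sec (psh x) a"
        then have el: "(a, s) \<in> el" by (simp add: elI)
        let ?i = "i0 (a, s)"
        have i: "?i \<in> I" "(a, s) \<in> V ?i" using i0[OF el] by simp_all
        have "Comp M (K ?i) x E g (\<iota> ?i) = \<kappa> ?i" using g i(1) by (simp add: J_def D_def)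
        from fun_cong[OF fun_cong[OF this], of a "u ?i (a, s)"]
        show "g a s = f a s"
          using \<iota>(2)[OF i] uc[OF i] fe[OF el] by (simp add: e_def)
      qed (use g in blast)
    qed
  qed
  ultimately show ?thesis by blast
qed

lemma locally_presentable_M: "locally_presentable TYPE('u) M"
proof -
  \<comment> \<open>The image of the naturals in \<open>'u\<close> carries the required copy of the
    countable cardinal.\<close>
  obtain f :: "nat \<Rightarrow> 'u" where f: "inj f"
    using infinite_countable_subset[OF universe_infinite[OF universe]] by blast
  let ?r = "|range f|"
  have "|range f| =o |UNIV :: nat set|"
    using f by (meson bij_betw_def card_of_ordIsoI ordIso_symmetric)
  then have r: "?r =o natLeq" using card_of_nat ordIso_transitive by blast
  have "Card_order ?r" by (rule card_of_Card_order)
  moreover have "infinite (Field ?r)" using f by (simp add: Field_card_of finite_image_iff)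
  moreover have "regularCard ?r"
    using regularCard_ordIso[OF ordIso_symmetric[OF r] natLeq_Cinfinite regularCard_natLeq] .
  moreover have "?r <o |UNIV :: 'u set|"
    using r universe unfolding universe_def using ordIso_ordLess_trans by blast
  moreover have "fp_set \<subseteq> Obj M"
    using fp_set_fp unfolding fp_def by blast
  moreover have "presentable TYPE('u) ?r M K" if K: "K \<in> fp_set" for K
  proof -
    obtain L R u where "finite R" "wf_pres {..<length L} ((!) L) R" "fp {..<length L} ((!) L) R K u"
      using fp_set_fp[OF K] by blast
    then show ?thesis using r by (intro fp_presentable) auto
  qed
  moreover have "\<exists>(J :: ('u, 'u) cat) D \<iota>. small_category TYPE('u) J \<and> filtered ?r J \<and> is_functor J M D \<and>
     (\<forall>i \<in> Obj J. FObj D i \<in> fp_set) \<and> is_colimit J M D x \<iota>" if "x \<in> Obj M" for x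
    unfolding filtered_ordIso[OF r] by (rule filtered_colimit_of_fp[OF that])
  moreover have "cocomplete TYPE('u) M"
    unfolding cocomplete_def
  proof (intro allI impI)
    fix J :: "('u, 'u) cat" and D assume *: "small_category TYPE('u) J \<and> is_functor J M D"
    interpret diagram A G T J D
      by unfold_locales (use * in \<open>simp_all add: small_category_def\<close>)
    show "\<exists>c \<iota>. is_colimit J M D c \<iota>" by (rule colimit_exists)
  qed
  ultimately show ?thesis
    unfolding locally_presentable_def using category_M small_fp_set by blast
qed

text \<open>A map is determined by its graph, which is a subset of a small set; the strong limit
  condition bounds the set of all such subsets.\<close>

lemma locally_small_M:
  assumes "strong_limit TYPE('u)"
  shows "locally_small TYPE('u) M"
  unfolding locally_small_def
proof (intro ballI)
  fix E E' assume E: "E \<in> Obj M" "E' \<in> Obj M"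
  let ?h = "\<lambda>f. Sigma (Obj A) (\<lambda>a. (\<lambda>s. (s, f a s)) ` Sec (psh E) a)"
  let ?S = "Sigma (Obj A) (\<lambda>a. Sec (psh E) a \<times> Sec (psh E') a)"
  have "inj_on ?h (Hom M E E')"
  proof (rule inj_onI)
    fix f g assume f: "f \<in> Hom M E E'" and g: "g \<in> Hom M E E'" and eq: "?h f = ?h g"
    show "f = g"
    proof (rule M_Hom_eqI[OF E f g])
      fix a s assume "a \<in> Obj A" "s \<in> Sec (psh E) a"
      then have "(a, s, f a s) \<in> ?h f" by blast
      then show "f a s = g a s" unfolding eq by blast
    qed
  qed
  moreover have "?h ` Hom M E E' \<subseteq> Pow ?S"
    using M_Hom_closed[OF E] by blast
  moreover have "small TYPE('u) (Pow ?S)"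
    using small_A E by (intro small_Pow assms small_Sigma universe) (auto simp: small_category_def small_Sec)
  ultimately show "small TYPE('u) (Hom M E E')" by (blast intro: small_inj_onD small_subset)
qed

end

theorem theorem4p10:
  fixes A :: "('o, 'm) cat"
    and G T :: "('o, 'm, 'u) crs_group"
  assumes "universe TYPE('u)"
    and "small_category TYPE('u) A"
    and "terminal (crs_grp_cat A) T"
    and "crossed_group A G"
  shows "(\<exists>F \<eta> \<epsilon>.
            adjunction (set_over A G) (crs_mon_over A T G) F forget \<eta> \<epsilon> \<and>
            monadic (set_over A G) (crs_mon_over A T G) F forget \<eta> \<epsilon> \<and>
            finitary TYPE('u) (set_over A G) (comp_func forget F)) \<and>
         locally_presentable TYPE('u) (crs_mon_over A T G) \<and>
         (strong_limit TYPE('u) \<longrightarrow> locally_small TYPE('u) (crs_mon_over A T G))"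
proof -
  interpret crossed_group_over A G T
    using assms by (simp add: crossed_group_over_def crossed_group_over_axioms_def)
  show ?thesis
    using adjunction_exists monadic_forget finitary_forget locally_presentable_M locally_small_M by blast
qed

end
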